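(* Let $\gamma$ be a $(k-1)$-dimensional submanifold of the sphere at infinity of $\mathbb{H}^n$ (or of a geodesic sphere centred at the origin of the Poincaré ball model) such that, in the Poincaré model, the radial cone built upon $\gamma$ is Euclidean minimising. Then there is no minimal $k$-dimensional submanifold of $\mathbb{H}^n$ with ideal boundary (respectively boundary) $\gamma$.
   Context: The Poincaré model is the unit ball of $\mathbb{R}^n$ with metric $\frac{4}{(1-r^2)^2}g_E$, where $g_E$ is the Euclidean metric and $r$ the Euclidean distance to the origin. The radial cone built upon $\gamma$ is the union of the straight segments from the origin to the points of $\gamma$. Euclidean minimising means that the cone minimises the Euclidean $k$-volume among $k$-dimensional submanifolds with boundary $\gamma$. The ideal boundary of a submanifold is its boundary at infinity in the sphere at infinity.
   Formalization: Proved: no minimal submanifold other than the radial cone itself has (ideal) boundary γ; for a great sphere γ the cone is a flat, totally geodesic disc, so the literal claim fails. Having (ideal) boundary γ means that M with γ added is a compact embedded C¹ submanifold with boundary γ. *)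

theory Defs
  imports "HOL-Analysis.Analysis"
begin

section \<open>Embedded submanifolds of Euclidean space\<close>

definition C1_on :: "('a::real_normed_vector \<Rightarrow> 'b::real_normed_vector) \<Rightarrow> 'a set \<Rightarrow> bool" where
  "C1_on f U \<longleftrightarrow> (\<exists>f' :: 'a \<Rightarrow> ('a \<Rightarrow>\<^sub>L 'b).
     (\<forall>x\<in>U. (f has_derivative blinfun_apply (f' x)) (at x)) \<and> continuous_on U f')"

definition C1_diffeo_on :: "('a::euclidean_space \<Rightarrow> 'a) \<Rightarrow> 'a set \<Rightarrow> bool" where
  "C1_diffeo_on \<phi> W \<longleftrightarrow> open W \<and> open (\<phi> ` W) \<and> inj_on \<phi> W \<and>
     C1_on \<phi> W \<and> C1_on (inv_into W \<phi>) (\<phi> ` W)"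

text \<open>Slice charts: near each of its points, a \<open>d\<close>-dimensional embedded submanifold \<open>S\<close> with
  boundary \<open>B\<close> is straightened by a local diffeomorphism of the ambient space to an open part of
  a \<open>d\<close>-dimensional linear subspace \<open>L\<close> (points off \<open>B\<close>), or of the half-space of \<open>L\<close> cut out by
  a vector \<open>e\<close> (points of \<open>B\<close>). Neither \<open>S\<close> nor \<open>B\<close> is required to be closed.\<close>

definition submanifold_with_boundary ::
    "nat \<Rightarrow> 'a::euclidean_space set \<Rightarrow> 'a set \<Rightarrow> bool" where
  "submanifold_with_boundary d S B \<longleftrightarrow> B \<subseteq> S \<and>
     (\<forall>p\<in>S - B. \<exists>W \<phi> L. p \<in> W \<and> C1_diffeo_on \<phi> W \<and> subspace L \<and> dim L = d \<and>
        W \<inter> B = {} \<and> \<phi> ` (S \<inter> W) = \<phi> ` W \<inter> L) \<and>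
     (\<forall>p\<in>B. \<exists>W \<phi> L e. p \<in> W \<and> C1_diffeo_on \<phi> W \<and> subspace L \<and> dim L = d \<and>
        e \<in> L \<and> e \<noteq> 0 \<and>
        \<phi> ` (S \<inter> W) = \<phi> ` W \<inter> {y\<in>L. 0 \<le> e \<bullet> y} \<and>
        \<phi> ` (B \<inter> W) = \<phi> ` W \<inter> {y\<in>L. e \<bullet> y = 0})"

abbreviation submanifold :: "nat \<Rightarrow> 'a::euclidean_space set \<Rightarrow> bool" where
  "submanifold d S \<equiv> submanifold_with_boundary d S {}"

text \<open>In the next two definitions \<open>M\<close> is the submanifold without its boundary points, so that
  \<open>M \<union> \<gamma>\<close> is the submanifold with boundary.\<close>

definition has_boundary :: "nat \<Rightarrow> 'a::euclidean_space set \<Rightarrow> 'a set \<Rightarrow> bool" where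
  "has_boundary d M \<gamma> \<longleftrightarrow>
     M \<inter> \<gamma> = {} \<and> compact (M \<union> \<gamma>) \<and> submanifold_with_boundary d (M \<union> \<gamma>) \<gamma>"

text \<open>The sphere at infinity of the ball model is the unit sphere. As usual, having ideal boundary
  \<open>\<gamma>\<close> includes regularity up to infinity: the compactification \<open>M \<union> \<gamma>\<close> is a submanifold with
  boundary \<open>\<gamma>\<close>.\<close>

definition has_ideal_boundary :: "nat \<Rightarrow> 'a::euclidean_space set \<Rightarrow> 'a set \<Rightarrow> bool" where
  "has_ideal_boundary d M \<gamma> \<longleftrightarrow>
     M \<subseteq> ball 0 1 \<and> closure M \<inter> sphere 0 1 = \<gamma> \<and> has_boundary d M \<gamma>"

section \<open>Volume for a conformally Euclidean metric\<close>

definition C1_parametrisation :: "(real^'k \<Rightarrow> real^'n) \<Rightarrow> (real^'k) set \<Rightarrow> bool" where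
  "C1_parametrisation f U \<longleftrightarrow> open U \<and> C1_on f U \<and> inj_on f U \<and>
     (\<forall>u\<in>U. inj (frechet_derivative f (at u)))"

text \<open>The Riemannian volume density \<open>sqrt (det G)\<close> of the parametrisation \<open>f\<close>, where \<open>G\<close> is the
  pull-back under \<open>f\<close> of the metric \<open>h\<cdot>g\<^sub>E\<close>.\<close>

definition volume_density ::
    "(real^'n \<Rightarrow> real) \<Rightarrow> (real^'k \<Rightarrow> real^'n) \<Rightarrow> real^'k \<Rightarrow> real" where
  "volume_density h f u =
     (let A = matrix (frechet_derivative f (at u))
      in sqrt (det (h (f u) *\<^sub>R (transpose A ** A))))"

text \<open>The \<open>k\<close>-dimensional volume of \<open>A\<close>, with \<open>k = CARD('k)\<close>, for the metric \<open>h\<cdot>g\<^sub>E\<close>: the supremum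
  of the total volume of finitely many pairwise disjoint Borel pieces \<open>f\<^sub>i(S\<^sub>i)\<close>, each inside a
  local parametrisation \<open>f\<^sub>i : U\<^sub>i \<rightarrow> A\<close>. On a \<open>k\<close>-dimensional submanifold this is the Riemannian
  volume. The definition also applies to sets with a negligible singular part, such as cones.\<close>

definition kvolume ::
    "'k::finite itself \<Rightarrow> (real^'n \<Rightarrow> real) \<Rightarrow> (real^'n) set \<Rightarrow> ennreal" where
  "kvolume _ h A =
     (SUP (N, f, U, S) \<in> {(N :: nat, f :: nat \<Rightarrow> real^'k \<Rightarrow> real^'n,
                           U :: nat \<Rightarrow> (real^'k) set, S :: nat \<Rightarrow> (real^'k) set).
          (\<forall>i<N. C1_parametrisation (f i) (U i) \<and> f i ` U i \<subseteq> A \<and>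
                 S i \<in> sets borel \<and> S i \<subseteq> U i) \<and>
          disjoint_family_on (\<lambda>i. f i ` S i) {..<N}}.
        \<Sum>i<N. \<integral>\<^sup>+u\<in>S i. ennreal (volume_density h (f i) u) \<partial>lborel)"

definition euclidean_volume :: "'k::finite itself \<Rightarrow> (real^'n) set \<Rightarrow> ennreal" where
  "euclidean_volume k A = kvolume k (\<lambda>_. 1) A"

definition hyperbolic_volume :: "'k::finite itself \<Rightarrow> (real^'n) set \<Rightarrow> ennreal" where
  "hyperbolic_volume k A = kvolume k (\<lambda>x. 4 / (1 - (norm x)\<^sup>2)\<^sup>2) A"

section \<open>Minimal submanifolds of hyperbolic space\<close>

text \<open>A minimal submanifold is a critical point of the hyperbolic volume under compactly supported
  variations. The first variation depends only on the initial velocity \<open>X\<close> of a variation, which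
  is therefore taken to be \<open>x \<mapsto> x + t X(x)\<close>. The volume is localised to \<open>\<Omega>\<close>, outside of which
  nothing moves, because the total volume is infinite if \<open>M\<close> reaches the sphere at infinity.
  Compactness of \<open>M \<inter> closure \<Omega>\<close> keeps the variation away from the boundary of \<open>M\<close>.\<close>

definition minimal_submanifold :: "'k::finite itself \<Rightarrow> (real^'n) set \<Rightarrow> bool" where
  "minimal_submanifold k M \<longleftrightarrow> M \<subseteq> ball 0 1 \<and> submanifold CARD('k) M \<and>
     (\<forall>X \<Omega>. C1_on X UNIV \<and> open \<Omega> \<and> closure \<Omega> \<subseteq> ball 0 1 \<and> compact (M \<inter> closure \<Omega>) \<and>
        closure {x. X x \<noteq> 0} \<subseteq> \<Omega> \<longrightarrow>
        ((\<lambda>t. enn2real (hyperbolic_volume k ((\<lambda>x. x + t *\<^sub>R X x) ` (M \<inter> \<Omega>))))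
           has_real_derivative 0) (at 0))"

text \<open>The point at Euclidean distance \<open>r\<close> from the origin is at hyperbolic distance
  \<open>\<integral> 2 / (1 - s\<^sup>2) ds = 2 artanh r\<close>, the integral being over \<open>0 \<le> s \<le> r\<close>.\<close>

definition geodesic_sphere :: "real \<Rightarrow> (real^'n) set" where
  "geodesic_sphere \<rho> = {x \<in> ball 0 1. 2 * artanh (norm x) = \<rho>}"

section \<open>Radial cones\<close>

text \<open>The cone over a great subsphere is a flat disc, which is Euclidean minimising and is itself
  a (totally geodesic) minimal submanifold; nonexistence results therefore concern submanifolds
  other than the cone. A cone that is not a submanifold is never an exception.\<close>

definition radial_cone :: "'a::real_vector set \<Rightarrow> 'a set" where
  "radial_cone \<gamma> = (\<Union>p\<in>\<gamma>. closed_segment 0 p)"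

definition euclidean_minimising ::
    "'k::finite itself \<Rightarrow> (real^'n) set \<Rightarrow> (real^'n) set \<Rightarrow> bool" where
  "euclidean_minimising k C \<gamma> \<longleftrightarrow>
     (\<forall>S. compact S \<and> submanifold_with_boundary CARD('k) S \<gamma> \<longrightarrow>
        euclidean_volume k C \<le> euclidean_volume k S)"

end

theory Submission
  imports Defs
begin

text \<open>The velocity \<open>X = \<eta> ((1 - |x|\<^sup>2)/2)^k x\<close> turns the hyperbolic first variation into the Euclidean
  identity \<open>\<integral>\<^sub>M (\<nabla>\<eta> \<bullet> x\<^sup>T + \<eta> (k + 2k |x\<^sup>\<bottom>|\<^sup>2 / (1 - |x|\<^sup>2))) = 0\<close>, where \<open>x\<^sup>T\<close> and \<open>x\<^sup>\<bottom>\<close> are the tangential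
  and normal parts of the position. Let \<open>\<eta>\<close> tend to 1 inside \<open>M\<close>, cut off in collars of \<open>\<gamma>\<close>. As
  \<open>\<gamma>\<close> lies in a sphere about the origin, the boundary flux \<open>-\<integral>\<^sub>M \<nabla>\<eta> \<bullet> x\<^sup>T\<close> is in the limit at most
  \<open>k\<close> times the volume of the cone, hence at most \<open>k vol(M \<union> \<gamma>)\<close> since the cone is minimising. So
  \<open>x\<^sup>\<bottom> = 0\<close> on \<open>M\<close>: locally \<open>M\<close> is a cone, the ray through each of its points ends on \<open>\<gamma>\<close>,
  and \<open>M \<union> \<gamma>\<close> is the radial cone.\<close>

section \<open>Gram determinants and \<open>C\<^sup>1\<close> calculus\<close>

text \<open>The power of \<open>(1 - |x|\<^sup>2)/2\<close> in \<open>X\<close> is the inverse of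
  the hyperbolic volume density. Every integral thus becomes Euclidean and stays finite up to the
  sphere at infinity, where hyperbolic volume diverges. In the identity, \<open>k\<close> is the
  tangential divergence of the position; the conformal factor adds
  \<open>2k |x|\<^sup>2 / (1 - |x|\<^sup>2)\<close>, the gradient of the power takes away the same
  expression with the tangential part, and the normal part remains with a favourable sign. The
  constant of the flux bound has this origin: on \<gamma> the conormal part of the position is at
  most the radius \<open>R\<close>, while the cone has volume \<open>R/k\<close> times that of
  \<gamma>. Ideal and finite boundaries are treated together, as subsets of some
  \<open>sphere 0 R\<close>. The volume of \<open>M \<union> \<gamma>\<close> is finite, so it can
  be subtracted from both sides. The shape of the proof is dictated by \<open>kvolume\<close>, a
  supremum over families of parametrised pieces: partitions of unity turn it into integrals over
  chart domains and back, and the terms with derivatives of the partition functions have to cancel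
  between different charts.\<close>

abbreviation fd :: "('a::real_normed_vector \<Rightarrow> 'b::real_normed_vector) \<Rightarrow> 'a \<Rightarrow> 'a \<Rightarrow> 'b" where
  "fd f x \<equiv> frechet_derivative f (at x)"

definition jac :: "(real^'k \<Rightarrow> real^'n) \<Rightarrow> real^'k \<Rightarrow> real^'k^'n" where
  "jac f u = matrix (fd f u)"

lemma det_matrix_smult: "det (c *\<^sub>R (A::real^'k^'k)) = c ^ CARD('k) * det A"
proof -
  have "c *\<^sub>R A = matrix ((*\<^sub>R) c) ** A"
    by (simp add: vec_eq_iff matrix_matrix_mult_def matrix_def axis_def if_distrib if_distribR cong: if_cong)
  then show ?thesis by (simp add: det_mul)
qed

lemma gram_mult_vec_inner:
  "((transpose A ** A) *v x) \<bullet> y = ((A::real^'k^'n) *v x) \<bullet> (A *v y)"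
  by (metis dot_lmul_matrix inner_commute matrix_vector_mul_assoc transpose_matrix_vector)

lemma gram_invertible:
  assumes "inj ((*v) (A::real^'k^'n))"
  shows "invertible (transpose A ** A)"
proof -
  have "x = 0" if "(transpose A ** A) *v x = 0" for x
  proof -
    have "(A *v x) \<bullet> (A *v x) = 0" using gram_mult_vec_inner[of A x x] that by simp
    then have "A *v x = A *v 0" by simp
    with assms show ?thesis by (meson injD)
  qed
  then have "inj ((*v) (transpose A ** A))"
    by (simp add: linear_injective_0)
  then show ?thesis
    by (metis invertible_left_inverse matrix_left_invertible_injective)
qed

text \<open>The segment from the Gram matrix to the identity consists of positive definite, hence
  nonsingular, matrices, so the determinant keeps the sign it has at the identity.\<close>

lemma det_gram_pos:
  assumes "inj ((*v) (A::real^'k^'n))"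
  shows "0 < det (transpose A ** A)"
proof (rule ccontr)
  let ?G = "transpose A ** A"
  define H where "H s = s *\<^sub>R ?G + (1 - s) *\<^sub>R (mat 1 :: real^'k^'k)" for s :: real
  assume "\<not> 0 < det ?G"
  then have le: "det (H 1) \<le> 0" by (simp add: H_def)
  have 0: "det (H 0) = 1" by (simp add: H_def)
  have cont: "continuous_on {0..1} (\<lambda>s. det (H s))"
    unfolding det_def H_def by (intro continuous_intros) 
  obtain s where s: "0 \<le> s" "s \<le> 1" "det (H s) = 0"
    using IVT2'[of "\<lambda>s. det (H s)" 1 0 0] le 0 cont by auto
  then have "\<not> invertible (H s)" by (simp add: invertible_det_nz)
  then obtain x where x: "x \<noteq> 0" "H s *v x = 0"
    by (metis invertible_left_inverse matrix_left_invertible_ker)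
  have "H s *v x = s *\<^sub>R (?G *v x) + (1 - s) *\<^sub>R x"
    by (simp add: H_def matrix_vector_mult_add_rdistrib scaleR_matrix_vector_assoc[symmetric])
  then have "0 = s * ((A *v x) \<bullet> (A *v x)) + (1 - s) * (x \<bullet> x)"
    using x(2) gram_mult_vec_inner[of A x x]
    by (metis inner_add_left inner_scaleR_left inner_zero_left)
  moreover have "0 \<le> s * ((A *v x) \<bullet> (A *v x))" "0 \<le> (1 - s) * (x \<bullet> x)" using s by auto
  ultimately have z: "s * ((A *v x) \<bullet> (A *v x)) = 0" "(1 - s) * (x \<bullet> x) = 0" by linarith+
  with x(1) have "s = 1" by simp
  with z(1) have "A *v x = A *v 0" by simp
  with assms x(1) show False by (metis injD)
qed

text \<open>Product rule in the Leibniz expansion; the terms that differentiate the same row are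
  collected into one determinant.\<close>

lemma det_has_derivative:
  fixes N :: "real \<Rightarrow> real^'k^'k"
  assumes d: "\<And>i j. ((\<lambda>t. N t $ i $ j) has_real_derivative N' $ i $ j) (at a)"
  shows "((\<lambda>t. det (N t)) has_real_derivative
    (\<Sum>i\<in>UNIV. det (\<chi> l. if l = i then row i N' else row l (N a)))) (at a)"
proof -
  have "((\<lambda>t. det (N t)) has_real_derivative
     (\<Sum>p | p permutes UNIV. of_int (sign p) *
        (\<Sum>i\<in>UNIV. N' $ i $ p i * (\<Prod>l\<in>UNIV-{i}. N a $ l $ p l)))) (at a)"
    unfolding det_def
    by (rule DERIV_sum, rule DERIV_cmult, rule has_field_derivative_prod) (use d in auto)
  also have "(\<Sum>p | p permutes (UNIV::'k set). of_int (sign p) *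
        (\<Sum>i\<in>UNIV. N' $ i $ p i * (\<Prod>l\<in>UNIV-{i}. N a $ l $ p l))) =
     (\<Sum>i\<in>UNIV. \<Sum>p | p permutes UNIV. of_int (sign p) *
         (N' $ i $ p i * (\<Prod>l\<in>UNIV-{i}. N a $ l $ p l)))"
    by (simp add: sum_distrib_left) (rule sum.swap)
  also have "\<dots> = (\<Sum>i\<in>UNIV. det (\<chi> l. if l = i then row i N' else row l (N a)))"
    unfolding det_def
  proof (intro sum.cong refl arg_cong2[where f="(*)"])
    fix i :: 'k and p
    have "(\<Prod>l\<in>UNIV. (\<chi> l. if l = i then row i N' else row l (N a)) $ l $ p l)
       = (\<chi> l. if l = i then row i N' else row l (N a)) $ i $ p i *
         (\<Prod>l\<in>UNIV-{i}. (\<chi> l. if l = i then row i N' else row l (N a)) $ l $ p l)"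
      by (rule prod.remove) auto
    also have "\<dots> = N' $ i $ p i * (\<Prod>l\<in>UNIV-{i}. N a $ l $ p l)"
      by (intro arg_cong2[where f="(*)"] prod.cong) (auto simp: row_def)
    finally show "N' $ i $ p i * (\<Prod>l\<in>UNIV-{i}. N a $ l $ p l) =
       (\<Prod>l\<in>UNIV. (\<chi> l. if l = i then row i N' else row l (N a)) $ l $ p l)" ..
  qed
  finally show ?thesis .
qed

text \<open>With the derivative written as \<open>C ** N a\<close>, its row \<open>i\<close> is a
  combination of the rows of \<open>N a\<close>, and only row \<open>i\<close> itself survives in
  the determinant, with coefficient \<open>C $ i $ i\<close>.\<close>

lemma Jacobi_formula:
  fixes N :: "real \<Rightarrow> real^'k^'k"
  assumes d: "\<And>i j. ((\<lambda>t. N t $ i $ j) has_real_derivative (C ** N a) $ i $ j) (at a)"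
  shows "((\<lambda>t. det (N t)) has_real_derivative trace C * det (N a)) (at a)"
proof -
  have r: "row i (C ** N a) = (\<Sum>l\<in>UNIV. C $ i $ l *s row l (N a))" for i
    by (simp add: vec_eq_iff row_def matrix_matrix_mult_def)
  have "det (\<chi> l. if l = i then row i (C ** N a) else row l (N a)) = C $ i $ i * det (N a)" for i
    using cramer_lemma_transpose[of i "C $ i" "N a"] unfolding r by simp
  then show ?thesis
    using det_has_derivative[OF d] by (simp add: trace_def sum_distrib_right)
qed

text \<open>In finite dimension, continuity of the derivative in operator norm follows from
  continuity in each fixed direction. This spares the construction of \<open>blinfun\<close>
  values.\<close>

lemma C1_onI:
  fixes f :: "'a::euclidean_space \<Rightarrow> 'b::real_normed_vector"
  assumes "\<And>x. x \<in> U \<Longrightarrow> (f has_derivative f' x) (at x)"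
    and "\<And>v. continuous_on U (\<lambda>x. f' x v)"
  shows "C1_on f U"
  unfolding C1_on_def
proof (intro exI conjI ballI)
  have b: "bounded_linear (f' x)" if "x \<in> U" for x
    using assms(1)[OF that] by (rule has_derivative_bounded_linear)
  show "(f has_derivative blinfun_apply (Blinfun (f' x))) (at x)" if "x \<in> U" for x
    using assms(1)[OF that] b[OF that] by (simp add: bounded_linear_Blinfun_apply)
  show "continuous_on U (\<lambda>x. Blinfun (f' x))"
    by (rule continuous_on_blinfun_componentwise)
       (use assms(2) b in \<open>simp add: bounded_linear_Blinfun_apply cong: continuous_on_cong\<close>)
qed

text \<open>The direction \<open>w\<close> may vary with the point because the derivative is later
  evaluated on the moving vector \<open>rad f u\<close>.\<close>

lemma C1_onD:
  assumes "C1_on f U"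
  shows C1_on_has_derivative: "x \<in> U \<Longrightarrow> (f has_derivative fd f x) (at x)"
    and C1_on_continuous_fd: "continuous_on U w \<Longrightarrow> continuous_on U (\<lambda>x. fd f x (w x))"
    and C1_on_continuous: "continuous_on U f"
proof -
  obtain f' where f': "\<And>x. x \<in> U \<Longrightarrow> (f has_derivative blinfun_apply (f' x)) (at x)" "continuous_on U f'"
    using assms unfolding C1_on_def by blast
  have e: "fd f x = blinfun_apply (f' x)" if "x \<in> U" for x
    using f'(1)[OF that] by (rule frechet_derivative_at[symmetric])
  show "x \<in> U \<Longrightarrow> (f has_derivative fd f x) (at x)" using f' e by simp
  show "continuous_on U (\<lambda>x. fd f x (w x))" if "continuous_on U w"
  proof -
    have "continuous_on U (\<lambda>x. blinfun_apply (f' x) (w x))"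
      using f'(2) that by (rule bounded_bilinear.continuous_on[OF bounded_bilinear_blinfun_apply])
    then show ?thesis using e by (simp cong: continuous_on_cong)
  qed
  show "continuous_on U f"
    using f'(1) has_derivative_continuous continuous_at_imp_continuous_on by blast
qed

lemma C1_on_subset: "C1_on f U \<Longrightarrow> V \<subseteq> U \<Longrightarrow> C1_on f V"
  unfolding C1_on_def by (meson continuous_on_subset subsetD)

lemma fdI: "(f has_derivative f') (at x) \<Longrightarrow> fd f x = f'"
  by (rule frechet_derivative_at[symmetric])

lemma C1_on_bounded_linear:
  assumes "bounded_linear (f :: 'a::euclidean_space \<Rightarrow> _)" shows "C1_on f U"
  by (rule C1_onI[where f'="\<lambda>_. f"]) (use assms bounded_linear_imp_has_derivative in auto)

lemma C1_on_const: "C1_on (\<lambda>_::'a::euclidean_space. c) U"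
  by (rule C1_onI[where f'="\<lambda>_ _. 0"]) auto

lemma C1_on_compose:
  fixes f :: "'a::euclidean_space \<Rightarrow> 'b::real_normed_vector" and g :: "'b \<Rightarrow> 'c::real_normed_vector"
  assumes "C1_on f U" "C1_on g V" "f ` U \<subseteq> V"
  shows "C1_on (\<lambda>x. g (f x)) U"
proof (rule C1_onI)
  show "((\<lambda>x. g (f x)) has_derivative (\<lambda>v. fd g (f x) (fd f x v))) (at x)" if "x \<in> U" for x
    using has_derivative_compose[OF C1_on_has_derivative[OF assms(1) that]
        C1_on_has_derivative[OF assms(2)]] that assms(3) by auto
  obtain g' where g': "\<And>x. x \<in> V \<Longrightarrow> (g has_derivative blinfun_apply (g' x)) (at x)" "continuous_on V g'"
    using assms(2) unfolding C1_on_def by blast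
  show "continuous_on U (\<lambda>x. fd g (f x) (fd f x v))" for v
  proof -
    have "continuous_on U (\<lambda>x. blinfun_apply (g' (f x)) (fd f x v))"
      by (intro bounded_bilinear.continuous_on[OF bounded_bilinear_blinfun_apply]
        continuous_on_compose2[OF g'(2) C1_on_continuous[OF assms(1)] assms(3)]
        C1_on_continuous_fd[OF assms(1)] continuous_on_const)
    moreover have "fd g (f x) = blinfun_apply (g' (f x))" if "x \<in> U" for x
      using fdI g'(1) that assms(3) by blast
    ultimately show ?thesis by (simp cong: continuous_on_cong)
  qed
qed

lemma C1_on_add:
  fixes f g :: "'a::euclidean_space \<Rightarrow> 'b::real_normed_vector"
  assumes "C1_on f U" "C1_on g U" shows "C1_on (\<lambda>x. f x + g x) U"
  by (rule C1_onI[where f'="\<lambda>x v. fd f x v + fd g x v"])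
     (auto intro!: has_derivative_add continuous_intros C1_onD[OF assms(1)] C1_onD[OF assms(2)])

lemma C1_on_diff:
  fixes f g :: "'a::euclidean_space \<Rightarrow> 'b::real_normed_vector"
  assumes "C1_on f U" "C1_on g U" shows "C1_on (\<lambda>x. f x - g x) U"
  by (rule C1_onI[where f'="\<lambda>x v. fd f x v - fd g x v"])
     (auto intro!: has_derivative_diff continuous_intros C1_onD[OF assms(1)] C1_onD[OF assms(2)])

lemma C1_on_scaleR:
  fixes f :: "'a::euclidean_space \<Rightarrow> real" and g :: "'a \<Rightarrow> 'b::real_normed_vector"
  assumes "C1_on f U" "C1_on g U" shows "C1_on (\<lambda>x. f x *\<^sub>R g x) U"
  by (rule C1_onI[where f'="\<lambda>x v. f x *\<^sub>R fd g x v + fd f x v *\<^sub>R g x"])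
     (auto intro!: has_derivative_scaleR continuous_intros C1_onD[OF assms(1)] C1_onD[OF assms(2)])

lemma C1_on_mult:
  fixes f g :: "'a::euclidean_space \<Rightarrow> real"
  assumes "C1_on f U" "C1_on g U" shows "C1_on (\<lambda>x. f x * g x) U"
  using C1_on_scaleR[OF assms] by simp

lemma C1_on_power:
  fixes f :: "'a::euclidean_space \<Rightarrow> real"
  assumes "C1_on f U" shows "C1_on (\<lambda>x. f x ^ n) U"
  by (induction n) (auto intro: C1_on_const C1_on_mult assms)

lemma C1_on_sum:
  fixes f :: "'i \<Rightarrow> 'a::euclidean_space \<Rightarrow> 'b::real_normed_vector"
  assumes "\<And>i. i \<in> I \<Longrightarrow> C1_on (f i) U" shows "C1_on (\<lambda>x. \<Sum>i\<in>I. f i x) U"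
  using assms by (induction I rule: infinite_finite_induct) (auto intro: C1_on_const C1_on_add)

lemma C1_on_prod:
  fixes f :: "'i \<Rightarrow> 'a::euclidean_space \<Rightarrow> real"
  assumes "\<And>i. i \<in> I \<Longrightarrow> C1_on (f i) U" shows "C1_on (\<lambda>x. \<Prod>i\<in>I. f i x) U"
  using assms by (induction I rule: infinite_finite_induct) (auto intro: C1_on_const C1_on_mult)

lemma C1_on_norm_square: "C1_on (\<lambda>x::'a::euclidean_space. (norm x)\<^sup>2) U"
  unfolding power2_norm_eq_inner
  by (rule C1_onI[where f'="\<lambda>x v. x \<bullet> v + v \<bullet> x"])
     (auto intro!: derivative_eq_intros continuous_intros)

lemma C1_on_id: "C1_on (\<lambda>x::'a::euclidean_space. x) U"
  by (rule C1_on_bounded_linear) simp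

lemma C1_on_cong_open:
  fixes f :: "'a::euclidean_space \<Rightarrow> 'b::real_normed_vector"
  assumes "C1_on f U" "open U" "\<And>x. x \<in> U \<Longrightarrow> g x = f x"
  shows "C1_on g U"
proof -
  have "(g has_derivative fd f x) (at x)" if "x \<in> U" for x
    using has_derivative_transform_within_open[OF C1_on_has_derivative[OF assms(1) that] assms(2) that]
    assms(3) by simp
  then show ?thesis
    by (rule C1_onI) (use C1_onD[OF assms(1)] in auto)
qed

lemma C1_on_open_Un:
  fixes f :: "'a::euclidean_space \<Rightarrow> 'b::real_normed_vector"
  assumes "C1_on f U" "C1_on f V" "open U" "open V" shows "C1_on f (U \<union> V)"
proof (rule C1_onI[where f'="fd f"])
  show "(f has_derivative fd f x) (at x)" if "x \<in> U \<union> V" for x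
    using that C1_on_has_derivative[OF assms(1)] C1_on_has_derivative[OF assms(2)] by auto
  show "continuous_on (U \<union> V) (\<lambda>x. fd f x v)" for v
    by (intro continuous_on_open_Un assms C1_on_continuous_fd continuous_on_const)
qed

text \<open>A function built from a chart inverse lives only on the open set of the chart;
  multiplied by a function supported there it extends to all of space, as a test function
  must.\<close>

lemma C1_on_extend_zero:
  fixes f :: "'a::euclidean_space \<Rightarrow> 'b::real_normed_vector"
  assumes "C1_on f W" "open W" "closed S" "S \<subseteq> W" "\<And>x. x \<notin> S \<Longrightarrow> f x = 0"
  shows "C1_on f UNIV"
proof -
  have "C1_on f (- S)"
    by (rule C1_on_cong_open[OF C1_on_const[of 0]]) (use assms in \<open>auto simp: open_Compl\<close>)
  then have "C1_on f (W \<union> - S)"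
    using assms by (intro C1_on_open_Un) (auto simp: open_Compl)
  moreover have "W \<union> - S = UNIV" using assms by auto
  ultimately show ?thesis by simp
qed

section \<open>A cutoff profile of class \<open>C\<^sup>1\<close> on the line\<close>

text \<open>The cubic is the Hermite interpolant \<open>t\<^sup>2 (3 - 2 t)\<close> with
  \<open>t = 2 - s\<close>, falling from 1 to 0 with zero slope at both ends. One continuous
  derivative is all that the velocities in \<open>minimal_submanifold\<close> require.\<close>

definition step :: "real \<Rightarrow> real" where
  "step s = (if s \<le> 1 then 1 else if s \<ge> 2 then 0 else (2 - s)\<^sup>2 * (2 * s - 1))"

definition step' :: "real \<Rightarrow> real" where
  "step' s = (if s \<le> 1 then 0 else if s \<ge> 2 then 0 else - (6 * (s - 1) * (2 - s)))"

text \<open>Serves the two break points of \<open>step\<close>, where pieces with different formulas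
  meet.\<close>

lemma DERIV_zero_if_quadratic:
  fixes g :: "real \<Rightarrow> real"
  assumes "\<And>x. \<bar>x - a\<bar> < 1 \<Longrightarrow> \<bar>g x - g a\<bar> \<le> C * (x - a)\<^sup>2"
  shows "DERIV g a :> 0"
  unfolding has_field_derivative_iff
proof (rule Lim_null_comparison)
  show "\<forall>\<^sub>F x in at a. norm ((g x - g a) / (x - a)) \<le> C * \<bar>x - a\<bar>"
    unfolding eventually_at
  proof (intro exI[of _ 1] conjI ballI impI)
    fix x assume x: "x \<noteq> a \<and> dist x a < 1"
    then have "\<bar>g x - g a\<bar> \<le> (C * \<bar>x - a\<bar>) * \<bar>x - a\<bar>"
      using assms[of x] by (simp add: dist_real_def power2_eq_square mult.assoc)
    then show "norm ((g x - g a) / (x - a)) \<le> C * \<bar>x - a\<bar>"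
      using x by (simp add: abs_divide divide_le_eq)
  qed simp
  show "(\<lambda>x. C * \<bar>x - a\<bar>) \<midarrow>a\<rightarrow> 0"
    by (auto intro!: tendsto_eq_intros)
qed

lemma step_DERIV: "DERIV step s :> step' s"
proof -
  consider "s < 1" | "s = 1" | "1 < s" "s < 2" | "s = 2" | "s > 2" by linarith
  then show ?thesis
  proof cases
    case 1
    have "DERIV (\<lambda>_::real. 1::real) s :> step' s" using 1 by (auto simp: step'_def)
    then show ?thesis
      by (rule has_field_derivative_transform_within_open[where S="{..<1}"]) (use 1 in \<open>auto simp: step_def\<close>)
  next
    case 2
    \<comment> \<open>After the double zero at the break point is split off, a linear factor
      remains, and 5 is a generous bound for it between 1 and 2.\<close>
    have "DERIV step 1 :> 0"
    proof (rule DERIV_zero_if_quadratic[where C=5])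
      fix x :: real assume x: "\<bar>x - 1\<bar> < 1"
      show "\<bar>step x - step 1\<bar> \<le> 5 * (x - 1)\<^sup>2"
      proof (cases "x \<le> 1")
        case False
        have "(2 - x)\<^sup>2 * (2 * x - 1) - 1 = (x - 1)\<^sup>2 * (2 * x - 5)"
          by (simp add: power2_eq_square algebra_simps)
        then have "\<bar>step x - step 1\<bar> = (x - 1)\<^sup>2 * \<bar>2 * x - 5\<bar>"
          using False x by (simp add: step_def abs_mult)
        also have "\<dots> \<le> (x - 1)\<^sup>2 * 5" using False x by (intro mult_left_mono) auto
        finally show ?thesis by simp
      qed (simp add: step_def)
    qed
    then show ?thesis using 2 by (simp add: step'_def)
  next
    case 3
    have "DERIV (\<lambda>s::real. (2 - s)\<^sup>2 * (2 * s - 1)) s :> step' s"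
      by (rule derivative_eq_intros refl)+ (use 3 in \<open>simp add: step'_def power2_eq_square algebra_simps\<close>)
    then show ?thesis
      by (rule has_field_derivative_transform_within_open[where S="{1<..<2}"]) (use 3 in \<open>auto simp: step_def\<close>)
  next
    case 4
    have "DERIV step 2 :> 0"
    proof (rule DERIV_zero_if_quadratic[where C=5])
      fix x :: real assume x: "\<bar>x - 2\<bar> < 1"
      show "\<bar>step x - step 2\<bar> \<le> 5 * (x - 2)\<^sup>2"
      proof (cases "x \<ge> 2")
        case False
        have "\<bar>step x - step 2\<bar> = (x - 2)\<^sup>2 * \<bar>2 * x - 1\<bar>"
          using False x by (simp add: step_def abs_mult power2_commute)
        also have "\<dots> \<le> (x - 2)\<^sup>2 * 5" using False x by (intro mult_left_mono) auto
        finally show ?thesis by simp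
      qed (simp add: step_def)
    qed
    then show ?thesis using 4 by (simp add: step'_def)
  next
    case 5
    have "DERIV (\<lambda>_::real. 0::real) s :> step' s" using 5 by (auto simp: step'_def)
    then show ?thesis
      by (rule has_field_derivative_transform_within_open[where S="{2<..}"]) (use 5 in \<open>auto simp: step_def\<close>)
  qed
qed

text \<open>The form with \<open>max\<close> has no case distinction, so continuity is
  immediate.\<close>

lemma step'_eq: "step' s = - 6 * max 0 (s - 1) * max 0 (2 - s)"
  by (auto simp: step'_def max_def)

lemma step'_continuous: "continuous_on A step'"
  unfolding step'_eq[abs_def] by (intro continuous_intros)

lemma C1_on_step: "C1_on step U"
proof (rule C1_onI[where f'="\<lambda>x v. step' x * v"])
  show "(step has_derivative (*) (step' x)) (at x)" for x
    using step_DERIV by (simp add: has_field_derivative_def)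
qed (auto intro!: continuous_intros step'_continuous)

lemma step_bounds: "0 \<le> step s" "step s \<le> 1"
proof -
  show "0 \<le> step s" by (auto simp: step_def)
  show "step s \<le> 1"
  proof (cases "1 < s \<and> s < 2")
    case True
    have "1 - (2 - s)\<^sup>2 * (2 * s - 1) = (s - 1)\<^sup>2 * (5 - 2 * s)"
      by (simp add: power2_eq_square algebra_simps)
    moreover have "0 \<le> (s - 1)\<^sup>2 * (5 - 2 * s)" using True by simp
    ultimately have "(2 - s)\<^sup>2 * (2 * s - 1) \<le> 1" by linarith
    then show ?thesis using True by (simp add: step_def)
  qed (auto simp: step_def)
qed

lemma step_pos: "s < 2 \<Longrightarrow> 0 < step s" by (auto simp: step_def)

lemma step'_neg: "1 < s \<Longrightarrow> s < 2 \<Longrightarrow> step' s < 0" by (auto simp: step'_def)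

lemma step_strict_decreasing:
  assumes "1 \<le> a" "a < b" "b \<le> 2" shows "step b < step a"
proof (rule DERIV_neg_imp_decreasing_open[OF assms(2)])
  show "\<exists>y. DERIV step x :> y \<and> y < 0" if "a < x" "x < b" for x
    using step_DERIV step'_neg[of x] that assms by (intro exI[of _ "step' x"]) auto
  show "continuous_on {a..b} step" by (rule C1_on_continuous[OF C1_on_step])
qed

section \<open>Change of variables for arbitrary finite index types\<close>

text \<open>The library proves the change of variables formula for determinants only over a well-ordered index
  type; \<open>wo\<close> is a copy of a finite type that carries such an order.\<close>

typedef 'a wo = "UNIV :: 'a set" by simp

definition wo_index :: "'a::finite wo \<Rightarrow> nat" where
  "wo_index x = (SOME f :: 'a \<Rightarrow> nat. inj f) (Rep_wo x)"

lemma wo_index_eq_iff: "wo_index x = wo_index y \<longleftrightarrow> x = y"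
proof -
  have "\<exists>f :: 'a \<Rightarrow> nat. inj f" using finite_imp_inj_to_nat_seg[of "UNIV :: 'a set"] by auto
  then have "inj (SOME f :: 'a \<Rightarrow> nat. inj f)" by (rule someI_ex)
  then show ?thesis by (auto simp: wo_index_def inj_eq Rep_wo_inject)
qed

instantiation wo :: (finite) "{finite, wellorder}"
begin

definition less_eq_wo :: "'a wo \<Rightarrow> 'a wo \<Rightarrow> bool" where
  "less_eq_wo x y \<longleftrightarrow> wo_index x \<le> wo_index y"

definition less_wo :: "'a wo \<Rightarrow> 'a wo \<Rightarrow> bool" where
  "less_wo x y \<longleftrightarrow> wo_index x < wo_index y"

instance
proof
  have "(UNIV :: 'a wo set) = Abs_wo ` UNIV"
    by (auto intro!: image_eqI Rep_wo_inverse[symmetric])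
  moreover have "finite (Abs_wo ` (UNIV :: 'a set))" by (rule finite_imageI) simp
  ultimately show "finite (UNIV :: 'a wo set)" by simp
  fix P :: "'a wo \<Rightarrow> bool" and a :: "'a wo"
  assume step: "\<And>x. (\<And>y. y < x \<Longrightarrow> P y) \<Longrightarrow> P x"
  have "\<forall>b. wo_index b = n \<longrightarrow> P b" for n
  proof (induction n rule: less_induct)
    case (less n)
    show ?case
    proof (intro allI impI)
      fix b :: "'a wo" assume b: "wo_index b = n"
      show "P b" by (rule step) (use less b in \<open>simp add: less_wo_def\<close>)
    qed
  qed
  then show "P a" by blast
next
  fix x y z :: "'a wo"
  show "(x < y) = (x \<le> y \<and> \<not> y \<le> x)" "x \<le> x" "x \<le> y \<or> y \<le> x"
    unfolding less_eq_wo_def less_wo_def by (simp_all add: less_le_not_le linear)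
  show "x \<le> z" if "x \<le> y" "y \<le> z" using that unfolding less_eq_wo_def by linarith
  show "x = y" if "x \<le> y" "y \<le> x"
    using that unfolding less_eq_wo_def by (metis wo_index_eq_iff le_antisym)
qed

end

lemma bij_Rep_wo: "bij (Rep_wo :: 'a wo \<Rightarrow> 'a)"
  by (rule o_bij[where g=Abs_wo]) (simp_all add: fun_eq_iff Abs_wo_inverse Rep_wo_inverse)

text \<open>Conjugation with \<open>s\<close> maps the permutations of one index type onto those of
  the other and preserves signs, so the Leibniz sums agree term by term.\<close>

lemma det_reindex:
  fixes A :: "real^'k^'k" and s :: "'m::finite \<Rightarrow> 'k"
  assumes "bij s"
  shows "det (\<chi> i j. A $ s i $ s j) = det A"
proof -
  have inj: "inj s" and inv: "bij (inv s)" using assms by (simp_all add: bij_is_inj bij_imp_bij_inv)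
  have "(\<Sum>p | p permutes (UNIV::'m set). of_int (sign p) * (\<Prod>i\<in>UNIV. (\<chi> i j. A $ s i $ s j) $ i $ p i)) =
     (\<Sum>p | p permutes (UNIV::'k set). of_int (sign p) * (\<Prod>i\<in>UNIV. A $ i $ p i))"
  proof (rule sum.reindex_bij_witness[where i="map_permutation UNIV (inv s)" and j="map_permutation UNIV s"])
    fix p :: "'m \<Rightarrow> 'm" assume "p \<in> {p. p permutes UNIV}"
    then have p: "p permutes UNIV" by simp
    show "map_permutation UNIV (inv s) (map_permutation UNIV s p) = p"
      by (rule map_permutation_compose_inv[OF assms p]) (simp add: inj)
    show "map_permutation UNIV s p \<in> {p. p permutes UNIV}"
      using map_permutation_permutes[OF assms p] by simp
    have "(\<Prod>i\<in>UNIV. A $ i $ map_permutation UNIV s p i) = (\<Prod>i\<in>UNIV. A $ s i $ s (p i))"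
      by (subst prod.reindex_bij_betw[OF assms, symmetric]) (simp add: map_permutation_apply[OF inj])
    then show "of_int (sign (map_permutation UNIV s p)) * (\<Prod>i\<in>UNIV. A $ i $ map_permutation UNIV s p i) =
       of_int (sign p) * (\<Prod>i\<in>UNIV. (\<chi> i j. A $ s i $ s j) $ i $ p i)"
      using sign_map_permutation[OF inj p] by simp
  next
    fix p :: "'k \<Rightarrow> 'k" assume "p \<in> {p. p permutes UNIV}"
    then have p: "p permutes UNIV" by simp
    show "map_permutation UNIV s (map_permutation UNIV (inv s) p) = p"
      by (rule map_permutation_compose_inv[OF inv p]) (simp add: assms bij_is_surj surj_f_inv_f)
    show "map_permutation UNIV (inv s) p \<in> {p. p permutes UNIV}"
      using map_permutation_permutes[OF inv p] by simp
  qed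
  then show ?thesis unfolding det_def .
qed

definition of_wo :: "real^('k::finite wo) \<Rightarrow> real^'k" where
  "of_wo x = (\<chi> i. x $ Abs_wo i)"

definition to_wo :: "real^'k \<Rightarrow> real^('k::finite wo)" where
  "to_wo x = (\<chi> i. x $ Rep_wo i)"

lemma of_to_wo [simp]: "of_wo (to_wo x) = x" "to_wo (of_wo y) = y"
  by (simp_all add: of_wo_def to_wo_def vec_eq_iff Abs_wo_inverse Rep_wo_inverse)

lemma bounded_linear_of_wo: "bounded_linear of_wo"
  by (rule linear_conv_bounded_linear[THEN iffD1])
     (auto intro!: linearI simp: of_wo_def vec_eq_iff)

lemma bounded_linear_to_wo: "bounded_linear to_wo"
  by (rule linear_conv_bounded_linear[THEN iffD1])
     (auto intro!: linearI simp: to_wo_def vec_eq_iff)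

lemma prod_Basis_vec:
  "(\<Prod>b\<in>Basis. (x :: real^'m) \<bullet> b) = (\<Prod>i\<in>UNIV. x $ i)"
proof -
  have "Basis = range (\<lambda>i::'m. axis i (1::real))" by (auto simp: Basis_vec_def)
  moreover have "inj (\<lambda>i::'m. axis i (1::real))" by (auto simp: inj_on_def axis_eq_axis)
  then have "(\<Prod>b\<in>range (\<lambda>i::'m. axis i (1::real)). x \<bullet> b) = (\<Prod>i\<in>UNIV. x \<bullet> axis i 1)"
    by (subst prod.reindex) (simp_all add: o_def)
  ultimately show ?thesis by (simp add: inner_axis)
qed

text \<open>Relabelling coordinates maps boxes to boxes with the same edge lengths, and Lebesgue
  measure is determined by its values on boxes.\<close>

lemma lborel_of_wo: "lborel = distr lborel borel (of_wo :: real^('k::finite wo) \<Rightarrow> _)"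
proof (rule lborel_eqI)
  have m: "of_wo \<in> borel_measurable (lborel :: (real^('k wo)) measure)"
    using borel_measurable_continuous_onI[OF linear_continuous_on[OF bounded_linear_of_wo]] by simp
  fix l u :: "real^'k" assume lu: "\<And>b. b \<in> Basis \<Longrightarrow> l \<bullet> b \<le> u \<bullet> b"
  have le: "to_wo l \<bullet> b \<le> to_wo u \<bullet> b" if "b \<in> Basis" for b
  proof -
    have "l $ i \<le> u $ i" for i
      using lu[OF axis_in_Basis_iff[THEN iffD2], of 1 i] by (simp add: inner_axis)
    then show ?thesis using that by (auto simp: Basis_vec_def inner_axis to_wo_def)
  qed
  have bj: "bij_betw (Rep_wo :: 'k wo \<Rightarrow> 'k) UNIV UNIV" by (rule bij_Rep_wo)
  have v: "of_wo -` box l u = box (to_wo l) (to_wo u)"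
    by (auto simp: mem_box_cart of_wo_def to_wo_def)
       (metis Rep_wo_inverse, metis Rep_wo_inverse, metis Abs_wo_inverse UNIV_I, metis Abs_wo_inverse UNIV_I)
  have "emeasure (distr lborel borel of_wo) (box l u) = emeasure lborel (box (to_wo l) (to_wo u))"
    using m by (simp add: emeasure_distr v)
  also have "\<dots> = (\<Prod>b\<in>Basis. (to_wo u - to_wo l) \<bullet> b)"
    using le by (simp add: emeasure_lborel_box)
  also have "(\<Prod>b\<in>Basis. (to_wo u - to_wo l) \<bullet> b) = (\<Prod>i\<in>UNIV. (u - l) $ Rep_wo i)"
    unfolding prod_Basis_vec by (simp add: to_wo_def)
  also have "\<dots> = (\<Prod>b\<in>Basis. (u - l) \<bullet> b)"
    unfolding prod_Basis_vec using prod.reindex_bij_betw[OF bj, of "\<lambda>i. (u - l) $ i"] by simp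
  finally show "emeasure (distr lborel borel of_wo) (box l u) = ennreal (\<Prod>b\<in>Basis. (u - l) \<bullet> b)" .
qed simp

lemma det_conj_wo:
  fixes f :: "real^'k \<Rightarrow> real^'k"
  assumes "linear f"
  shows "det (matrix (\<lambda>x. to_wo (f (of_wo x)))) = det (matrix f)"
proof -
  have "of_wo (axis j 1) = axis (Rep_wo j) (1::real)" for j :: "'k wo"
    by (auto simp: of_wo_def axis_def vec_eq_iff Abs_wo_inverse Rep_wo_inverse)
  then have "matrix (\<lambda>x. to_wo (f (of_wo x))) = (\<chi> i j. matrix f $ Rep_wo i $ Rep_wo j)"
    by (simp only: matrix_def to_wo_def) (simp add: vec_eq_iff)
  then show ?thesis using det_reindex[OF bij_Rep_wo, of "matrix f"] by simp
qed

section \<open>Change of variables for nonnegative integrals\<close>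

text \<open>Dictionary between the two integrals in use: \<open>kvolume\<close> is made of
  nonnegative Lebesgue integrals, while change of variables and dominated convergence are applied to
  integrals of \<open>absolutely_integrable_on\<close> type.\<close>

lemma absolutely_integrable_nonneg_iff:
  fixes q :: "'a::euclidean_space \<Rightarrow> real"
  assumes m: "(\<lambda>x. indicator S x * q x) \<in> borel_measurable borel" and nn: "\<And>x. x \<in> S \<Longrightarrow> 0 \<le> q x"
  shows "q absolutely_integrable_on S \<longleftrightarrow> (\<integral>\<^sup>+x\<in>S. ennreal (q x) \<partial>lborel) < \<infinity>"
    and "q absolutely_integrable_on S \<Longrightarrow> (\<integral>\<^sup>+x\<in>S. ennreal (q x) \<partial>lborel) = ennreal (integral S q)"
proof -
  have e: "(\<integral>\<^sup>+x\<in>S. ennreal (q x) \<partial>lborel) = (\<integral>\<^sup>+x. ennreal (indicator S x * q x) \<partial>lborel)"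
    by (rule nn_integral_cong) (simp add: indicator_def)
  have n: "0 \<le> indicator S x * q x" for x using nn by (simp add: indicator_def)
  show 1: "(\<integral>\<^sup>+x\<in>S. ennreal (q x) \<partial>lborel) = ennreal (integral S q)" if "q absolutely_integrable_on S"
  proof -
    have "(q has_integral integral S q) S"
      using that by (simp add: absolutely_integrable_on_def integrable_integral)
    then show ?thesis
      using nn_integral_has_integral_lebesgue[OF nn] e by simp
  qed
  show "q absolutely_integrable_on S \<longleftrightarrow> (\<integral>\<^sup>+x\<in>S. ennreal (q x) \<partial>lborel) < \<infinity>"
  proof
    assume "(\<integral>\<^sup>+x\<in>S. ennreal (q x) \<partial>lborel) < \<infinity>"
    then have "(\<lambda>x. indicator S x * q x) integrable_on UNIV"
      using e by (intro nn_integral_integrable_on m n) simp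
    then have "q integrable_on S"
      by (simp add: indicator_def of_bool_def if_distrib[of "\<lambda>x. x * q y" for y] integrable_restrict_UNIV cong: if_cong)
    then show "q absolutely_integrable_on S"
      using nn nonnegative_absolutely_integrable_1 by blast
  qed (use 1 in simp)
qed

text \<open>The densities \<open>p\<close> and \<open>q\<close> are linked on \<open>S\<close> only,
  since the integrands to which this is applied are meaningful just on chart domains.\<close>

lemma nn_integral_change_of_variables_wo:
  fixes g :: "real^'m::{finite,wellorder} \<Rightarrow> real^'m::_"
  assumes S: "S \<in> sets borel"
    and der: "\<And>x. x \<in> S \<Longrightarrow> (g has_derivative g' x) (at x within S)" and inj: "inj_on g S"
    and p: "(\<lambda>x. indicator S x * p x) \<in> borel_measurable borel"
    and q: "(\<lambda>x. indicator (g ` S) x * q x) \<in> borel_measurable borel"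
    and pq: "\<And>x. x \<in> S \<Longrightarrow> p x = \<bar>det (matrix (g' x))\<bar> * q (g x)"
    and nn: "\<And>x. x \<in> S \<Longrightarrow> 0 \<le> q (g x)"
  shows "(\<integral>\<^sup>+x\<in>S. ennreal (p x) \<partial>lborel) = (\<integral>\<^sup>+x\<in>g ` S. ennreal (q x) \<partial>lborel)"
proof -
  have nnp: "0 \<le> p x" if "x \<in> S" for x using pq nn that by simp
  have nnq: "0 \<le> q x" if "x \<in> g ` S" for x using nn that by auto
  have c: "p absolutely_integrable_on S \<longleftrightarrow> (\<lambda>x. \<bar>det (matrix (g' x))\<bar> * q (g x)) absolutely_integrable_on S"
    by (rule set_integrable_cong) (use pq in auto)
  have ci: "integral S p = integral S (\<lambda>x. \<bar>det (matrix (g' x))\<bar> * q (g x))"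
    by (rule integral_cong) (use pq in auto)
  have S': "S \<in> sets lebesgue" using S by simp
  \<comment> \<open>The real integrand is passed to the formula as a vector with a single component;
    the facts that follow unpack it again.\<close>
  note cov = has_absolute_integral_change_of_variables[OF S' der inj, of "\<lambda>x. vec (q x) :: real^1"]
  have v: "(\<lambda>x. vec (h x) :: real^1) absolutely_integrable_on A \<longleftrightarrow> h absolutely_integrable_on A" for h and A :: "(real^'m::_) set"
    by (subst absolutely_integrable_componentwise_iff) (auto simp: Basis_vec_def inner_axis)
  have vi: "integral A (\<lambda>x. vec (h x) :: real^1) = vec (integral A h)" if "h absolutely_integrable_on A" for h and A :: "(real^'m::_) set"
    using that by (simp add: vec_eq_iff integral_component_eq_cart[symmetric] v set_lebesgue_integral_eq_integral(1))
  have sc: "c *\<^sub>R (vec r :: real^1) = vec (c * r)" for c r :: real by (simp add: vec_eq_iff)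
  note cov' = cov[unfolded sc v]
  show ?thesis
  proof (cases "q absolutely_integrable_on (g ` S)")
    case True
    then have P: "p absolutely_integrable_on S"
      and "integral S (\<lambda>x. vec (\<bar>det (matrix (g' x))\<bar> * q (g x)) :: real^1) = integral (g ` S) (\<lambda>x. vec (q x))"
      using cov' c by blast+
    then have "integral S p = integral (g ` S) q"
      using vi[OF True] vi[OF P[unfolded c]] ci by (simp add: vec_eq_iff)
    then show ?thesis
      using absolutely_integrable_nonneg_iff(2)[OF p nnp P] absolutely_integrable_nonneg_iff(2)[OF q nnq True] by simp
  next
    \<comment> \<open>If one side is not integrable, neither is the other, and both integrals are
      infinite.\<close>
    case False
    then have "\<not> p absolutely_integrable_on S" using cov' c by blast
    then show ?thesis
      using absolutely_integrable_nonneg_iff(1)[OF p nnp] absolutely_integrable_nonneg_iff(1)[OF q nnq] False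
      by (simp add: less_top[symmetric])
  qed
qed

text \<open>Conjugating \<open>g\<close> with the relabelling \<open>of_wo\<close> reduces this to
  the previous lemma, because Lebesgue measure and the Jacobian determinant are invariant under
  it.\<close>

lemma nn_integral_change_of_variables:
  fixes g :: "real^'k \<Rightarrow> real^'k"
  assumes S: "S \<in> sets borel"
    and der: "\<And>x. x \<in> S \<Longrightarrow> (g has_derivative g' x) (at x within S)" and inj: "inj_on g S"
    and p: "(\<lambda>x. indicator S x * p x) \<in> borel_measurable borel"
    and q: "(\<lambda>x. indicator (g ` S) x * q x) \<in> borel_measurable borel"
    and pq: "\<And>x. x \<in> S \<Longrightarrow> p x = \<bar>det (matrix (g' x))\<bar> * q (g x)"
    and nn: "\<And>x. x \<in> S \<Longrightarrow> 0 \<le> q (g x)"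
  shows "(\<integral>\<^sup>+x\<in>S. ennreal (p x) \<partial>lborel) = (\<integral>\<^sup>+x\<in>g ` S. ennreal (q x) \<partial>lborel)"
proof -
  let ?J = "of_wo :: real^('k wo) \<Rightarrow> real^'k" and ?K = "to_wo :: real^'k \<Rightarrow> _"
  have J: "?J \<in> borel_measurable borel"
    using borel_measurable_continuous_onI[OF linear_continuous_on[OF bounded_linear_of_wo]] by simp
  have tr: "(\<integral>\<^sup>+x\<in>A. ennreal (h x) \<partial>lborel) = (\<integral>\<^sup>+x\<in>?K ` A. ennreal (h (?J x)) \<partial>lborel)"
    if h: "(\<lambda>x. indicator A x * h x) \<in> borel_measurable borel" for h A
  proof -
    have e: "(\<integral>\<^sup>+x\<in>A. ennreal (h x) \<partial>lborel) = (\<integral>\<^sup>+x. ennreal (indicator A x * h x) \<partial>lborel)"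
      by (rule nn_integral_cong) (simp add: indicator_def)
    also have "\<dots> = (\<integral>\<^sup>+x. ennreal (indicator A (?J x) * h (?J x)) \<partial>lborel)"
      using h J by (subst lborel_of_wo, subst nn_integral_distr) auto
    also have "\<dots> = (\<integral>\<^sup>+x\<in>?K ` A. ennreal (h (?J x)) \<partial>lborel)"
    proof (rule nn_integral_cong)
      fix x
      have "?J x \<in> A \<longleftrightarrow> x \<in> ?K ` A" by (metis imageE image_eqI of_to_wo)
      then show "ennreal (indicator A (?J x) * h (?J x)) = ennreal (h (?J x)) * indicator (?K ` A) x"
        by (simp add: indicator_def)
    qed
    finally show ?thesis .
  qed
  have KA: "?K ` A = ?J -` A" for A by (auto simp: image_iff) (metis of_to_wo(2))
  define gg where "gg x = ?K (g (?J x))" for x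
  have im: "gg ` (?K ` S) = ?K ` (g ` S)" by (auto simp: gg_def image_iff)
  have lin: "linear (g' x)" if "x \<in> S" for x
    using der[OF that] has_derivative_linear by blast
  have meas: "(\<lambda>x. indicator (?K ` A) x * h (?J x)) \<in> borel_measurable borel"
    if "(\<lambda>x. indicator A x * h x) \<in> borel_measurable borel" for h :: "_ \<Rightarrow> real" and A
  proof -
    have "(\<lambda>x. indicator A (?J x) * h (?J x)) \<in> borel_measurable borel"
      using measurable_compose[OF J that] by simp
    then show ?thesis by (simp add: KA indicator_def)
  qed
  have "(\<integral>\<^sup>+x\<in>?K ` S. ennreal (p (?J x)) \<partial>lborel) = (\<integral>\<^sup>+x\<in>gg ` (?K ` S). ennreal (q (?J x)) \<partial>lborel)"
  proof (rule nn_integral_change_of_variables_wo[where g'="\<lambda>x v. ?K (g' (?J x) (?J v))"])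
    show "?K ` S \<in> sets borel" unfolding KA using J S by (simp add: measurable_sets_borel)
    show "inj_on gg (?K ` S)"
      unfolding inj_on_def gg_def using inj by (metis imageE inj_on_def of_to_wo)
    show "(gg has_derivative (\<lambda>v. ?K (g' (?J x) (?J v)))) (at x within ?K ` S)" if "x \<in> ?K ` S" for x
    proof -
      have 1: "(?J has_derivative ?J) (at x within ?K ` S)"
        by (rule bounded_linear_imp_has_derivative[OF bounded_linear_of_wo])
      have 2: "(g has_derivative g' (?J x)) (at (?J x) within ?J ` ?K ` S)"
        using der that by (auto simp: image_image)
      have 3: "(?K has_derivative ?K) (at (g (?J x)))"
        by (rule bounded_linear_imp_has_derivative[OF bounded_linear_to_wo])
      show ?thesis unfolding gg_def
        by (rule has_derivative_compose[OF has_derivative_in_compose[OF 1 2] 3, unfolded o_def])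
    qed
    show "p (?J x) = \<bar>det (matrix (\<lambda>v. ?K (g' (?J x) (?J v))))\<bar> * q (?J (gg x))" if "x \<in> ?K ` S" for x
      using that pq det_conj_wo[OF lin] by (auto simp: gg_def)
    show "0 \<le> q (?J (gg x))" if "x \<in> ?K ` S" for x
      using that nn by (auto simp: gg_def)
    show "(\<lambda>x. indicator (gg ` ?K ` S) x * q (?J x)) \<in> borel_measurable borel"
      unfolding im by (rule meas[OF q])
  qed (rule meas[OF p])
  then show ?thesis unfolding tr[OF p] tr[OF q] im .
qed

section \<open>Local parametrisations and the volume\<close>

definition gram :: "(real^'k \<Rightarrow> real^'n) \<Rightarrow> real^'k \<Rightarrow> real^'k^'k" where
  "gram f u = transpose (jac f u) ** jac f u"

definition gden :: "(real^'k \<Rightarrow> real^'n) \<Rightarrow> real^'k \<Rightarrow> real" where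
  "gden f u = sqrt (det (gram f u))"

text \<open>The tangential part of the position \<open>f u\<close>, in coordinates (\<open>rad\<close>) and in space (\<open>tpart\<close>).\<close>

definition rad :: "(real^'k \<Rightarrow> real^'n) \<Rightarrow> real^'k \<Rightarrow> real^'k" where
  "rad f u = matrix_inv (gram f u) *v (transpose (jac f u) *v f u)"

definition tpart :: "(real^'k \<Rightarrow> real^'n) \<Rightarrow> real^'k \<Rightarrow> real^'n" where
  "tpart f u = jac f u *v rad f u"

lemma volume_density_eq:
  "volume_density h f (u::real^'k) = sqrt (h (f u) ^ CARD('k)) * gden f u"
  by (simp add: volume_density_def Let_def gden_def gram_def jac_def det_matrix_smult real_sqrt_mult)

lemma continuous_on_det_entries:
  fixes M :: "'a::topological_space \<Rightarrow> real^'k^'k"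
  assumes "\<And>i j. continuous_on U (\<lambda>u. M u $ i $ j)"
  shows "continuous_on U (\<lambda>u. det (M u))"
  unfolding det_def
  by (intro continuous_on_sum continuous_on_mult continuous_on_const continuous_on_prod assms)

lemma param_subset: "C1_parametrisation f U \<Longrightarrow> V \<subseteq> U \<Longrightarrow> open V \<Longrightarrow> C1_parametrisation f V"
  unfolding C1_parametrisation_def by (meson C1_on_subset inj_on_subset subsetD)

lemma jac_works: "(f has_derivative f') (at u) \<Longrightarrow> jac f u *v v = f' v"
  unfolding jac_def by (metis fdI has_derivative_linear matrix_works linear_matrix_vector_mul_eq)

lemma
  assumes "C1_parametrisation f U"
  shows param_open: "open U" and param_C1: "C1_on f U" and param_inj: "inj_on f U"
    and param_continuous: "continuous_on U f"
  using assms C1_on_continuous unfolding C1_parametrisation_def by blast+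

text \<open>\<open>param_rad\<close> is the system of normal equations of least squares; it makes
  \<open>tpart\<close> the orthogonal projection of the position onto the tangent space.\<close>

lemma
  assumes "C1_parametrisation f U" "u \<in> U"
  shows param_has_derivative: "(f has_derivative fd f u) (at u)"
    and param_jac: "jac f u *v v = fd f u v"
    and param_jac_inj: "inj ((*v) (jac f u))"
    and param_gden_pos: "0 < gden f u"
    and param_det_gram_pos: "0 < det (gram f u)"
    and param_rad: "gram f u *v rad f u = transpose (jac f u) *v f u"
    and tpart_eq: "tpart f u = fd f u (rad f u)"
    and tpart_orthogonal: "(f u - tpart f u) \<bullet> fd f u w = 0"
proof -
  show d: "(f has_derivative fd f u) (at u)"
    using assms C1_on_has_derivative unfolding C1_parametrisation_def by blast
  show j: "jac f u *v v = fd f u v" for v using d by (rule jac_works)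
  then have "(*v) (jac f u) = fd f u" by auto
  then show i: "inj ((*v) (jac f u))" using assms unfolding C1_parametrisation_def by metis
  then show p: "0 < det (gram f u)" unfolding gram_def by (rule det_gram_pos)
  then show "0 < gden f u" by (simp add: gden_def)
  have "invertible (gram f u)" using i unfolding gram_def by (rule gram_invertible)
  then have "gram f u ** matrix_inv (gram f u) = mat 1"
    unfolding matrix_inv_def invertible_def by (rule someI2_ex) simp
  then show r: "gram f u *v rad f u = transpose (jac f u) *v f u"
    unfolding rad_def by (simp add: matrix_vector_mul_assoc)
  show "tpart f u = fd f u (rad f u)" by (simp add: tpart_def j)
  have "tpart f u \<bullet> (jac f u *v w) = (gram f u *v rad f u) \<bullet> w"
    by (simp add: tpart_def gram_def gram_mult_vec_inner)
  also have "\<dots> = f u \<bullet> (jac f u *v w)"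
    unfolding r by (metis dot_lmul_matrix transpose_matrix_vector)
  finally show "(f u - tpart f u) \<bullet> fd f u w = 0" by (simp add: j inner_diff_left)
qed

text \<open>Two tangent vectors with this property differ by a tangent vector orthogonal to itself.
  Hence \<open>tpart\<close> does not depend on the chart.\<close>

lemma tpart_unique:
  assumes "C1_parametrisation f U" "u \<in> U" "z = fd f u w0" "\<And>w. (f u - z) \<bullet> fd f u w = 0"
  shows "tpart f u = z"
proof -
  have "linear (fd f u)" using param_has_derivative[OF assms(1,2)] has_derivative_linear by blast
  then have d: "tpart f u - z = fd f u (rad f u - w0)"
    using tpart_eq[OF assms(1,2)] assms(3) by (simp add: linear_diff)
  have "(tpart f u - z) \<bullet> (tpart f u - z) = (f u - z) \<bullet> (tpart f u - z) - (f u - tpart f u) \<bullet> (tpart f u - z)"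
    by (simp add: inner_diff_left)
  also have "\<dots> = 0" unfolding d using assms(4) tpart_orthogonal[OF assms(1,2)] by simp
  finally show ?thesis by simp
qed

lemma tpart_pythagoras:
  assumes "C1_parametrisation f U" "u \<in> U"
  shows "(norm (f u))\<^sup>2 = (norm (tpart f u))\<^sup>2 + (norm (f u - tpart f u))\<^sup>2"
proof -
  have "(f u - tpart f u) \<bullet> tpart f u = 0"
    using tpart_orthogonal[OF assms] tpart_eq[OF assms] by simp
  then show ?thesis
    by (simp add: power2_norm_eq_inner inner_diff_left inner_diff_right inner_commute)
qed

lemma
  assumes "C1_parametrisation f U"
  shows jac_continuous: "continuous_on U (\<lambda>u. jac f u $ i $ j)"
    and gden_continuous: "continuous_on U (gden f)"
    and rad_continuous: "continuous_on U (rad f)"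
    and tpart_continuous: "continuous_on U (tpart f)"
proof -
  show j: "continuous_on U (\<lambda>u. jac f u $ i $ j)" for i j
    using C1_on_continuous_fd[OF param_C1[OF assms] continuous_on_const, of "axis j 1"]
    by (auto simp: jac_def matrix_def intro: continuous_on_component)
  have g: "continuous_on U (\<lambda>u. gram f u $ a $ b)" for a b
    by (simp add: gram_def matrix_matrix_mult_def transpose_def) (intro continuous_on_sum continuous_on_mult j)
  have d: "continuous_on U (\<lambda>u. det (gram f u))"
    by (rule continuous_on_det_entries) (rule g)
  then show "continuous_on U (gden f)" unfolding gden_def by (intro continuous_intros)
  let ?b = "\<lambda>u. transpose (jac f u) *v f u"
  have b: "continuous_on U (\<lambda>u. ?b u $ i)" for i
    by (simp add: matrix_vector_mult_def transpose_def)
       (intro continuous_on_sum continuous_on_mult j continuous_on_component param_continuous[OF assms])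
  \<comment> \<open>Cramer's rule exhibits \<open>rad\<close> as a quotient of determinants with
    continuous entries and nonzero denominator, so continuity of \<open>matrix_inv\<close> is not
    called upon.\<close>
  have "rad f u = (\<chi> k. det (\<chi> i j. if j = k then ?b u $ i else gram f u $ i $ j) / det (gram f u))"
    if "u \<in> U" for u
    using cramer[of "gram f u" "rad f u" "?b u"] param_det_gram_pos[OF assms that]
      param_rad[OF assms that] by simp
  moreover have "continuous_on U (\<lambda>u. \<chi> k. det (\<chi> i j. if j = k then ?b u $ i else gram f u $ i $ j) / det (gram f u))"
  proof (intro continuous_on_vec_lambda continuous_on_divide d continuous_on_det_entries)
    show "\<forall>u\<in>U. det (gram f u) \<noteq> 0" using param_det_gram_pos[OF assms] by force
    show "continuous_on U (\<lambda>u. (\<chi> i j. if j = k then ?b u $ i else gram f u $ i $ j) $ i $ j)" for k i j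
      using b[of i] g[of i j] by (cases "j = k") simp_all
  qed
  ultimately show r: "continuous_on U (rad f)" by (simp cong: continuous_on_cong)
  have "continuous_on U (\<lambda>u. fd f u (rad f u))"
    by (rule C1_on_continuous_fd[OF param_C1[OF assms] r])
  then show "continuous_on U (tpart f)"
    using tpart_eq[OF assms] by (simp cong: continuous_on_cong)
qed

text \<open>The inverse \<open>\<kappa>\<close> of the parametrisation is differentiable on an open subset of the ambient space,
  which makes transition maps differentiable without an inverse function theorem.\<close>

definition pchart ::
    "(real^'n) set \<Rightarrow> (real^'k \<Rightarrow> real^'n) \<Rightarrow> (real^'k) set \<Rightarrow> (real^'n) set \<Rightarrow> (real^'n \<Rightarrow> real^'k) \<Rightarrow> bool" where
  "pchart A f U W \<kappa> \<longleftrightarrow> open W \<and> C1_parametrisation f U \<and> f ` U = A \<inter> W \<and>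
     (\<forall>x\<in>W. \<kappa> differentiable (at x)) \<and> (\<forall>u\<in>U. \<kappa> (f u) = u)"

text \<open>The chain rule \<open>Dg = Df \<circ> Dt\<close> for the transition map \<open>t\<close>
  makes the two Gram matrices congruent through \<open>Dt\<close>, so the densities differ by
  \<open>|det Dt|\<close>. As \<open>Dt\<close> is bijective, both charts have the same tangent
  space and the same projection of the position.\<close>

lemma transition:
  fixes f :: "real^'k \<Rightarrow> real^'n" and g :: "real^'k \<Rightarrow> real^'n"
  assumes A: "pchart A f U W \<kappa>" and g: "C1_parametrisation g V" "g ` V \<subseteq> A" and v: "v \<in> V" "g v \<in> W"
  shows "\<kappa> (g v) \<in> U" "f (\<kappa> (g v)) = g v"
    and "((\<lambda>v. \<kappa> (g v)) has_derivative fd (\<lambda>v. \<kappa> (g v)) v) (at v)"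
    and "gden g v = \<bar>det (matrix (fd (\<lambda>v. \<kappa> (g v)) v))\<bar> * gden f (\<kappa> (g v))"
    and "tpart g v = tpart f (\<kappa> (g v))"
proof -
  let ?t = "\<lambda>v. \<kappa> (g v)"
  have A': "open W" "C1_parametrisation f U" "f ` U = A \<inter> W" "\<And>x. x \<in> W \<Longrightarrow> \<kappa> differentiable (at x)"
    "\<And>u. u \<in> U \<Longrightarrow> \<kappa> (f u) = u" using A unfolding pchart_def by auto
  have tU: "?t w \<in> U \<and> f (?t w) = g w" if "w \<in> V" "g w \<in> W" for w
  proof -
    have "g w \<in> f ` U" using that g(2) A'(3) by auto
    then show ?thesis using A'(5) by auto
  qed
  show u: "\<kappa> (g v) \<in> U" "f (\<kappa> (g v)) = g v" using tU[OF v] by auto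
  have "?t differentiable (at v)"
    using differentiable_compose[of \<kappa> g v UNIV] A'(4)[OF v(2)] param_has_derivative[OF g(1) v(1)]
    by (meson differentiableI differentiable_at_withinI differentiable_compose differentiable_def
      differentiable_chain_at o_def)
  then show dt: "(?t has_derivative fd ?t v) (at v)"
    by (simp add: frechet_derivative_works)
  let ?O = "{w \<in> V. g w \<in> W}"
  have "open ?O"
    using continuous_open_preimage[OF param_continuous[OF g(1)] param_open[OF g(1)] A'(1)]
    by (simp add: vimage_def Int_def)
  moreover have "v \<in> ?O" using v by simp
  ultimately have "((\<lambda>w. f (?t w)) has_derivative fd g v) (at v)"
    by (intro has_derivative_transform_within_open[OF param_has_derivative[OF g(1) v(1)]]) (use tU in auto)
  then have ch: "fd g v = (\<lambda>w. fd f (?t v) (fd ?t v w))"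
    using has_derivative_compose[OF dt param_has_derivative[OF A'(2) u(1)]]
    by (rule has_derivative_unique)
  let ?T = "matrix (fd ?t v)"
  have lt: "linear (fd ?t v)" using dt has_derivative_linear by blast
  have "jac g v *v w = (jac f (?t v) ** ?T) *v w" for w
    using param_jac[OF g(1) v(1)] param_jac[OF A'(2) u(1)] ch
    by (simp add: matrix_vector_mul_assoc[symmetric] matrix_works[OF lt[folded linear_matrix_vector_mul_eq]] matrix_works lt)
  then have J: "jac g v = jac f (?t v) ** ?T" by (simp add: matrix_eq)
  have "gram g v = transpose ?T ** gram f (?t v) ** ?T"
    unfolding gram_def J by (simp add: matrix_transpose_mul matrix_mul_assoc)
  then have "det (gram g v) = (det ?T)\<^sup>2 * det (gram f (?t v))"
    by (simp add: det_mul power2_eq_square)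
  then show "gden g v = \<bar>det ?T\<bar> * gden f (?t v)"
    by (simp add: gden_def real_sqrt_mult)
  \<comment> \<open>Injectivity of \<open>Dg\<close> passes to \<open>Dt\<close>, which is then
    surjective for reasons of dimension. A preimage \<open>w0\<close> of \<open>rad f\<close> shows
    that the projection computed in chart \<open>f\<close> is tangent in chart
    \<open>g\<close>.\<close>
  have "inj (fd g v)" using g(1) v(1) unfolding C1_parametrisation_def by blast
  then have "inj (fd ?t v)" unfolding ch by (auto simp: inj_def)
  then have "surj (fd ?t v)" using lt linear_injective_imp_surjective by blast
  then obtain w0 where w0: "rad f (?t v) = fd ?t v w0" by (metis surjD)
  show "tpart g v = tpart f (?t v)"
  proof (rule tpart_unique[OF g(1) v(1), of _ w0])
    show "tpart f (?t v) = fd g v w0"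
      using tpart_eq[OF A'(2) u(1)] w0 ch by simp
    show "(g v - tpart f (?t v)) \<bullet> fd g v w = 0" for w
      using tpart_orthogonal[OF A'(2) u(1)] u(2) ch by simp
  qed
qed

lemma borel_preimage_continuous_on:
  assumes "continuous_on A h" "A \<in> sets borel" "B \<in> sets borel"
  shows "{x \<in> A. h x \<in> B} \<in> sets borel"
proof -
  have "h \<in> borel_measurable (restrict_space borel A)"
    using assms(1) by (rule borel_measurable_continuous_on_restrict)
  from measurable_sets[OF this assms(3)] have "h -` B \<inter> A \<in> sets (restrict_space borel A)"
    by (simp add: space_restrict_space)
  then have "h -` B \<inter> A \<in> sets borel" using assms(2) by (simp add: sets_restrict_space_iff)
  moreover have "{x \<in> A. h x \<in> B} = h -` B \<inter> A" by auto
  ultimately show ?thesis by simp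
qed

lemma borel_measurable_indicator_times:
  fixes g :: "'a::euclidean_space \<Rightarrow> 'b::euclidean_space" and F :: "'b \<Rightarrow> real" and r :: "'a \<Rightarrow> real"
  assumes "continuous_on V g" "continuous_on V r" "V \<in> sets borel" "T \<in> sets borel" "T \<subseteq> V"
    and F: "F \<in> borel_measurable borel"
  shows "(\<lambda>x. indicator T x * (F (g x) * r x)) \<in> borel_measurable borel"
proof -
  have g: "(\<lambda>x. indicator V x *\<^sub>R g x) \<in> borel_measurable borel"
    and r: "(\<lambda>x. indicator V x *\<^sub>R r x) \<in> borel_measurable borel"
    using assms(1-3) by (simp_all only: borel_measurable_continuous_on_indicator)
  have "(\<lambda>x. F (indicator V x *\<^sub>R g x)) \<in> borel_measurable borel"
    by (rule measurable_compose[OF g F])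
  then have "(\<lambda>x. indicator T x * (F (indicator V x *\<^sub>R g x) * (indicator V x *\<^sub>R r x))) \<in> borel_measurable borel"
    using r assms(4) by measurable
  moreover have "(\<lambda>x. indicator T x * (F (indicator V x *\<^sub>R g x) * (indicator V x *\<^sub>R r x))) = (\<lambda>x. indicator T x * (F (g x) * r x))"
    using assms(5) by (auto simp: indicator_def fun_eq_iff)
  ultimately show ?thesis by simp
qed

text \<open>The transition map is continuous and injective between open sets of equal dimension,
  hence a homeomorphism onto an open set by invariance of domain. Its continuous inverse shows that
  the image of \<open>T\<close> is Borel, and the change of variables formula applies.\<close>

lemma nn_integral_reparametrise:
  fixes f :: "real^'k \<Rightarrow> real^'n" and g :: "real^'k \<Rightarrow> real^'n"
  assumes A: "pchart A f U W \<kappa>" and g: "C1_parametrisation g V" "g ` V \<subseteq> A"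
    and T: "T \<in> sets borel" "T \<subseteq> V" "g ` T \<subseteq> W"
    and F: "F \<in> borel_measurable borel" "\<And>x. 0 \<le> F x"
  shows "{u \<in> U. f u \<in> g ` T} \<in> sets borel"
    and "(\<integral>\<^sup>+v\<in>T. ennreal (F (g v) * gden g v) \<partial>lborel) =
         (\<integral>\<^sup>+u\<in>{u \<in> U. f u \<in> g ` T}. ennreal (F (f u) * gden f u) \<partial>lborel)"
proof -
  let ?t = "\<lambda>v. \<kappa> (g v)" and ?O = "{w \<in> V. g w \<in> W}"
  have A': "open W" "C1_parametrisation f U" "f ` U = A \<inter> W"
    "\<And>u. u \<in> U \<Longrightarrow> \<kappa> (f u) = u" using A unfolding pchart_def by auto
  have oO: "open ?O"
    using continuous_open_preimage[OF param_continuous[OF g(1)] param_open[OF g(1)] A'(1)]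
    by (simp add: vimage_def Int_def)
  have inj: "inj_on ?t ?O"
  proof (rule inj_onI)
    fix v w assume vw: "v \<in> ?O" "w \<in> ?O" "?t v = ?t w"
    then have "g v = g w" using transition(2)[OF A g] by (metis mem_Collect_eq)
    then show "v = w" using param_inj[OF g(1)] vw by (auto dest: inj_onD)
  qed
  have cont: "continuous_on ?O ?t"
    using has_derivative_continuous[OF transition(3)[OF A g]]
    by (intro continuous_at_imp_continuous_on ballI) simp
  have TO: "T \<subseteq> ?O" using T by auto
  obtain s where "homeomorphism ?O (?t ` ?O) ?t s"
    using invariance_of_domain_homeomorphism[OF oO cont order_refl inj] .
  then have s: "continuous_on (?t ` ?O) s" "\<And>x. x \<in> ?O \<Longrightarrow> s (?t x) = x"
    unfolding homeomorphism_def by blast+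
  have ope: "open (?t ` ?O)" by (rule invariance_of_domain[OF cont oO inj])
  have im: "?t ` T = {u \<in> U. f u \<in> g ` T}"
  proof (intro equalityI subsetI)
    fix u assume "u \<in> ?t ` T"
    then show "u \<in> {u \<in> U. f u \<in> g ` T}" using TO transition(1,2)[OF A g] by auto
  next
    fix u assume "u \<in> {u \<in> U. f u \<in> g ` T}"
    then obtain v where v: "u \<in> U" "v \<in> T" "f u = g v" by auto
    then have "u = ?t v" using A'(4)[of u] by simp
    then show "u \<in> ?t ` T" using v(2) by blast
  qed
  have "?t ` T = {y \<in> ?t ` ?O. s y \<in> T}"
  proof (intro equalityI subsetI)
    fix y assume "y \<in> ?t ` T"
    then show "y \<in> {y \<in> ?t ` ?O. s y \<in> T}" using TO s(2) by auto
  next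
    fix y assume "y \<in> {y \<in> ?t ` ?O. s y \<in> T}"
    then obtain x where x: "x \<in> ?O" "y = ?t x" "s y \<in> T" by auto
    then have "x \<in> T" using s(2) by metis
    then show "y \<in> ?t ` T" using x by blast
  qed
  then have bt: "?t ` T \<in> sets borel"
    using borel_preimage_continuous_on[OF s(1) _ T(1)] ope by simp
  then show "{u \<in> U. f u \<in> g ` T} \<in> sets borel" unfolding im .
  show "(\<integral>\<^sup>+v\<in>T. ennreal (F (g v) * gden g v) \<partial>lborel) =
         (\<integral>\<^sup>+u\<in>{u \<in> U. f u \<in> g ` T}. ennreal (F (f u) * gden f u) \<partial>lborel)"
    unfolding im[symmetric]
  proof (rule nn_integral_change_of_variables[OF T(1), where g'="fd ?t"])
    show "(?t has_derivative fd ?t x) (at x within T)" if "x \<in> T" for x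
      using that TO transition(3)[OF A g] by (auto intro: has_derivative_at_withinI)
    show "inj_on ?t T" using inj TO by (rule inj_on_subset)
    show "(\<lambda>x. indicator T x * (F (g x) * gden g x)) \<in> borel_measurable borel"
      by (rule borel_measurable_indicator_times[OF param_continuous[OF g(1)] gden_continuous[OF g(1)] _ T(1,2) F(1)])
         (use param_open[OF g(1)] in simp)
    show "(\<lambda>x. indicator (?t ` T) x * (F (f x) * gden f x)) \<in> borel_measurable borel"
      by (rule borel_measurable_indicator_times[OF param_continuous[OF A'(2)] gden_continuous[OF A'(2)] _ bt _ F(1)])
         (use param_open[OF A'(2)] im in auto)
    show "F (g x) * gden g x = \<bar>det (matrix (fd ?t x))\<bar> * (F (f (?t x)) * gden f (?t x))" if "x \<in> T" for x
      using that TO transition(2,4)[OF A g, of x] by auto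
    show "0 \<le> F (f (?t x)) * gden f (?t x)" if "x \<in> T" for x
      using that TO transition(1)[OF A g, of x] param_gden_pos[OF A'(2)] F(2)
      by (intro mult_nonneg_nonneg) (auto intro: less_imp_le)
  qed
qed

lemma pchart_param: "pchart A f U W \<kappa> \<Longrightarrow> C1_parametrisation f U"
  and pchart_image: "pchart A f U W \<kappa> \<Longrightarrow> f ` U = A \<inter> W"
  and pchart_open: "pchart A f U W \<kappa> \<Longrightarrow> open W"
  and pchart_inverse: "pchart A f U W \<kappa> \<Longrightarrow> u \<in> U \<Longrightarrow> \<kappa> (f u) = u"
  by (simp_all add: pchart_def)

text \<open>Disjoint Borel pieces, each inside one chart, cut the parameter set of \<open>g\<close>
  so that every part can be moved into a single chart.\<close>

lemma nn_integral_split_charts: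
  fixes f :: "nat \<Rightarrow> real^'k \<Rightarrow> real^'n" and g :: "real^'k \<Rightarrow> real^'n"
  assumes ch: "\<And>j. j < N \<Longrightarrow> pchart A (f j) (U j) (W j) (\<kappa> j)"
    and g: "C1_parametrisation g V" "g ` V \<subseteq> A"
    and T: "T \<in> sets borel" "T \<subseteq> V"
    and B: "\<And>j. j < N \<Longrightarrow> B j \<in> sets borel" "\<And>j. j < N \<Longrightarrow> B j \<subseteq> W j"
    and disj: "disjoint_family_on B {..<N}" and cov: "g ` T \<subseteq> (\<Union>j<N. B j)"
    and F: "F \<in> borel_measurable borel" "\<And>x. 0 \<le> F x"
  shows "(\<integral>\<^sup>+v\<in>T. ennreal (F (g v) * gden g v) \<partial>lborel) =
    (\<Sum>j<N. \<integral>\<^sup>+u\<in>{u \<in> U j. f j u \<in> g ` T \<inter> B j}. ennreal (F (f j u) * gden (f j) u) \<partial>lborel)"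
proof -
  let ?p = "\<lambda>v. F (g v) * gden g v" and ?T = "\<lambda>j. {v \<in> T. g v \<in> B j}"
  have cg: "continuous_on V g" by (rule param_continuous[OF g(1)])
  have bV: "V \<in> sets borel" using param_open[OF g(1)] by simp
  have bT: "?T j \<in> sets borel" if "j < N" for j
    using borel_preimage_continuous_on[OF continuous_on_subset[OF cg T(2)] T(1) B(1)[OF that]] .
  have m: "(\<lambda>v. indicator (?T j) v * ?p v) \<in> borel_measurable borel" if "j < N" for j
    by (rule borel_measurable_indicator_times[OF cg gden_continuous[OF g(1)] bV bT[OF that] _ F(1)]) (use T in auto)
  have pt: "ennreal (?p v) * indicator T v = (\<Sum>j<N. ennreal (indicator (?T j) v * ?p v))" for v
  proof (cases "v \<in> T")
    case True
    then obtain j where j: "j < N" "g v \<in> B j" using cov by auto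
    have z: "g v \<notin> B i" if "i < N" "i \<noteq> j" for i
      using disj j that unfolding disjoint_family_on_def by blast
    have "(\<Sum>i<N. ennreal (indicator (?T i) v * ?p v)) = (\<Sum>i<N. if i = j then ennreal (?p v) else 0)"
      by (rule sum.cong) (use True j z in \<open>auto simp: indicator_def\<close>)
    then show ?thesis using True j by (simp add: indicator_def)
  qed (simp add: indicator_def)
  have "(\<integral>\<^sup>+v\<in>T. ennreal (?p v) \<partial>lborel) = (\<Sum>j<N. \<integral>\<^sup>+v. ennreal (indicator (?T j) v * ?p v) \<partial>lborel)"
    unfolding pt by (rule nn_integral_sum) (use m in auto)
  also have "\<dots> = (\<Sum>j<N. \<integral>\<^sup>+u\<in>{u \<in> U j. f j u \<in> g ` T \<inter> B j}. ennreal (F (f j u) * gden (f j) u) \<partial>lborel)"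
  proof (rule sum.cong)
    fix j assume "j \<in> {..<N}"
    then have j: "j < N" by simp
    have "(\<integral>\<^sup>+v. ennreal (indicator (?T j) v * ?p v) \<partial>lborel) = (\<integral>\<^sup>+v\<in>?T j. ennreal (?p v) \<partial>lborel)"
      by (rule nn_integral_cong) (simp add: indicator_def)
    also have "\<dots> = (\<integral>\<^sup>+u\<in>{u \<in> U j. f j u \<in> g ` ?T j}. ennreal (F (f j u) * gden (f j) u) \<partial>lborel)"
      by (rule nn_integral_reparametrise(2)[OF ch[OF j] g bT[OF j] _ _ F]) (use T B(2)[OF j] in auto)
    also have "g ` ?T j = g ` T \<inter> B j" by auto
    finally show "(\<integral>\<^sup>+v. ennreal (indicator (?T j) v * ?p v) \<partial>lborel) =
      (\<integral>\<^sup>+u\<in>{u \<in> U j. f j u \<in> g ` T \<inter> B j}. ennreal (F (f j u) * gden (f j) u) \<partial>lborel)" .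
  qed simp
  finally show ?thesis .
qed

lemma nn_integral_sum_indicator_le:
  fixes q :: "'a::euclidean_space \<Rightarrow> 'b \<Rightarrow> real"
  assumes "finite I" "\<And>i. i \<in> I \<Longrightarrow> (\<lambda>u. indicator (S i) u * q u i) \<in> borel_measurable borel"
    and "\<And>u. (\<Sum>i\<in>I. ennreal (indicator (S i) u * q u i)) \<le> ennreal (r u) * indicator R u"
  shows "(\<Sum>i\<in>I. \<integral>\<^sup>+u\<in>S i. ennreal (q u i) \<partial>lborel) \<le> (\<integral>\<^sup>+u\<in>R. ennreal (r u) \<partial>lborel)"
proof -
  have "(\<Sum>i\<in>I. \<integral>\<^sup>+u\<in>S i. ennreal (q u i) \<partial>lborel) = (\<Sum>i\<in>I. \<integral>\<^sup>+u. ennreal (indicator (S i) u * q u i) \<partial>lborel)"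
    by (intro sum.cong nn_integral_cong refl) (simp add: indicator_def)
  also have "\<dots> = (\<integral>\<^sup>+u. (\<Sum>i\<in>I. ennreal (indicator (S i) u * q u i)) \<partial>lborel)"
    using assms(2) by (subst nn_integral_sum) auto
  also have "\<dots> \<le> (\<integral>\<^sup>+u\<in>R. ennreal (r u) \<partial>lborel)"
    by (rule nn_integral_mono) (rule assms(3))
  finally show ?thesis .
qed

section \<open>Computing \<open>kvolume\<close> with weights in finitely many charts\<close>

text \<open>Scaling a metric by \<open>h\<close> multiplies \<open>k\<close>-dimensional volume by
  the power \<open>k/2\<close> of \<open>h\<close>.\<close>

definition factor :: "'k::finite itself \<Rightarrow> (real^'n \<Rightarrow> real) \<Rightarrow> real^'n \<Rightarrow> real" where
  "factor _ h x = sqrt (h x ^ CARD('k))"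

lemma volume_density_factor: "volume_density h f (u::real^'k) = factor TYPE('k) h (f u) * gden f u"
  by (simp add: volume_density_eq factor_def)

text \<open>Weights with sum at most 1 never count a point more than once: redistributed over a
  disjoint refinement of the charts, the weighted integrals stay below the unweighted sum of that
  refinement, which is one of the sums in the supremum. This bounds the cone volume from
  below.\<close>

lemma kvolume_ge_weighted_sum:
  fixes f :: "nat \<Rightarrow> real^'k \<Rightarrow> real^'n"
  assumes ch: "\<And>j. j < N \<Longrightarrow> pchart A (f j) (U j) (W j) (\<kappa> j)"
    and h: "h \<in> borel_measurable borel" "\<And>x. 0 \<le> h x"
    and \<rho>: "\<And>j. j < N \<Longrightarrow> \<rho> j \<in> borel_measurable borel" "\<And>j x. 0 \<le> \<rho> j x"
      "\<And>x. x \<in> A \<Longrightarrow> (\<Sum>j<N. \<rho> j x) \<le> 1"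
  shows "(\<Sum>j<N. \<integral>\<^sup>+u\<in>U j. ennreal (\<rho> j (f j u) * volume_density h (f j) u) \<partial>lborel) \<le> kvolume TYPE('k) h A"
proof -
  let ?c = "factor TYPE('k) h"
  have c: "?c \<in> borel_measurable borel" "\<And>x. 0 \<le> ?c x"
    using h by (auto simp: factor_def[abs_def])
  \<comment> \<open>Each chart keeps only what the earlier charts have missed.\<close>
  define B where "B j = W j - (\<Union>i<j. W i)" for j
  define S where "S j = {u \<in> U j. f j u \<in> B j}" for j
  have ope: "open (W j)" if "j < N" for j using ch[OF that] by (rule pchart_open)
  have B: "B j \<in> sets borel" "B j \<subseteq> W j" if "j < N" for j
    using ope that by (auto simp: B_def intro!: sets.Diff borel_open open_UN)
  have disj: "disjoint_family_on B {..<N}"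
    unfolding disjoint_family_on_def
  proof (intro ballI impI)
    fix m n :: nat assume "m \<noteq> n"
    then show "B m \<inter> B n = {}" by (cases m n rule: linorder_cases) (auto simp: B_def)
  qed
  have un: "(\<Union>j<N. B j) = (\<Union>j<N. W j)"
  proof (intro equalityI subsetI)
    fix x assume "x \<in> (\<Union>j<N. W j)"
    then obtain j where j: "j < N" "x \<in> W j" by auto
    define i where "i = (LEAST i. x \<in> W i)"
    have "x \<in> W i" unfolding i_def using j(2) by (rule LeastI)
    moreover have "x \<notin> W l" if "l < i" for l using that unfolding i_def by (rule not_less_Least)
    moreover have "i \<le> j" unfolding i_def using j(2) by (rule Least_le)
    ultimately
    have "x \<in> B i" "i < N" using j by (auto simp: B_def)
    then show "x \<in> (\<Union>j<N. B j)" by auto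
  qed (auto simp: B_def)
  have par: "C1_parametrisation (f j) (U j)" "f j ` U j \<subseteq> A" "f j ` U j \<subseteq> W j" if "j < N" for j
    using pchart_param[OF ch[OF that]] pchart_image[OF ch[OF that]] by auto
  have bU: "U j \<in> sets borel" if "j < N" for j using param_open[OF par(1)[OF that]] by simp
  have bS: "S j \<in> sets borel" if "j < N" for j
    unfolding S_def by (rule borel_preimage_continuous_on[OF param_continuous[OF par(1)] bU B(1)]) (use that in auto)
  have S_subset: "S j \<subseteq> U j" for j by (auto simp: S_def)
  have bSi: "{u \<in> U j. f j u \<in> f i ` U i \<inter> B j} \<in> sets borel" if "i < N" "j < N" for i j
  proof -
    have "{u \<in> U j. f j u \<in> f i ` U i \<inter> B j} = {u \<in> U j. f j u \<in> W i \<inter> B j}"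
      using pchart_image[OF ch[OF that(1)]] par(2)[OF that(2)] by auto
    moreover have "{u \<in> U j. f j u \<in> W i \<inter> B j} \<in> sets borel"
      by (rule borel_preimage_continuous_on[OF param_continuous[OF par(1)] bU]) (use that ope B in auto)
    ultimately show ?thesis by simp
  qed
  have "(\<Sum>i<N. \<integral>\<^sup>+u\<in>U i. ennreal (\<rho> i (f i u) * volume_density h (f i) u) \<partial>lborel)
     = (\<Sum>i<N. \<integral>\<^sup>+u\<in>U i. ennreal ((\<rho> i (f i u) * ?c (f i u)) * gden (f i) u) \<partial>lborel)"
    by (simp add: volume_density_factor mult.assoc)
  \<comment> \<open>Chart \<open>i\<close> is cut along the pieces \<open>B j\<close>, and the part
    in \<open>B j\<close> is rewritten in chart \<open>j\<close>; after the sums are exchanged, all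
    weights meet in the same chart.\<close>
  also have "\<dots> = (\<Sum>i<N. \<Sum>j<N. \<integral>\<^sup>+u\<in>{u \<in> U j. f j u \<in> f i ` U i \<inter> B j}.
       ennreal ((\<rho> i (f j u) * ?c (f j u)) * gden (f j) u) \<partial>lborel)"
  proof (rule sum.cong)
    fix i assume "i \<in> {..<N}"
    then have i: "i < N" by simp
    show "(\<integral>\<^sup>+u\<in>U i. ennreal ((\<rho> i (f i u) * ?c (f i u)) * gden (f i) u) \<partial>lborel) =
       (\<Sum>j<N. \<integral>\<^sup>+u\<in>{u \<in> U j. f j u \<in> f i ` U i \<inter> B j}. ennreal ((\<rho> i (f j u) * ?c (f j u)) * gden (f j) u) \<partial>lborel)"
    proof (rule nn_integral_split_charts[where F="\<lambda>x. \<rho> i x * ?c x", OF ch par(1,2)[OF i] bU[OF i] order_refl B disj])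
      show "f i ` U i \<subseteq> (\<Union>j<N. B j)" using par(3)[OF i] i un by auto
      show "(\<lambda>x. \<rho> i x * ?c x) \<in> borel_measurable borel" using \<rho>(1)[OF i] c(1) by simp
      show "0 \<le> \<rho> i x * ?c x" for x using \<rho>(2) c(2) by simp
    qed auto
  qed simp
  also have "\<dots> = (\<Sum>j<N. \<Sum>i<N. \<integral>\<^sup>+u\<in>{u \<in> U j. f j u \<in> f i ` U i \<inter> B j}.
       ennreal ((\<rho> i (f j u) * ?c (f j u)) * gden (f j) u) \<partial>lborel)"
    by (rule sum.swap)
  also have "\<dots> \<le> (\<Sum>j<N. \<integral>\<^sup>+u\<in>S j. ennreal (volume_density h (f j) u) \<partial>lborel)"
  proof (rule sum_mono)
    fix j assume "j \<in> {..<N}"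
    then have j: "j < N" by simp
    show "(\<Sum>i<N. \<integral>\<^sup>+u\<in>{u \<in> U j. f j u \<in> f i ` U i \<inter> B j}.
       ennreal ((\<rho> i (f j u) * ?c (f j u)) * gden (f j) u) \<partial>lborel) \<le> (\<integral>\<^sup>+u\<in>S j. ennreal (volume_density h (f j) u) \<partial>lborel)"
    proof (rule nn_integral_sum_indicator_le)
      show "(\<lambda>u. indicator {u \<in> U j. f j u \<in> f i ` U i \<inter> B j} u * ((\<rho> i (f j u) * ?c (f j u)) * gden (f j) u)) \<in> borel_measurable borel"
        if "i \<in> {..<N}" for i
        by (rule borel_measurable_indicator_times[where F="\<lambda>x. \<rho> i x * ?c x", OF param_continuous[OF par(1)[OF j]] gden_continuous[OF par(1)[OF j]] bU[OF j] bSi])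
           (use that j \<rho>(1)[of i] c(1) in auto)
      fix u
      have g0: "0 \<le> gden (f j) u" if "u \<in> U j" using param_gden_pos[OF par(1)[OF j] that] by simp
      show "(\<Sum>i<N. ennreal (indicator {u \<in> U j. f j u \<in> f i ` U i \<inter> B j} u * (\<rho> i (f j u) * ?c (f j u) * gden (f j) u)))
        \<le> ennreal (volume_density h (f j) u) * indicator (S j) u"
      proof (cases "u \<in> S j")
        case True
        then have u: "u \<in> U j" by (simp add: S_def)
        let ?v = "?c (f j u) * gden (f j) u"
        have v: "0 \<le> ?v" using c(2) g0[OF u] by simp
        have "(\<Sum>i<N. ennreal (indicator {u \<in> U j. f j u \<in> f i ` U i \<inter> B j} u * (\<rho> i (f j u) * ?c (f j u) * gden (f j) u)))
           \<le> (\<Sum>i<N. ennreal (\<rho> i (f j u) * ?v))"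
          by (intro sum_mono ennreal_leI) (use \<rho>(2) v in \<open>auto simp: indicator_def mult.assoc\<close>)
        also have "\<dots> = ennreal ((\<Sum>i<N. \<rho> i (f j u)) * ?v)"
          using \<rho>(2) v by (subst sum_ennreal) (auto simp: sum_distrib_right)
        also have "\<dots> \<le> ennreal (1 * ?v)"
          by (intro ennreal_leI mult_right_mono \<rho>(3) v) (use par(2)[OF j] u in auto)
        finally show ?thesis using True by (simp add: volume_density_factor)
      qed (auto simp: S_def indicator_def)
    qed simp
  qed
  also have "\<dots> \<le> kvolume TYPE('k) h A"
    unfolding kvolume_def
  proof (rule SUP_upper2[where i="(N, f, U, S)"])
    have "disjoint_family_on (\<lambda>i. f i ` S i) {..<N}"
      unfolding disjoint_family_on_def
    proof (intro ballI impI)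
      fix m n assume "m \<in> {..<N}" "n \<in> {..<N}" "m \<noteq> n"
      then have "B m \<inter> B n = {}" using disj unfolding disjoint_family_on_def by blast
      moreover have "f m ` S m \<subseteq> B m" "f n ` S n \<subseteq> B n" by (auto simp: S_def)
      ultimately show "f m ` S m \<inter> f n ` S n = {}" by blast
    qed
    moreover have "\<forall>i<N. C1_parametrisation (f i) (U i) \<and> f i ` U i \<subseteq> A \<and> S i \<in> sets borel \<and> S i \<subseteq> U i"
      using par(1,2) bS S_subset by blast
    ultimately show "(N, f, U, S) \<in> {(N, f, U, S). (\<forall>i<N. C1_parametrisation (f i) (U i) \<and> f i ` U i \<subseteq> A \<and>
                 S i \<in> sets borel \<and> S i \<subseteq> U i) \<and> disjoint_family_on (\<lambda>i. f i ` S i) {..<N}}"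
      by (simp only: mem_Collect_eq case_prod_conv simp_thms)
  qed simp
  finally show ?thesis .
qed

text \<open>Any family competing in the supremum is split by the weights and moved into the charts.
  There its pieces stay disjoint, so in each chart they add up to at most the full weighted
  integral. This bounds the volume of \<open>M\<close> from above.\<close>

lemma kvolume_le_weighted_sum:
  fixes f :: "nat \<Rightarrow> real^'k \<Rightarrow> real^'n"
  assumes ch: "\<And>j. j < N \<Longrightarrow> pchart A (f j) (U j) (W j) (\<kappa> j)"
    and h: "h \<in> borel_measurable borel" "\<And>x. 0 \<le> h x"
    and \<rho>: "\<And>j. j < N \<Longrightarrow> \<rho> j \<in> borel_measurable borel" "\<And>j x. 0 \<le> \<rho> j x"
      "\<And>x. x \<in> A \<Longrightarrow> (\<Sum>j<N. \<rho> j x) = 1" "\<And>j x. j < N \<Longrightarrow> x \<in> A - W j \<Longrightarrow> \<rho> j x = 0"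
  shows "kvolume TYPE('k) h A \<le> (\<Sum>j<N. \<integral>\<^sup>+u\<in>U j. ennreal (\<rho> j (f j u) * volume_density h (f j) u) \<partial>lborel)"
  unfolding kvolume_def
proof (rule SUP_least, clarify)
  let ?c = "factor TYPE('k) h"
  have c: "?c \<in> borel_measurable borel" "\<And>x. 0 \<le> ?c x"
    using h by (auto simp: factor_def[abs_def])
  fix n :: nat and g :: "nat \<Rightarrow> real^'k \<Rightarrow> real^'n" and V T
  assume fam: "\<forall>i<n. C1_parametrisation (g i) (V i) \<and> g i ` V i \<subseteq> A \<and> T i \<in> sets borel \<and> T i \<subseteq> V i"
    and disj: "disjoint_family_on (\<lambda>i. g i ` T i) {..<n}"
  have par: "C1_parametrisation (f j) (U j)" "f j ` U j \<subseteq> A" if "j < N" for j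
    using pchart_param[OF ch[OF that]] pchart_image[OF ch[OF that]] by auto
  let ?T = "\<lambda>l j. {v \<in> T l. g l v \<in> W j}"
  let ?Q = "\<lambda>l j. {u \<in> U j. f j u \<in> g l ` ?T l j}"
  have bT: "?T l j \<in> sets borel" if "l < n" "j < N" for l j
    using borel_preimage_continuous_on[OF continuous_on_subset[OF param_continuous], of "g l" "V l" "T l" "W j"]
      fam that pchart_open[OF ch[OF that(2)]] by auto
  have F: "(\<lambda>x. \<rho> j x * ?c x) \<in> borel_measurable borel" "\<And>x. 0 \<le> \<rho> j x * ?c x" if "j < N" for j
    using \<rho>(1)[OF that] \<rho>(2) c by auto
  have rp: "?Q l j \<in> sets borel"
    "(\<integral>\<^sup>+v\<in>?T l j. ennreal ((\<rho> j (g l v) * ?c (g l v)) * gden (g l) v) \<partial>lborel) =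
      (\<integral>\<^sup>+u\<in>?Q l j. ennreal ((\<rho> j (f j u) * ?c (f j u)) * gden (f j) u) \<partial>lborel)"
    if "l < n" "j < N" for l j
  proof -
    have *: "?T l j \<subseteq> V l" "g l ` ?T l j \<subseteq> W j" using fam that by auto
    have g: "C1_parametrisation (g l) (V l)" "g l ` V l \<subseteq> A" using fam that by auto
    show "?Q l j \<in> sets borel"
      by (rule nn_integral_reparametrise(1)[OF ch[OF that(2)] g bT[OF that] * F(1)[OF that(2)] F(2)[OF that(2)]])
    show "(\<integral>\<^sup>+v\<in>?T l j. ennreal ((\<rho> j (g l v) * ?c (g l v)) * gden (g l) v) \<partial>lborel) =
      (\<integral>\<^sup>+u\<in>?Q l j. ennreal ((\<rho> j (f j u) * ?c (f j u)) * gden (f j) u) \<partial>lborel)"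
      by (rule nn_integral_reparametrise(2)[OF ch[OF that(2)] g bT[OF that] * F(1)[OF that(2)] F(2)[OF that(2)]])
  qed
  have "(\<Sum>l<n. \<integral>\<^sup>+v\<in>T l. ennreal (volume_density h (g l) v) \<partial>lborel)
    \<le> (\<Sum>l<n. \<Sum>j<N. \<integral>\<^sup>+v\<in>?T l j. ennreal ((\<rho> j (g l v) * ?c (g l v)) * gden (g l) v) \<partial>lborel)"
  proof (rule sum_mono)
    fix l assume "l \<in> {..<n}"
    then have l: "l < n" by simp
    then have g: "C1_parametrisation (g l) (V l)" "g l ` V l \<subseteq> A" "T l \<in> sets borel" "T l \<subseteq> V l"
      using fam by auto
    let ?p = "\<lambda>j v. (\<rho> j (g l v) * ?c (g l v)) * gden (g l) v"
    have "(\<integral>\<^sup>+v\<in>T l. ennreal (volume_density h (g l) v) \<partial>lborel) =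
      (\<integral>\<^sup>+v. (\<Sum>j<N. ennreal (indicator (?T l j) v * ?p j v)) \<partial>lborel)"
    proof (rule nn_integral_cong)
      fix v
      show "ennreal (volume_density h (g l) v) * indicator (T l) v = (\<Sum>j<N. ennreal (indicator (?T l j) v * ?p j v))"
      proof (cases "v \<in> T l")
        case True
        then have v: "v \<in> V l" "g l v \<in> A" using g by auto
        have nn: "0 \<le> gden (g l) v" using param_gden_pos[OF g(1) v(1)] by simp
        have "indicator (?T l j) v * ?p j v = \<rho> j (g l v) * (?c (g l v) * gden (g l) v)" if "j < N" for j
          using True \<rho>(4)[OF that, of "g l v"] v by (auto simp: indicator_def)
        then have "(\<Sum>j<N. ennreal (indicator (?T l j) v * ?p j v)) = (\<Sum>j<N. ennreal (\<rho> j (g l v) * (?c (g l v) * gden (g l) v)))"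
          by (intro sum.cong refl arg_cong[where f=ennreal]) (simp only: lessThan_iff)
        also have "\<dots> = ennreal ((\<Sum>j<N. \<rho> j (g l v)) * (?c (g l v) * gden (g l) v))"
          using \<rho>(2) c(2) nn by (subst sum_ennreal) (auto simp: sum_distrib_right)
        finally show ?thesis using True \<rho>(3)[OF v(2)] by (simp add: volume_density_factor)
      qed (simp add: indicator_def)
    qed
    also have "\<dots> = (\<Sum>j<N. \<integral>\<^sup>+v. ennreal (indicator (?T l j) v * ?p j v) \<partial>lborel)"
    proof (rule nn_integral_sum)
      fix j assume "j \<in> {..<N}"
      then have j: "j < N" by simp
      have "(\<lambda>v. indicator (?T l j) v * ?p j v) \<in> borel_measurable borel"
        by (rule borel_measurable_indicator_times[where F="\<lambda>x. \<rho> j x * ?c x", OF param_continuous[OF g(1)] gden_continuous[OF g(1)] _ bT[OF l j] _ F(1)[OF j]])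
           (use g param_open[OF g(1)] in auto)
      then show "(\<lambda>v. ennreal (indicator (?T l j) v * ?p j v)) \<in> borel_measurable lborel" by simp
    qed
    also have "\<dots> = (\<Sum>j<N. \<integral>\<^sup>+v\<in>?T l j. ennreal (?p j v) \<partial>lborel)"
      by (intro sum.cong nn_integral_cong refl) (simp add: indicator_def)
    finally show "(\<integral>\<^sup>+v\<in>T l. ennreal (volume_density h (g l) v) \<partial>lborel)
      \<le> (\<Sum>j<N. \<integral>\<^sup>+v\<in>?T l j. ennreal (?p j v) \<partial>lborel)" by simp
  qed
  also have "\<dots> = (\<Sum>l<n. \<Sum>j<N. \<integral>\<^sup>+u\<in>?Q l j. ennreal ((\<rho> j (f j u) * ?c (f j u)) * gden (f j) u) \<partial>lborel)"
    by (intro sum.cong refl) (use rp(2) in auto)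
  also have "\<dots> = (\<Sum>j<N. \<Sum>l<n. \<integral>\<^sup>+u\<in>?Q l j. ennreal ((\<rho> j (f j u) * ?c (f j u)) * gden (f j) u) \<partial>lborel)"
    by (rule sum.swap)
  also have "\<dots> \<le> (\<Sum>j<N. \<integral>\<^sup>+u\<in>U j. ennreal (\<rho> j (f j u) * volume_density h (f j) u) \<partial>lborel)"
  proof (rule sum_mono)
    fix j assume "j \<in> {..<N}"
    then have j: "j < N" by simp
    let ?p = "\<lambda>u. (\<rho> j (f j u) * ?c (f j u)) * gden (f j) u"
    have "(\<Sum>l<n. \<integral>\<^sup>+u\<in>?Q l j. ennreal (?p u) \<partial>lborel) \<le> (\<integral>\<^sup>+u\<in>U j. ennreal (?p u) \<partial>lborel)"
    proof (rule nn_integral_sum_indicator_le)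
      show "(\<lambda>u. indicator (?Q l j) u * ?p u) \<in> borel_measurable borel" if "l \<in> {..<n}" for l
        by (rule borel_measurable_indicator_times[where F="\<lambda>x. \<rho> j x * ?c x", OF param_continuous[OF par(1)[OF j]] gden_continuous[OF par(1)[OF j]] _ rp(1) _ F(1)[OF j]])
           (use that j param_open[OF par(1)[OF j]] in auto)
      fix u
      show "(\<Sum>l<n. ennreal (indicator (?Q l j) u * ?p u)) \<le> ennreal (?p u) * indicator (U j) u"
      proof (cases "\<exists>l<n. u \<in> ?Q l j")
        case True
        then obtain l where l: "l < n" "u \<in> ?Q l j" by blast
        \<comment> \<open>Because the images are disjoint, at most one member of the family
          contributes at \<open>u\<close>.\<close>
        have "u \<notin> ?Q i j" if "i < n" "i \<noteq> l" for i
        proof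
          assume "u \<in> ?Q i j"
          then have "f j u \<in> g i ` T i \<inter> g l ` T l" using l by auto
          then show False using disj that l(1) unfolding disjoint_family_on_def by blast
        qed
        then have "(\<Sum>i<n. ennreal (indicator (?Q i j) u * ?p u)) = (\<Sum>i<n. if i = l then ennreal (?p u) else 0)"
          using l by (intro sum.cong) (auto simp: indicator_def)
        then show ?thesis using l by (simp add: indicator_def)
      next
        case False
        then have "(\<Sum>l<n. ennreal (indicator (?Q l j) u * ?p u)) = 0"
          by (intro sum.neutral) (auto simp: indicator_def)
        then show ?thesis by simp
      qed
    qed simp
    then show "(\<Sum>l<n. \<integral>\<^sup>+u\<in>?Q l j. ennreal (?p u) \<partial>lborel) \<le> (\<integral>\<^sup>+u\<in>U j. ennreal (\<rho> j (f j u) * volume_density h (f j) u) \<partial>lborel)"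
      by (simp add: volume_density_factor mult.assoc)
  qed
  finally show "(\<Sum>l<n. \<integral>\<^sup>+v\<in>T l. ennreal (volume_density h (g l) v) \<partial>lborel)
    \<le> (\<Sum>j<N. \<integral>\<^sup>+u\<in>U j. ennreal (\<rho> j (f j u) * volume_density h (f j) u) \<partial>lborel)" .
qed

lemma kvolume_single_chart:
  fixes f :: "real^'k \<Rightarrow> real^'n"
  assumes "pchart A f U W \<kappa>" "A \<subseteq> W" "h \<in> borel_measurable borel" "\<And>x. 0 \<le> h x"
  shows "kvolume TYPE('k) h A = (\<integral>\<^sup>+u\<in>U. ennreal (volume_density h f u) \<partial>lborel)"
proof (rule antisym)
  show "kvolume TYPE('k) h A \<le> (\<integral>\<^sup>+u\<in>U. ennreal (volume_density h f u) \<partial>lborel)"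
    using kvolume_le_weighted_sum[of 1 A "\<lambda>_. f" "\<lambda>_. U" "\<lambda>_. W" "\<lambda>_. \<kappa>" h "\<lambda>_ _. 1"] assms by auto
  show "(\<integral>\<^sup>+u\<in>U. ennreal (volume_density h f u) \<partial>lborel) \<le> kvolume TYPE('k) h A"
    using kvolume_ge_weighted_sum[of 1 A "\<lambda>_. f" "\<lambda>_. U" "\<lambda>_. W" "\<lambda>_. \<kappa>" h "\<lambda>_ _. 1"] assms by auto
qed

text \<open>The supremum sees a set only through the parametrisations inside it. Applied to
  \<open>M \<union> \<gamma>\<close>, where no parametrisation meets the boundary.\<close>

lemma kvolume_mono_param:
  assumes "\<And>g V. C1_parametrisation (g :: real^'k \<Rightarrow> real^'n) V \<Longrightarrow> g ` V \<subseteq> K \<Longrightarrow> g ` V \<subseteq> M"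
  shows "kvolume TYPE('k) h K \<le> kvolume TYPE('k) h M"
  unfolding kvolume_def
proof (rule SUP_least, clarify)
  fix N :: nat and f U S
  assume *: "\<forall>i<N. C1_parametrisation (f i :: real^'k \<Rightarrow> real^'n) (U i) \<and> f i ` U i \<subseteq> K \<and> S i \<in> sets borel \<and> S i \<subseteq> U i"
    and d: "disjoint_family_on (\<lambda>i. f i ` S i) {..<N}"
  have f: "f i ` U i \<subseteq> M" if "i < N" for i by (rule assms) (use * that in auto)
  show "(\<Sum>i<N. \<integral>\<^sup>+u\<in>S i. ennreal (volume_density h (f i) u) \<partial>lborel) \<le>
    (SUP (N, f, U, S) \<in> {(N :: nat, f :: nat \<Rightarrow> real^'k \<Rightarrow> real^'n, U :: nat \<Rightarrow> (real^'k) set, S :: nat \<Rightarrow> (real^'k) set).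
          (\<forall>i<N. C1_parametrisation (f i) (U i) \<and> f i ` U i \<subseteq> M \<and> S i \<in> sets borel \<and> S i \<subseteq> U i) \<and>
          disjoint_family_on (\<lambda>i. f i ` S i) {..<N}}.
        \<Sum>i<N. \<integral>\<^sup>+u\<in>S i. ennreal (volume_density h (f i) u) \<partial>lborel)"
    by (rule SUP_upper2[where i="(N, f, U, S)"]) (use f * d in auto)
qed

section \<open>The first variation\<close>

text \<open>What differentiating an integral over a compact \<open>Z\<close> calls for: a time
  derivative, jointly continuous like the function itself, and no derivative in space. The property
  passes through sums, products, inverses and roots, out of which volume densities are
  built.\<close>

definition tC1 :: "real set \<Rightarrow> 'a::euclidean_space set \<Rightarrow> (real \<Rightarrow> 'a \<Rightarrow> real) \<Rightarrow> bool" where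
  "tC1 T Z q \<longleftrightarrow> (\<exists>q'. (\<forall>t\<in>T. \<forall>u\<in>Z. ((\<lambda>s. q s u) has_real_derivative q' t u) (at t)) \<and>
     continuous_on (T \<times> Z) (\<lambda>p. q (fst p) (snd p)) \<and> continuous_on (T \<times> Z) (\<lambda>p. q' (fst p) (snd p)))"

lemma tC1_space:
  assumes "continuous_on Z c" shows "tC1 T Z (\<lambda>t. c)"
  unfolding tC1_def
  by (rule exI[of _ "\<lambda>_ _. 0"]) (auto intro!: continuous_intros continuous_on_compose2[OF assms])

lemma tC1_time: "tC1 T Z (\<lambda>t u. t)"
  unfolding tC1_def
  by (rule exI[of _ "\<lambda>_ _. 1"]) (auto intro!: continuous_intros)

lemma tC1_add:
  assumes "tC1 T Z q" "tC1 T Z r" shows "tC1 T Z (\<lambda>t u. q t u + r t u)"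
proof -
  obtain q' r' where *:
    "\<And>t u. t \<in> T \<Longrightarrow> u \<in> Z \<Longrightarrow> ((\<lambda>s. q s u) has_real_derivative q' t u) (at t)"
    "\<And>t u. t \<in> T \<Longrightarrow> u \<in> Z \<Longrightarrow> ((\<lambda>s. r s u) has_real_derivative r' t u) (at t)"
    "continuous_on (T \<times> Z) (\<lambda>p. q (fst p) (snd p))" "continuous_on (T \<times> Z) (\<lambda>p. q' (fst p) (snd p))"
    "continuous_on (T \<times> Z) (\<lambda>p. r (fst p) (snd p))" "continuous_on (T \<times> Z) (\<lambda>p. r' (fst p) (snd p))"
    using assms unfolding tC1_def by blast
  show ?thesis unfolding tC1_def
    by (intro exI[of _ "\<lambda>t u. q' t u + r' t u"] conjI ballI continuous_on_add * DERIV_add)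
qed

lemma tC1_mult:
  assumes "tC1 T Z q" "tC1 T Z r" shows "tC1 T Z (\<lambda>t u. q t u * r t u)"
proof -
  obtain q' r' where *:
    "\<And>t u. t \<in> T \<Longrightarrow> u \<in> Z \<Longrightarrow> ((\<lambda>s. q s u) has_real_derivative q' t u) (at t)"
    "\<And>t u. t \<in> T \<Longrightarrow> u \<in> Z \<Longrightarrow> ((\<lambda>s. r s u) has_real_derivative r' t u) (at t)"
    "continuous_on (T \<times> Z) (\<lambda>p. q (fst p) (snd p))" "continuous_on (T \<times> Z) (\<lambda>p. q' (fst p) (snd p))"
    "continuous_on (T \<times> Z) (\<lambda>p. r (fst p) (snd p))" "continuous_on (T \<times> Z) (\<lambda>p. r' (fst p) (snd p))"
    using assms unfolding tC1_def by blast
  show ?thesis unfolding tC1_def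
    by (intro exI[of _ "\<lambda>t u. q' t u * r t u + r' t u * q t u"] conjI ballI continuous_on_add continuous_on_mult * DERIV_mult)
qed

lemma tC1_sum:
  assumes "\<And>i. i \<in> I \<Longrightarrow> tC1 T Z (q i)" shows "tC1 T Z (\<lambda>t u. \<Sum>i\<in>I. q i t u)"
  using assms by (induction I rule: infinite_finite_induct) (simp_all add: tC1_add tC1_space)

lemma tC1_prod:
  assumes "\<And>i. i \<in> I \<Longrightarrow> tC1 T Z (q i)" shows "tC1 T Z (\<lambda>t u. \<Prod>i\<in>I. q i t u)"
  using assms by (induction I rule: infinite_finite_induct) (simp_all add: tC1_mult tC1_space)

lemma tC1_power:
  assumes "tC1 T Z q" shows "tC1 T Z (\<lambda>t u. q t u ^ n)"
  by (induction n) (simp_all add: tC1_mult tC1_space assms)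

lemma tC1_det:
  fixes N :: "real \<Rightarrow> 'a::euclidean_space \<Rightarrow> real^'k^'k"
  assumes "\<And>i j. tC1 T Z (\<lambda>t u. N t u $ i $ j)" shows "tC1 T Z (\<lambda>t u. det (N t u))"
  unfolding det_def by (intro tC1_sum tC1_mult tC1_prod assms tC1_space continuous_on_const)

lemma tC1_compose:
  assumes "tC1 T Z q" "\<And>t u. t \<in> T \<Longrightarrow> u \<in> Z \<Longrightarrow> q t u \<in> I"
    and g: "\<And>x. x \<in> I \<Longrightarrow> (g has_real_derivative g' x) (at x)" "continuous_on I g'"
  shows "tC1 T Z (\<lambda>t u. g (q t u))"
proof -
  obtain q' where *:
    "\<And>t u. t \<in> T \<Longrightarrow> u \<in> Z \<Longrightarrow> ((\<lambda>s. q s u) has_real_derivative q' t u) (at t)"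
    "continuous_on (T \<times> Z) (\<lambda>p. q (fst p) (snd p))" "continuous_on (T \<times> Z) (\<lambda>p. q' (fst p) (snd p))"
    using assms(1) unfolding tC1_def by blast
  have cg: "continuous_on I g"
    using g(1) by (meson DERIV_isCont continuous_at_imp_continuous_on)
  show ?thesis unfolding tC1_def
  proof (intro exI[of _ "\<lambda>t u. g' (q t u) * q' t u"] conjI ballI continuous_on_mult *)
    show "((\<lambda>s. g (q s u)) has_real_derivative g' (q t u) * q' t u) (at t)" if "t \<in> T" "u \<in> Z" for t u
      using DERIV_chain2[OF g(1)[OF assms(2)[OF that]] *(1)[OF that]] .
    show "continuous_on (T \<times> Z) (\<lambda>p. g (q (fst p) (snd p)))"
      by (rule continuous_on_compose2[OF cg *(2)]) (use assms(2) in auto)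
    show "continuous_on (T \<times> Z) (\<lambda>p. g' (q (fst p) (snd p)))"
      by (rule continuous_on_compose2[OF g(2) *(2)]) (use assms(2) in auto)
  qed
qed

lemma tC1_inverse:
  assumes "tC1 T Z q" "\<And>t u. t \<in> T \<Longrightarrow> u \<in> Z \<Longrightarrow> 0 < q t u"
  shows "tC1 T Z (\<lambda>t u. inverse (q t u))"
  by (rule tC1_compose[OF assms(1), of "{0<..}" inverse "\<lambda>x. - (inverse x * inverse x)"])
     (use assms(2) in \<open>auto intro!: continuous_intros derivative_eq_intros\<close>)

lemma tC1_sqrt:
  assumes "tC1 T Z q" "\<And>t u. t \<in> T \<Longrightarrow> u \<in> Z \<Longrightarrow> 0 < q t u"
  shows "tC1 T Z (\<lambda>t u. sqrt (q t u))"
  by (rule tC1_compose[OF assms(1), of "{0<..}" sqrt "\<lambda>x. inverse (sqrt x) / 2"])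
     (use assms(2) DERIV_real_sqrt in \<open>auto intro!: continuous_intros\<close>)

lemma bounded_continuous_absolutely_integrable:
  fixes f :: "'a::euclidean_space \<Rightarrow> real"
  assumes "continuous_on S f" "S \<in> sets borel" "bounded S" "\<And>x. x \<in> S \<Longrightarrow> \<bar>f x\<bar> \<le> B"
  shows "f absolutely_integrable_on S"
proof (rule measurable_bounded_by_integrable_imp_absolutely_integrable)
  have Sl: "S \<in> sets lebesgue" using assms(2) by simp
  then show "f \<in> borel_measurable (lebesgue_on S)" "S \<in> sets lebesgue"
    using continuous_imp_measurable_on_sets_lebesgue[OF assms(1)] by auto
  have "S \<in> lmeasurable" using assms(3) Sl by (rule bounded_set_imp_lmeasurable)
  then show "(\<lambda>_. B) integrable_on S" by (rule integrable_on_const)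
qed (use assms(4) in auto)

text \<open>Compactness bounds the time derivative, so the difference quotients share a constant
  bound and dominated convergence applies. The limit \<open>E\<close> is given only pointwise; its
  integrability is part of the result.\<close>

lemma DERIV_integral_tC1:
  fixes D :: "real \<Rightarrow> 'a::euclidean_space \<Rightarrow> real"
  assumes D: "tC1 {-d..d} Z D" and d: "0 < d" and Z: "compact Z" and S: "S \<in> sets borel" "S \<subseteq> Z"
    and D0: "\<And>u. u \<in> S \<Longrightarrow> ((\<lambda>t. D t u) has_real_derivative E u) (at 0)"
  shows "((\<lambda>t. integral S (D t)) has_real_derivative integral S E) (at 0)"
    and "E integrable_on S"
    and "t \<in> {-d..d} \<Longrightarrow> D t absolutely_integrable_on S"
proof -
  let ?T = "{-d..d}"
  obtain D' where D': "\<And>t u. t \<in> ?T \<Longrightarrow> u \<in> Z \<Longrightarrow> ((\<lambda>s. D s u) has_real_derivative D' t u) (at t)"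
    "continuous_on (?T \<times> Z) (\<lambda>p. D (fst p) (snd p))" "continuous_on (?T \<times> Z) (\<lambda>p. D' (fst p) (snd p))"
    using D unfolding tC1_def by blast
  have cpt: "compact (?T \<times> Z)" using Z by (intro compact_Times) auto
  obtain B where B: "\<And>t u. t \<in> ?T \<Longrightarrow> u \<in> Z \<Longrightarrow> \<bar>D t u\<bar> \<le> B"
    using compact_imp_bounded[OF compact_continuous_image[OF D'(2) cpt]] unfolding bounded_iff by fastforce
  obtain B' where B': "\<And>t u. t \<in> ?T \<Longrightarrow> u \<in> Z \<Longrightarrow> \<bar>D' t u\<bar> \<le> B'"
    using compact_imp_bounded[OF compact_continuous_image[OF D'(3) cpt]] unfolding bounded_iff by fastforce
  have bS: "bounded S" using S(2) Z compact_imp_bounded bounded_subset by blast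
  have Sm: "S \<in> lmeasurable" using bS S(1) by (intro bounded_set_imp_lmeasurable) auto
  show int: "D t absolutely_integrable_on S" if "t \<in> ?T" for t
  proof (rule bounded_continuous_absolutely_integrable[OF _ S(1) bS])
    have "continuous_on S (\<lambda>u. (\<lambda>p. D (fst p) (snd p)) (t, u))"
      by (rule continuous_on_compose2[OF D'(2)]) (use that S in \<open>auto intro!: continuous_intros\<close>)
    then show "continuous_on S (D t)" by simp
    show "\<bar>D t u\<bar> \<le> B" if "u \<in> S" for u using B that \<open>t \<in> ?T\<close> S by blast
  qed
  have lip: "\<bar>D t u - D 0 u\<bar> \<le> B' * \<bar>t\<bar>" if "t \<in> ?T" "u \<in> S" for t u
  proof -
    have "norm (D t u - D 0 u) \<le> B' * norm (t - 0)"
      by (rule field_differentiable_bound[where S="?T" and f'="\<lambda>s. D' s u"])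
         (use that S D'(1) B' d in \<open>auto intro: has_field_derivative_at_within\<close>)
    then show ?thesis by simp
  qed
  have key: "E integrable_on S \<and> (\<lambda>n. (integral S (D (s n)) - integral S (D 0)) / s n) \<longlonglongrightarrow> integral S E"
    if s: "\<And>n. s n \<noteq> 0" "s \<longlonglongrightarrow> 0" "\<And>n. s n \<in> ?T" for s :: "nat \<Rightarrow> real"
  proof -
    let ?q = "\<lambda>n u. (D (s n) u - D 0 u) / s n"
    have iq: "?q n integrable_on S" for n
      using int[OF s(3)[of n]] int[of 0] d
      by (intro integrable_on_divide integrable_diff) (auto simp: absolutely_integrable_on_def)
    have eq: "integral S (?q n) = (integral S (D (s n)) - integral S (D 0)) / s n" for n
      using int[OF s(3)[of n]] int[of 0] d by (simp add: integral_diff absolutely_integrable_on_def)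
    have bd: "norm (?q n u) \<le> B'" if "u \<in> S" for n u
      using lip[OF s(3) that, of n] s(1)[of n] by (simp add: divide_le_eq)
    have lim: "(\<lambda>n. ?q n u) \<longlonglongrightarrow> E u" if "u \<in> S" for u
    proof -
      have "((\<lambda>h. (D (0 + h) u - D 0 u) / h) \<longlongrightarrow> E u) (at 0)"
        using D0[OF that] by (simp add: DERIV_def)
      then show ?thesis using s(1,2) unfolding tendsto_at_iff_sequentially by (auto simp: o_def)
    qed
    show ?thesis
      using dominated_convergence[of ?q S "\<lambda>_. B'" E, OF iq integrable_on_const[OF Sm] bd lim]
      unfolding eq by blast
  qed
  \<comment> \<open>One concrete sequence of times suffices to read off the integrability of
    \<open>E\<close>.\<close>
  have s0: "\<And>n. d / real (Suc n) \<noteq> 0" "(\<lambda>n. d / real (Suc n)) \<longlonglongrightarrow> 0" "\<And>n. d / real (Suc n) \<in> ?T"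
    using d LIMSEQ_Suc[OF lim_const_over_n, of d] by (auto simp: field_simps simp del: of_nat_Suc)
       (smt (verit) mult_nonneg_nonneg of_nat_0_le_iff)
  show "E integrable_on S" using key[OF s0] by blast
  show "((\<lambda>t. integral S (D t)) has_real_derivative integral S E) (at 0)"
    unfolding DERIV_def
  proof (subst tendsto_at_iff_sequentially, intro allI impI)
    fix s :: "nat \<Rightarrow> real" assume s: "\<forall>i. s i \<in> UNIV - {0}" "s \<longlonglongrightarrow> 0"
    then obtain N where N: "\<And>n. n \<ge> N \<Longrightarrow> \<bar>s n\<bar> < d"
      using d by (auto simp: lim_sequentially dist_real_def) metis
    \<comment> \<open>A null sequence enters the time interval only after finitely many terms, hence
      the shift by \<open>N\<close>.\<close>
    have "(\<lambda>n. (integral S (D (s (n + N))) - integral S (D 0)) / s (n + N)) \<longlonglongrightarrow> integral S E"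
    proof (rule key[THEN conjunct2])
      show "(\<lambda>n. s (n + N)) \<longlonglongrightarrow> 0" by (rule LIMSEQ_ignore_initial_segment[OF s(2)])
      show "s (n + N) \<noteq> 0" for n using s(1) by simp
      show "s (n + N) \<in> ?T" for n using N[of "n + N"] by (simp add: abs_less_iff)
    qed
    then have "(\<lambda>n. (integral S (D (s n)) - integral S (D 0)) / s n) \<longlonglongrightarrow> integral S E"
      by (rule LIMSEQ_offset)
    then show "((\<lambda>h. (integral S (D (0 + h)) - integral S (D 0)) / h) \<circ> s) \<longlonglongrightarrow> integral S E"
      by (simp add: o_def)
  qed
qed

section \<open>Bump functions and partitions of unity\<close>

lemma C1_bump_ball:
  fixes p :: "'a::euclidean_space"
  assumes "0 < r"
  obtains c :: "'a \<Rightarrow> real" where "C1_on c UNIV" "\<And>x. 0 \<le> c x" "\<And>x. c x \<le> 1"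
    "\<And>x. x \<in> ball p r \<Longrightarrow> c x = 1" "closure {x. c x \<noteq> 0} \<subseteq> cball p (2 * r)"
proof
  \<comment> \<open>The squared distance is differentiable at the centre too; \<open>step\<close>
    reaches 0 at distance \<open>sqrt 2 * r\<close>, which is within \<open>2 * r\<close>.\<close>
  let ?c = "\<lambda>x. step ((norm (x - p))\<^sup>2 * (1 / r\<^sup>2))"
  have n: "C1_on (\<lambda>x. (norm (x - p))\<^sup>2) UNIV"
    by (rule C1_on_compose[OF C1_on_diff[OF C1_on_id C1_on_const] C1_on_norm_square[of UNIV]]) simp
  show "C1_on ?c UNIV"
    by (rule C1_on_compose[OF C1_on_mult[OF n C1_on_const] C1_on_step[of UNIV]]) simp
  show "0 \<le> ?c x" "?c x \<le> 1" for x by (simp_all add: step_bounds)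
  show "?c x = 1" if "x \<in> ball p r" for x
  proof -
    have "norm (x - p) \<le> r" using that by (simp add: dist_norm norm_minus_commute)
    then have "(norm (x - p))\<^sup>2 \<le> r\<^sup>2" by (intro power_mono) auto
    then show ?thesis using assms by (simp add: step_def field_simps)
  qed
  show "closure {x. ?c x \<noteq> 0} \<subseteq> cball p (2 * r)"
  proof (rule closure_minimal)
    show "{x. ?c x \<noteq> 0} \<subseteq> cball p (2 * r)"
    proof
      fix x assume "x \<in> {x. ?c x \<noteq> 0}"
      then have "(norm (x - p))\<^sup>2 * (1 / r\<^sup>2) < 2" by (auto simp: step_def split: if_splits)
      then have "(norm (x - p))\<^sup>2 < 2 * r\<^sup>2" using assms by (simp add: field_simps)
      also have "\<dots> \<le> (2 * r)\<^sup>2" by (simp add: power_mult_distrib)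
      finally have "norm (x - p) < 2 * r" by (rule power_less_imp_less_base) (use assms in simp)
      then show "x \<in> cball p (2 * r)" by (simp add: dist_norm norm_minus_commute)
    qed
  qed simp
qed

text \<open>The total is 1 on an open neighbourhood of \<open>K\<close>, so that its derivative
  vanishes on \<open>K\<close>, and at most 1 everywhere, so that the functions can also serve as
  weights on the cone.\<close>

lemma C1_partition_of_unity:
  fixes K :: "'a::euclidean_space set"
  assumes K: "compact K" and W: "\<And>p. p \<in> K \<Longrightarrow> open (W p)" "\<And>p. p \<in> K \<Longrightarrow> p \<in> W p"
  obtains N :: nat and p \<rho> G where "\<And>i. i < N \<Longrightarrow> p i \<in> K" "\<And>i. C1_on (\<rho> i :: 'a \<Rightarrow> real) UNIV"
    "\<And>i x. 0 \<le> \<rho> i x" "\<And>i. i < N \<Longrightarrow> compact (closure {x. \<rho> i x \<noteq> 0})"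
    "\<And>i. i < N \<Longrightarrow> closure {x. \<rho> i x \<noteq> 0} \<subseteq> W (p i)" "open G" "K \<subseteq> G"
    "\<And>x. x \<in> G \<Longrightarrow> (\<Sum>i<N. \<rho> i x) = 1" "\<And>x. (\<Sum>i<N. \<rho> i x) \<le> 1"
proof -
  have "\<exists>r>0. cball p (2 * r) \<subseteq> W p" if pK: "p \<in> K" for p
  proof -
    obtain e where e: "e > 0" "cball p e \<subseteq> W p"
      using open_contains_cball_eq[OF W(1)[OF pK]] W(2)[OF pK] by blast
    then show ?thesis by (intro exI[of _ "e / 2"]) auto
  qed
  then obtain r where r: "\<And>p. p \<in> K \<Longrightarrow> 0 < r p" "\<And>p. p \<in> K \<Longrightarrow> cball p (2 * r p) \<subseteq> W p" by metis
  have "K \<subseteq> (\<Union>p\<in>K. ball p (r p))" using r(1) by force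
  then obtain C where C: "C \<subseteq> K" "finite C" "K \<subseteq> (\<Union>p\<in>C. ball p (r p))"
    using compactE_image[OF K, of K "\<lambda>p. ball p (r p)"] by auto
  obtain p and N :: nat where p: "C = p ` {..<N}"
    using C(2) finite_imp_nat_seg_image_inj_on[of C] by (auto simp: lessThan_def)
  have "\<exists>c :: 'a \<Rightarrow> real. C1_on c UNIV \<and> (\<forall>x. 0 \<le> c x) \<and> (\<forall>x. c x \<le> 1) \<and>
      (i < N \<longrightarrow> (\<forall>x\<in>ball (p i) (r (p i)). c x = 1) \<and> closure {x. c x \<noteq> 0} \<subseteq> cball (p i) (2 * r (p i)))" for i
  proof (cases "i < N")
    case True
    then have "0 < r (p i)" using r(1) C(1) p by auto
    from C1_bump_ball[OF this] show ?thesis by metis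
  next
    case False
    then show ?thesis using C1_on_const[of 0] by (intro exI[of _ "\<lambda>_. 0"]) auto
  qed
  then obtain c where c: "\<And>i. C1_on (c i :: 'a \<Rightarrow> real) UNIV" "\<And>i x. 0 \<le> c i x" "\<And>i x. c i x \<le> 1"
    "\<And>i x. i < N \<Longrightarrow> x \<in> ball (p i) (r (p i)) \<Longrightarrow> c i x = 1"
    "\<And>i. i < N \<Longrightarrow> closure {x. c i x \<noteq> 0} \<subseteq> cball (p i) (2 * r (p i))"
    by metis
  \<comment> \<open>Each function takes its share of what its predecessors have left; the total
    telescopes to 1 minus the product of all \<open>1 - c j x\<close>.\<close>
  let ?\<rho> = "\<lambda>i x. c i x * (\<Prod>j<i. 1 - c j x)"
  have tel: "(\<Sum>i<n. ?\<rho> i x) = 1 - (\<Prod>j<n. 1 - c j x)" for n x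
    by (induction n) (simp_all add: algebra_simps)
  have sub: "closure {x. ?\<rho> i x \<noteq> 0} \<subseteq> cball (p i) (2 * r (p i))" if "i < N" for i
  proof -
    have "closure {x. ?\<rho> i x \<noteq> 0} \<subseteq> closure {x. c i x \<noteq> 0}" by (rule closure_mono) auto
    then show ?thesis using c(5)[OF that] by blast
  qed
  show thesis
  proof (rule that[of N p ?\<rho> "\<Union>p\<in>C. ball p (r p)"])
    show pK: "p i \<in> K" if "i < N" for i using that C(1) p by auto
    show "C1_on (?\<rho> i) UNIV" for i
      by (intro C1_on_mult C1_on_prod C1_on_diff C1_on_const c)
    show "0 \<le> ?\<rho> i x" for i x
      by (intro mult_nonneg_nonneg prod_nonneg ballI) (use c in auto)
    show "compact (closure {x. ?\<rho> i x \<noteq> 0})" if "i < N" for i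
      using sub[OF that] bounded_subset[OF bounded_cball] by (auto simp: compact_eq_bounded_closed)
    show "closure {x. ?\<rho> i x \<noteq> 0} \<subseteq> W (p i)" if "i < N" for i
      using sub[OF that] r(2)[OF pK[OF that]] by blast
    show "(\<Sum>i<N. ?\<rho> i x) = 1" if x: "x \<in> (\<Union>p\<in>C. ball p (r p))" for x
    proof -
      obtain j where "j < N" "x \<in> ball (p j) (r (p j))" using x p by auto
      then have "(\<Prod>j<N. 1 - c j x) = 0" using c(4) by (intro prod_zero) auto
      then show ?thesis using tel[of x N] by simp
    qed
    show "(\<Sum>i<N. ?\<rho> i x) \<le> 1" for x
      unfolding tel using prod_nonneg[of "{..<N}" "\<lambda>j. 1 - c j x"] c(3) by auto
  qed (use C(3) in auto)
qed

lemma C1_bump: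
  fixes K :: "'a::euclidean_space set"
  assumes K: "compact K" "open V" "K \<subseteq> V"
  obtains \<zeta> :: "'a \<Rightarrow> real" and G where "C1_on \<zeta> UNIV" "open G" "K \<subseteq> G" "\<And>x. x \<in> G \<Longrightarrow> \<zeta> x = 1"
    "compact (closure {x. \<zeta> x \<noteq> 0})" "closure {x. \<zeta> x \<noteq> 0} \<subseteq> V"
proof -
  obtain N :: nat and p \<rho> G where *: "\<And>i. i < N \<Longrightarrow> p i \<in> K" "\<And>i. C1_on (\<rho> i :: 'a \<Rightarrow> real) UNIV"
    "\<And>i x. 0 \<le> \<rho> i x" "\<And>i. i < N \<Longrightarrow> compact (closure {x. \<rho> i x \<noteq> 0})"
    "\<And>i. i < N \<Longrightarrow> closure {x. \<rho> i x \<noteq> 0} \<subseteq> V" "open G" "K \<subseteq> G"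
    "\<And>x. x \<in> G \<Longrightarrow> (\<Sum>i<N. \<rho> i x) = 1" "\<And>x. (\<Sum>i<N. \<rho> i x) \<le> 1"
    by (rule C1_partition_of_unity[OF K(1), where W="\<lambda>_. V", OF K(2) subsetD[OF K(3)]])
       (assumption, rule that, assumption+)
  have "{x. (\<Sum>i<N. \<rho> i x) \<noteq> 0} \<subseteq> (\<Union>i<N. closure {x. \<rho> i x \<noteq> 0})"
  proof
    fix x assume "x \<in> {x. (\<Sum>i<N. \<rho> i x) \<noteq> 0}"
    then have "\<not> (\<forall>i\<in>{..<N}. \<rho> i x = 0)" by (auto simp only: sum.neutral)
    then obtain i where i: "i < N" "\<rho> i x \<noteq> 0" by auto
    then have "x \<in> closure {x. \<rho> i x \<noteq> 0}" by (intro subsetD[OF closure_subset]) simp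
    then show "x \<in> (\<Union>i<N. closure {x. \<rho> i x \<noteq> 0})" using i(1) by blast
  qed
  moreover have cu: "compact (\<Union>i<N. closure {x. \<rho> i x \<noteq> 0})" using *(4) by (intro compact_UN) auto
  ultimately have sub: "closure {x. (\<Sum>i<N. \<rho> i x) \<noteq> 0} \<subseteq> (\<Union>i<N. closure {x. \<rho> i x \<noteq> 0})"
    by (intro closure_minimal compact_imp_closed)
  show thesis
  proof (rule that[of "\<lambda>x. \<Sum>i<N. \<rho> i x" G])
    show "C1_on (\<lambda>x. \<Sum>i<N. \<rho> i x) UNIV" by (intro C1_on_sum *)
    show "compact (closure {x. (\<Sum>i<N. \<rho> i x) \<noteq> 0})"
      using compact_Int_closed[OF cu closed_closure] sub by (metis inf.absorb_iff2)
    show "closure {x. (\<Sum>i<N. \<rho> i x) \<noteq> 0} \<subseteq> V" using sub *(5) by blast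
  qed (use * in auto)
qed

lemma fd_eq_zero:
  fixes g :: "'a::euclidean_space \<Rightarrow> 'b::real_normed_vector"
  assumes "x \<notin> closure {y. g y \<noteq> 0}"
  shows "fd g x = (\<lambda>_. 0)" "g x = 0"
proof -
  have 0: "g y = 0" if "y \<in> - closure {y. g y \<noteq> 0}" for y
  proof -
    have "y \<notin> {y. g y \<noteq> 0}" using that closure_subset[of "{y. g y \<noteq> 0}"] by blast
    then show ?thesis by simp
  qed
  then show "g x = 0" using assms by blast
  have "(g has_derivative (\<lambda>_. 0)) (at x)"
  proof (rule has_derivative_transform_within_open[OF has_derivative_const[of 0]])
    show "open (- closure {y. g y \<noteq> 0})" by (simp only: open_Compl closed_closure)
    show "x \<in> - closure {y. g y \<noteq> 0}" using assms by blast
    show "0 = g y" if "y \<in> - closure {y. g y \<noteq> 0}" for y using 0[OF that] by (simp only:)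
  qed
  then show "fd g x = (\<lambda>_. 0)" by (rule fdI)
qed

text \<open>A single constant controls the field, its derivative and its Lipschitz quotients; the
  length of the time interval of a deformation is read off from it.\<close>

lemma C1_compact_support_bounds:
  fixes X :: "'a::euclidean_space \<Rightarrow> 'b::euclidean_space"
  assumes X: "C1_on X UNIV" and S: "compact (closure {x. X x \<noteq> 0})"
  obtains B where "0 \<le> B" "\<And>x y. norm (X x - X y) \<le> B * norm (x - y)" "\<And>x v. norm (fd X x v) \<le> B * norm v"
    "\<And>x. norm (X x) \<le> B"
proof -
  obtain X' where X': "\<And>x. (X has_derivative blinfun_apply (X' x)) (at x)" "continuous_on UNIV X'"
    using X unfolding C1_on_def by blast
  let ?S = "closure {x. X x \<noteq> 0}"
  have e: "fd X x = blinfun_apply (X' x)" for x using X'(1) by (rule fdI)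
  obtain B1 where B1: "\<And>x. x \<in> ?S \<Longrightarrow> norm (X' x) \<le> B1"
    using compact_imp_bounded[OF compact_continuous_image[OF continuous_on_subset[OF X'(2)] S]]
    unfolding bounded_iff by auto
  obtain B2 where B2: "\<And>x. x \<in> ?S \<Longrightarrow> norm (X x) \<le> B2"
    using compact_imp_bounded[OF compact_continuous_image[OF continuous_on_subset[OF C1_on_continuous[OF X]] S]]
    unfolding bounded_iff by auto
  define B where "B = \<bar>B1\<bar> + \<bar>B2\<bar>"
  have f: "norm (fd X x v) \<le> B * norm v" for x v
  proof (cases "x \<in> ?S")
    case True
    have "norm (blinfun_apply (X' x) v) \<le> norm (X' x) * norm v" by (rule norm_blinfun)
    also have "\<dots> \<le> B * norm v"
      using B1[OF True] by (intro mult_right_mono) (auto simp: B_def)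
    finally show ?thesis by (simp add: e)
  next
    case False
    then show ?thesis by (subst fd_eq_zero(1)) (auto simp only: norm_zero B_def intro!: mult_nonneg_nonneg add_nonneg_nonneg abs_ge_zero norm_ge_zero)
  qed
  have "norm (X x) \<le> B" for x
  proof (cases "x \<in> ?S")
    case True
    then show ?thesis using B2[OF True] unfolding B_def by linarith
  next
    case False
    have "X x = 0" by (rule fd_eq_zero(2)[OF False])
    then show ?thesis by (simp add: B_def)
  qed
  moreover have "norm (X x - X y) \<le> B * norm (x - y)" for x y
  proof (rule differentiable_bound[of UNIV X "fd X"])
    show "(X has_derivative fd X x) (at x)" for x using X'(1)[of x] by (simp only: e)
    show "onorm (fd X x) \<le> B" for x
      by (rule onorm_bound[OF _ f]) (simp add: B_def)
  qed simp_all
  moreover have "0 \<le> B" by (simp add: B_def)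
  ultimately show thesis using f that by blast
qed

text \<open>The lower bounds make \<open>F\<close> and its derivatives injective, invariance of
  domain makes \<open>F\<close> open, and so its inverse is differentiable. A deformed piece of
  \<open>M\<close> is again covered by one chart, and its volume is a single integral.\<close>

lemma pchart_diffeo:
  fixes f :: "real^'k \<Rightarrow> real^'n" and F :: "real^'n \<Rightarrow> real^'n"
  assumes A: "pchart A f U W \<kappa>" and \<Omega>: "open \<Omega>" "\<Omega> \<subseteq> W" and F: "C1_on F UNIV" and c: "0 < c"
    and lo: "\<And>x y. c * norm (x - y) \<le> norm (F x - F y)" "\<And>x v. c * norm v \<le> norm (fd F x v)"
  shows "pchart (F ` (A \<inter> \<Omega>)) (\<lambda>u. F (f u)) {u \<in> U. f u \<in> \<Omega>} (F ` \<Omega>) (\<lambda>y. \<kappa> (inv F y))"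
proof -
  have A': "C1_parametrisation f U" "f ` U = A \<inter> W" "\<And>x. x \<in> W \<Longrightarrow> \<kappa> differentiable (at x)"
    "\<And>u. u \<in> U \<Longrightarrow> \<kappa> (f u) = u" using A unfolding pchart_def by auto
  have inj: "inj F"
  proof (rule injI)
    fix x y assume "F x = F y"
    then have "c * norm (x - y) \<le> 0" using lo(1)[of x y] by simp
    then show "x = y" using c by (simp add: mult_le_0_iff)
  qed
  have cF: "continuous_on UNIV F" by (rule C1_on_continuous[OF F])
  have dF: "(F has_derivative fd F x) (at x)" for x by (rule C1_on_has_derivative[OF F]) simp
  have oF: "open (F ` T)" if T: "open T" for T
    by (rule invariance_of_domain[OF continuous_on_subset[OF cF subset_UNIV] T inj_on_subset[OF inj subset_UNIV]])
  have injF: "inj (fd F x)" for x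
  proof -
    have "linear (fd F x)" using dF has_derivative_linear by blast
    moreover have "v = 0" if "fd F x v = 0" for v using lo(2)[of v x] c that by (simp add: mult_le_0_iff)
    ultimately show ?thesis using linear_injective_0 by blast
  qed
  have dinv: "inv F differentiable (at (F x))" for x
  proof -
    have lin: "linear (fd F x)" using dF has_derivative_linear by blast
    obtain g' where g': "linear g'" "g' \<circ> fd F x = id"
      using linear_injective_left_inverse[OF lin injF] by blast
    have "(inv F has_derivative g') (at (F x))"
    proof (rule has_derivative_inverse_basic)
      show "(F has_derivative fd F x) (at (inv F (F x)))" using dF inj by simp
      show "bounded_linear g'" using g'(1) linear_conv_bounded_linear by blast
      show "g' \<circ> fd F x = id" by (rule g'(2))
      show "continuous (at (F x)) (inv F)"
        unfolding continuous_at_eps_delta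
      proof (intro allI impI)
        fix e :: real assume e: "0 < e"
        have "open (F ` ball x e)" by (rule oF) simp
        then obtain d where d: "0 < d" "ball (F x) d \<subseteq> F ` ball x e"
          using e by (meson centre_in_ball image_eqI open_contains_ball)
        show "\<exists>d>0. \<forall>x'. dist x' (F x) < d \<longrightarrow> dist (inv F x') (inv F (F x)) < e"
        proof (intro exI[of _ d] conjI allI impI d(1))
          fix y assume "dist y (F x) < d"
          then have "y \<in> F ` ball x e" using d(2) by (auto simp: dist_commute)
          then show "dist (inv F y) (inv F (F x)) < e" using inj by (auto simp: dist_commute)
        qed
      qed
      show "open (range F)" by (rule oF) simp
      show "F x \<in> range F" by simp
      show "F (inv F y) = y" if "y \<in> range F" for y using that by (rule f_inv_into_f)
    qed
    then show ?thesis by (rule differentiableI)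
  qed
  have chain: "((\<lambda>u. F (f u)) has_derivative (\<lambda>v. fd F (f u) (fd f u v))) (at u)" if "u \<in> U" for u
    using has_derivative_compose[OF param_has_derivative[OF A'(1) that] dF] .
  have op: "open {u \<in> U. f u \<in> \<Omega>}"
    using continuous_open_preimage[OF param_continuous[OF A'(1)] param_open[OF A'(1)] \<Omega>(1)]
    by (simp add: vimage_def Int_def)
  show ?thesis unfolding pchart_def
  proof (intro conjI ballI)
    show "open (F ` \<Omega>)" by (rule oF[OF \<Omega>(1)])
    show "C1_parametrisation (\<lambda>u. F (f u)) {u \<in> U. f u \<in> \<Omega>}"
      unfolding C1_parametrisation_def
    proof (intro conjI ballI)
      show "C1_on (\<lambda>u. F (f u)) {u \<in> U. f u \<in> \<Omega>}"
        by (rule C1_on_compose[OF C1_on_subset[OF param_C1[OF A'(1)]] F]) auto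
      show "inj_on (\<lambda>u. F (f u)) {u \<in> U. f u \<in> \<Omega>}"
        using param_inj[OF A'(1)] inj by (auto simp: inj_on_def inj_def)
      show "inj (fd (\<lambda>u. F (f u)) u)" if "u \<in> {u \<in> U. f u \<in> \<Omega>}" for u
      proof -
        have u: "u \<in> U" using that by simp
        have "inj (fd f u)" using A'(1) u unfolding C1_parametrisation_def by blast
        then show ?thesis using injF[of "f u"] unfolding fdI[OF chain[OF u]] by (auto simp: inj_def)
      qed
    qed (rule op)
    show "(\<lambda>u. F (f u)) ` {u \<in> U. f u \<in> \<Omega>} = F ` (A \<inter> \<Omega>) \<inter> F ` \<Omega>"
    proof -
      have "f ` {u \<in> U. f u \<in> \<Omega>} = A \<inter> \<Omega>" using A'(2) \<Omega>(2) by auto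
      then have "(\<lambda>u. F (f u)) ` {u \<in> U. f u \<in> \<Omega>} = F ` (A \<inter> \<Omega>)" by (simp add: image_image[symmetric])
      then show ?thesis by auto
    qed
    show "(\<lambda>y. \<kappa> (inv F y)) differentiable (at y)" if y: "y \<in> F ` \<Omega>" for y
    proof -
      obtain x where x: "x \<in> \<Omega>" "y = F x" using y by blast
      then have "\<kappa> differentiable (at (inv F y))" using A'(3) \<Omega>(2) inj by auto
      with dinv[of x] show ?thesis unfolding x(2)
        using differentiable_chain_at[of "inv F" "F x" \<kappa>] by (simp add: o_def)
    qed
    show "\<kappa> (inv F (F (f u))) = u" if "u \<in> {u \<in> U. f u \<in> \<Omega>}" for u
      using that A'(4) inj by simp
  qed
qed

section \<open>Derivative of the volume density along a radial field\<close>

text \<open>\<open>B\<close> is the Jacobian of \<open>X \<circ> f\<close> for a field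
  \<open>X x = \<psi>(x) x\<close>, with \<open>\<xi>\<close> the value and \<open>q\<close> the
  gradient of \<psi> at the point. It is a multiple of \<open>A\<close> plus a rank-one term, which
  keeps the trace in Jacobi's formula explicit.\<close>

lemma det_gram_perturb_DERIV:
  fixes A :: "real^'k^'n" and x q :: "real^'n" and \<xi> :: real
  assumes inj: "inj ((*v) A)" and y: "(transpose A ** A) *v y = transpose A *v x"
  defines "B \<equiv> \<chi> l j. \<xi> * A $ l $ j + x $ l * (transpose A *v q) $ j"
  shows "((\<lambda>t. det (transpose (A + t *\<^sub>R B) ** (A + t *\<^sub>R B))) has_real_derivative
     (2 * real CARD('k) * \<xi> + 2 * (q \<bullet> (A *v y))) * det (transpose A ** A)) (at 0)"
proof -
  let ?G = "transpose A ** A"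
  let ?a = "transpose A *v x" and ?b = "transpose A *v q"
  define z where "z = matrix_inv ?G *v ?b"
  have "?G ** matrix_inv ?G = mat 1"
    using gram_invertible[OF inj] unfolding matrix_inv_def invertible_def by (rule someI2_ex) simp
  then have z: "?G *v z = ?b" unfolding z_def by (simp add: matrix_vector_mul_assoc)
  \<comment> \<open>Let \<open>a\<close> and \<open>b\<close> be the images of \<open>x\<close> and
    \<open>q\<close> under the transpose of \<open>A\<close>. The Gram matrix has derivative
    \<open>2\<xi> G + a b\<^sup>T + b a\<^sup>T\<close>, and the solutions of \<open>G z = b\<close>
    and \<open>G y = a\<close> bring this to the form \<open>C ** G\<close> that
    \<open>Jacobi_formula\<close> expects.\<close>
  define C :: "real^'k^'k" where "C = (\<chi> i j. (if i = j then 2 * \<xi> else 0) + ?a $ i * z $ j + ?b $ i * y $ j)"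
  define N where "N t = transpose (A + t *\<^sub>R B) ** (A + t *\<^sub>R B)" for t :: real
  have N0: "N 0 = ?G" by (simp add: N_def)
  have sym: "?G $ i $ j = ?G $ j $ i" for i j
    by (simp add: matrix_matrix_mult_def transpose_def mult.commute)
  have Gz: "(\<Sum>l\<in>UNIV. z $ l * ?G $ l $ j) = ?b $ j" for j
  proof -
    have "(\<Sum>l\<in>UNIV. z $ l * ?G $ l $ j) = (\<Sum>l\<in>UNIV. ?G $ j $ l * z $ l)"
      by (intro sum.cong refl) (subst sym, simp only: mult.commute)
    also have "\<dots> = (?G *v z) $ j" by (simp only: matrix_vector_mult_def vec_lambda_beta)
    finally show ?thesis unfolding z .
  qed
  have Gy: "(\<Sum>l\<in>UNIV. y $ l * ?G $ l $ j) = ?a $ j" for j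
  proof -
    have "(\<Sum>l\<in>UNIV. y $ l * ?G $ l $ j) = (\<Sum>l\<in>UNIV. ?G $ j $ l * y $ l)"
      by (intro sum.cong refl) (subst sym, simp only: mult.commute)
    also have "\<dots> = (?G *v y) $ j" by (simp only: matrix_vector_mult_def vec_lambda_beta)
    finally show ?thesis unfolding y .
  qed
  have CG: "(C ** ?G) $ i $ j = 2 * \<xi> * ?G $ i $ j + ?a $ i * ?b $ j + ?b $ i * ?a $ j" for i j
  proof -
    have "(C ** ?G) $ i $ j = (\<Sum>l\<in>UNIV. C $ i $ l * ?G $ l $ j)"
      by (simp only: matrix_matrix_mult_def vec_lambda_beta)
    also have "\<dots> = (\<Sum>l\<in>UNIV. (if i = l then 2 * \<xi> * ?G $ l $ j else 0) + ?a $ i * (z $ l * ?G $ l $ j) + ?b $ i * (y $ l * ?G $ l $ j))"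
      by (intro sum.cong refl) (simp only: C_def vec_lambda_beta, simp add: algebra_simps)
    also have "\<dots> = 2 * \<xi> * ?G $ i $ j + ?a $ i * (\<Sum>l\<in>UNIV. z $ l * ?G $ l $ j) + ?b $ i * (\<Sum>l\<in>UNIV. y $ l * ?G $ l $ j)"
      by (simp only: sum.distrib sum_distrib_left sum.delta' sum.delta finite UNIV_I if_True)
    finally show ?thesis unfolding Gz Gy .
  qed
  have at: "?a $ i = (\<Sum>l\<in>UNIV. A $ l $ i * x $ l)" for i
    by (simp only: matrix_vector_mult_def transpose_def vec_lambda_beta)
  have d: "((\<lambda>t. N t $ i $ j) has_real_derivative (C ** N 0) $ i $ j) (at 0)" for i j
  proof -
    have "N t $ i $ j = (\<Sum>l\<in>UNIV. (A $ l $ i + t * B $ l $ i) * (A $ l $ j + t * B $ l $ j))" for t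
      by (simp add: N_def matrix_matrix_mult_def transpose_def)
    moreover have "((\<lambda>t. \<Sum>l\<in>UNIV. (A $ l $ i + t * B $ l $ i) * (A $ l $ j + t * B $ l $ j))
      has_real_derivative (\<Sum>l\<in>UNIV. B $ l $ i * A $ l $ j + A $ l $ i * B $ l $ j)) (at 0)"
      by (intro DERIV_sum) (auto intro!: derivative_eq_intros)
    moreover have "(\<Sum>l\<in>UNIV. B $ l $ i * A $ l $ j + A $ l $ i * B $ l $ j) = (C ** N 0) $ i $ j"
    proof -
      have "(\<Sum>l\<in>UNIV. B $ l $ i * A $ l $ j + A $ l $ i * B $ l $ j) =
        (\<Sum>l\<in>UNIV. 2 * \<xi> * (A $ l $ i * A $ l $ j) + ?b $ i * (A $ l $ j * x $ l) + (A $ l $ i * x $ l) * ?b $ j)"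
        by (intro sum.cong refl) (simp only: B_def vec_lambda_beta, simp add: algebra_simps)
      also have "\<dots> = 2 * \<xi> * (\<Sum>l\<in>UNIV. A $ l $ i * A $ l $ j) + ?b $ i * (\<Sum>l\<in>UNIV. A $ l $ j * x $ l) + (\<Sum>l\<in>UNIV. A $ l $ i * x $ l) * ?b $ j"
        by (simp only: sum.distrib sum_distrib_left sum_distrib_right)
      also have "\<dots> = 2 * \<xi> * ?G $ i $ j + ?b $ i * ?a $ j + ?a $ i * ?b $ j"
        by (simp only: at[symmetric]) (simp add: matrix_matrix_mult_def transpose_def)
      finally show ?thesis unfolding N0 CG by simp
    qed
    ultimately show ?thesis by simp
  qed
  have bv: "?b \<bullet> v = q \<bullet> (A *v v)" for v
    by (metis dot_lmul_matrix transpose_matrix_vector)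
  have "?a \<bullet> z = (?G *v y) \<bullet> z" by (simp only: y)
  also have "\<dots> = (?G *v z) \<bullet> y" by (metis gram_mult_vec_inner inner_commute)
  also have "\<dots> = q \<bullet> (A *v y)" by (simp only: z bv)
  finally have az: "?a \<bullet> z = q \<bullet> (A *v y)" .
  have "trace C = (\<Sum>i\<in>UNIV. 2 * \<xi> + ?a $ i * z $ i + ?b $ i * y $ i)"
    by (simp only: trace_def C_def vec_lambda_beta if_True refl simp_thms)
  also have "\<dots> = 2 * real CARD('k) * \<xi> + ?a \<bullet> z + ?b \<bullet> y"
    by (simp only: sum.distrib inner_vec_def inner_real_def sum_constant)
  also have "\<dots> = 2 * real CARD('k) * \<xi> + 2 * (q \<bullet> (A *v y))" by (simp only: az bv)
  finally show ?thesis using Jacobi_formula[OF d] unfolding N0 by (simp only: N_def)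
qed

text \<open>A radial velocity only rescales the point, so time enters through
  \<open>(1 + t * \<xi>)\<^sup>2\<close> alone.\<close>

lemma conformal_factor_DERIV:
  fixes x :: "real^'n"
  assumes "norm x < 1"
  shows "((\<lambda>t. 4 / (1 - (norm (x + t *\<^sub>R (\<xi> *\<^sub>R x)))\<^sup>2)\<^sup>2) has_real_derivative
    4 / (1 - (norm x)\<^sup>2)\<^sup>2 * (4 * \<xi> * (norm x)\<^sup>2 / (1 - (norm x)\<^sup>2))) (at 0)"
proof -
  let ?r = "(norm x)\<^sup>2"
  have r: "1 - ?r > 0" using assms by (simp add: power_less_one_iff abs_square_less_1)
  have "(norm (x + t *\<^sub>R (\<xi> *\<^sub>R x)))\<^sup>2 = (1 + t * \<xi>)\<^sup>2 * ?r" for t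
  proof -
    have "x + t *\<^sub>R (\<xi> *\<^sub>R x) = (1 + t * \<xi>) *\<^sub>R x" by (simp add: algebra_simps)
    then show ?thesis by (simp add: power_mult_distrib)
  qed
  moreover have "((\<lambda>t. 4 / (1 - (1 + t * \<xi>)\<^sup>2 * ?r)\<^sup>2) has_real_derivative
    4 / (1 - ?r)\<^sup>2 * (4 * \<xi> * ?r / (1 - ?r))) (at 0)"
  proof -
    have d: "((\<lambda>t. (1 - (1 + t * \<xi>)\<^sup>2 * ?r)) has_real_derivative - (2 * \<xi> * ?r)) (at 0)"
      by (auto intro!: derivative_eq_intros)
    have "((\<lambda>t. 4 / (1 - (1 + t * \<xi>)\<^sup>2 * ?r)\<^sup>2) has_real_derivative
      (0 * (1 - ?r)\<^sup>2 - 4 * (2 * (1 - ?r) * - (2 * \<xi> * ?r))) / ((1 - ?r)\<^sup>2 * (1 - ?r)\<^sup>2)) (at 0)"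
      by (rule DERIV_cong[OF DERIV_divide[OF DERIV_const DERIV_power[OF d]]]) (use r in simp_all)
    moreover have "(0 * (1 - ?r)\<^sup>2 - 4 * (2 * (1 - ?r) * - (2 * \<xi> * ?r))) / ((1 - ?r)\<^sup>2 * (1 - ?r)\<^sup>2)
       = 4 / (1 - ?r)\<^sup>2 * (4 * \<xi> * ?r / (1 - ?r))"
    proof -
      have key: "(0 * a\<^sup>2 - 4 * (2 * a * - (2 * \<xi> * b))) / (a\<^sup>2 * a\<^sup>2) = 4 / a\<^sup>2 * (4 * \<xi> * b / a)" if "a \<noteq> 0" for a b :: real
        using that by (simp add: field_simps power2_eq_square)
      show ?thesis by (rule key) (use r in simp)
    qed
    ultimately show ?thesis by simp
  qed
  ultimately show ?thesis by simp
qed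

text \<open>The volume density of the metric \<open>4/(1 - |x|\<^sup>2)\<^sup>2 g\<^sub>E\<close> is the Euclidean one divided by \<open>conf_inv k\<close>.\<close>

definition conf_inv :: "nat \<Rightarrow> real^'n \<Rightarrow> real" where
  "conf_inv k x = ((1 - (norm x)\<^sup>2) / 2) ^ k"

lemma conf_inv_has_derivative:
  assumes "norm x < 1"
  shows "(conf_inv k has_derivative (\<lambda>v. - (2 * real k * conf_inv k x / (1 - (norm x)\<^sup>2)) * (x \<bullet> v))) (at x)"
proof -
  have r: "1 - (norm x)\<^sup>2 > 0" using assms by (simp add: power_less_one_iff abs_square_less_1)
  have "((\<lambda>x. (1 - x \<bullet> x) / 2) has_derivative (\<lambda>v. - (x \<bullet> v))) (at x)"
    by (auto intro!: derivative_eq_intros simp: inner_commute)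
  then have "((\<lambda>x. ((1 - x \<bullet> x) / 2) ^ k) has_derivative (\<lambda>v. real k * (- (x \<bullet> v)) * ((1 - x \<bullet> x) / 2) ^ (k - 1))) (at x)"
    by (rule has_derivative_eq_rhs[OF has_derivative_power]) (auto simp: fun_eq_iff)
  moreover have "real k * (- (x \<bullet> v)) * ((1 - x \<bullet> x) / 2) ^ (k - 1) =
     - (2 * real k * conf_inv k x / (1 - (norm x)\<^sup>2)) * (x \<bullet> v)" for v
  proof (cases k)
    case (Suc n)
    have key: "m * - w * P = - (2 * m * (a / 2 * P) / a) * w" if "a \<noteq> 0" for m w P a :: real
      using that by simp
    show ?thesis unfolding Suc conf_inv_def power_Suc diff_Suc_1 power2_norm_eq_inner
      by (rule key) (use r in \<open>simp add: power2_norm_eq_inner\<close>)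
  qed simp
  ultimately show ?thesis unfolding conf_inv_def[abs_def] by (simp add: power2_norm_eq_inner)
qed

lemma C1_on_conf_inv: "C1_on (conf_inv k :: real^'n \<Rightarrow> real) U"
proof -
  have "C1_on (\<lambda>x::real^'n. ((1 - (norm x)\<^sup>2) * (1/2)) ^ k) U"
    by (rule C1_on_power[OF C1_on_mult[OF C1_on_diff[OF C1_on_const C1_on_norm_square] C1_on_const]])
  then show ?thesis by (simp add: conf_inv_def[abs_def])
qed

lemma linear_functional_inner:
  fixes g :: "'a::euclidean_space \<Rightarrow> real"
  assumes "linear g"
  obtains q where "\<And>v. g v = q \<bullet> v"
  using adjoint_works[OF assms] that[of "adjoint g 1"] by (simp add: inner_commute)

lemma matrix_plus_rank_one_vec:
  fixes A :: "real^'k^'n"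
  shows "(\<chi> l j. c * A $ l $ j + x $ l * b $ j) *v v = c *\<^sub>R (A *v v) + (b \<bullet> v) *\<^sub>R x"
proof -
  have "(\<Sum>j\<in>UNIV. (c * A $ l $ j + x $ l * b $ j) * v $ j) =
    c * (\<Sum>j\<in>UNIV. A $ l $ j * v $ j) + x $ l * (\<Sum>j\<in>UNIV. b $ j * v $ j)" for l
    by (simp only: distrib_right mult.assoc sum.distrib sum_distrib_left)
  then show ?thesis
    by (simp add: vec_eq_iff matrix_vector_mult_def inner_vec_def)
qed

text \<open>The logarithmic derivatives of the conformal factor and of the Gram determinant add up,
  the square root halves them, and the factor \<open>conf_inv\<close> of \<open>X\<close> cancels
  the hyperbolic density in front.\<close>

lemma volume_density_variation:
  fixes f :: "real^'k \<Rightarrow> real^'n"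
  assumes f: "C1_parametrisation f U" and u: "u \<in> U" and n: "norm (f u) < 1" and \<eta>: "C1_on \<eta> UNIV"
  defines "X \<equiv> \<lambda>x. (\<eta> x * conf_inv CARD('k) x) *\<^sub>R x"
  shows "((\<lambda>t. sqrt ((4 / (1 - (norm (f u + t *\<^sub>R X (f u)))\<^sup>2)\<^sup>2) ^ CARD('k) *
        det (transpose (jac f u + t *\<^sub>R jac (\<lambda>u. X (f u)) u) ** (jac f u + t *\<^sub>R jac (\<lambda>u. X (f u)) u))))
     has_real_derivative
      gden f u * (fd \<eta> (f u) (tpart f u) + \<eta> (f u) * (real CARD('k) +
        2 * real CARD('k) * (((norm (f u))\<^sup>2 - (norm (tpart f u))\<^sup>2) / (1 - (norm (f u))\<^sup>2))))) (at 0)"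
proof -
  let ?k = "CARD('k)" and ?x = "f u" and ?A = "jac f u" and ?p = "tpart f u"
  let ?c = "conf_inv ?k"
  define \<xi> where "\<xi> = \<eta> ?x * ?c ?x"
  have r: "1 - (norm ?x)\<^sup>2 > 0" using n by (simp add: power_less_one_iff abs_square_less_1)
  have d\<eta>: "(\<eta> has_derivative fd \<eta> ?x) (at ?x)" by (rule C1_on_has_derivative[OF \<eta>]) simp
  define g where "g v = fd \<eta> ?x v * ?c ?x - \<eta> ?x * (2 * real ?k * ?c ?x / (1 - (norm ?x)\<^sup>2) * (?x \<bullet> v))" for v
  have dg: "((\<lambda>x. \<eta> x * ?c x) has_derivative g) (at ?x)"
    by (rule has_derivative_eq_rhs[OF has_derivative_mult[OF d\<eta> conf_inv_has_derivative[OF n]]])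
       (auto simp: g_def fun_eq_iff)
  obtain q where q: "\<And>v. g v = q \<bullet> v"
    using linear_functional_inner[OF has_derivative_linear[OF dg]] by blast
  have dX: "(X has_derivative (\<lambda>v. \<xi> *\<^sub>R v + g v *\<^sub>R ?x)) (at ?x)"
    unfolding X_def \<xi>_def by (rule has_derivative_eq_rhs[OF has_derivative_scaleR[OF dg has_derivative_ident]]) simp
  have dXf: "((\<lambda>u. X (f u)) has_derivative (\<lambda>v. \<xi> *\<^sub>R fd f u v + g (fd f u v) *\<^sub>R ?x)) (at u)"
    using has_derivative_compose[OF param_has_derivative[OF f u] dX] .
  have bv: "(transpose ?A *v q) \<bullet> v = q \<bullet> (?A *v v)" for v
    by (metis dot_lmul_matrix transpose_matrix_vector)
  have B: "jac (\<lambda>u. X (f u)) u = (\<chi> l j. \<xi> * ?A $ l $ j + ?x $ l * (transpose ?A *v q) $ j)" (is "?B = ?B'")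
  proof -
    have "?B *v v = ?B' *v v" for v
    proof -
      have "?B' *v v = \<xi> *\<^sub>R (?A *v v) + ((transpose ?A *v q) \<bullet> v) *\<^sub>R ?x"
        by (rule matrix_plus_rank_one_vec)
      then show ?thesis
        unfolding jac_works[OF dXf] bv by (simp add: param_jac[OF f u] q)
    qed
    then show ?thesis by (simp add: matrix_eq)
  qed
  let ?H = "\<lambda>t. 4 / (1 - (norm (?x + t *\<^sub>R X ?x))\<^sup>2)\<^sup>2"
  let ?G = "\<lambda>t. det (transpose (?A + t *\<^sub>R ?B) ** (?A + t *\<^sub>R ?B))"
  let ?h = "4 / (1 - (norm ?x)\<^sup>2)\<^sup>2" and ?s = "(norm ?x)\<^sup>2 / (1 - (norm ?x)\<^sup>2)"
  have dH: "(?H has_real_derivative ?h * (4 * \<xi> * ?s)) (at 0)"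
    using conformal_factor_DERIV[OF n, of \<xi>] by (simp add: X_def \<xi>_def)
  have dG: "(?G has_real_derivative (2 * real ?k * \<xi> + 2 * g ?p) * det (gram f u)) (at 0)"
    using det_gram_perturb_DERIV[OF param_jac_inj[OF f u] param_rad[OF f u, unfolded gram_def], of \<xi> q]
    unfolding B gram_def tpart_def q .
  let ?P0 = "?h ^ ?k * det (gram f u)"
  have k: "real ?k * ?h ^ (?k - 1) * ?h = real ?k * ?h ^ ?k"
  proof -
    have "a ^ (n - 1) * a = a ^ n" if "0 < n" for a :: real and n
      using that by (cases n) simp_all
    then show ?thesis by (simp only: mult.assoc zero_less_card_finite)
  qed
  have dP: "((\<lambda>t. ?H t ^ ?k * ?G t) has_real_derivative
     ?P0 * (4 * real ?k * \<xi> * ?s + 2 * real ?k * \<xi> + 2 * g ?p)) (at 0)"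
  proof (rule DERIV_cong[OF DERIV_mult[OF DERIV_power[OF dH] dG]])
    have "real ?k * (?h * (4 * \<xi> * ?s) * ?h ^ (?k - Suc 0)) = (real ?k * ?h ^ (?k - 1) * ?h) * (4 * \<xi> * ?s)" by simp
    also have "\<dots> = real ?k * ?h ^ ?k * (4 * \<xi> * ?s)" unfolding k ..
    finally have e: "real ?k * (?h * (4 * \<xi> * ?s) * ?h ^ (?k - Suc 0)) = real ?k * ?h ^ ?k * (4 * \<xi> * ?s)" .
    show "real ?k * (?h * (4 * \<xi> * ?s) * ?H 0 ^ (?k - Suc 0)) * ?G 0 + (2 * real ?k * \<xi> + 2 * g ?p) * det (gram f u) * ?H 0 ^ ?k =
      ?P0 * (4 * real ?k * \<xi> * ?s + 2 * real ?k * \<xi> + 2 * g ?p)"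
      using e by (simp add: gram_def) (simp add: algebra_simps)
  qed
  have hp: "0 < ?h" using r by simp
  have P0: "0 < ?P0" using hp param_det_gram_pos[OF f u] by simp
  have P00: "?H 0 ^ ?k * ?G 0 = ?P0" by (simp add: gram_def)
  have sq: "sqrt ?P0 * ?c ?x = gden f u"
  proof -
    have "?h = (2 / (1 - (norm ?x)\<^sup>2))\<^sup>2" by (simp add: power_divide)
    then have "?h ^ ?k = ((2 / (1 - (norm ?x)\<^sup>2)) ^ ?k)\<^sup>2" by (simp add: power_mult[symmetric] mult.commute)
    then have "sqrt (?h ^ ?k) = (2 / (1 - (norm ?x)\<^sup>2)) ^ ?k" using r by simp
    moreover have key: "(2 / a) ^ n * (a / 2) ^ n = 1" if "a \<noteq> 0" for a :: real and n
      using that by (simp add: power_mult_distrib[symmetric])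
    ultimately have "sqrt (?h ^ ?k) * ?c ?x = 1"
      unfolding conf_inv_def by (simp only:) (rule key, use r in simp)
    then show ?thesis by (simp add: real_sqrt_mult gden_def mult_ac)
  qed
  have xp: "?x \<bullet> ?p = (norm ?p)\<^sup>2"
  proof -
    have "(?x - ?p) \<bullet> ?p = 0" using tpart_orthogonal[OF f u] tpart_eq[OF f u] by simp
    then show ?thesis by (simp add: inner_diff_left power2_norm_eq_inner)
  qed
  have "((\<lambda>t. sqrt (?H t ^ ?k * ?G t)) has_real_derivative
    (inverse (sqrt ?P0) / 2) * (?P0 * (4 * real ?k * \<xi> * ?s + 2 * real ?k * \<xi> + 2 * g ?p))) (at 0)"
  proof -
    have "(sqrt has_real_derivative inverse (sqrt ?P0) / 2) (at (?H 0 ^ ?k * ?G 0))"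
      using DERIV_real_sqrt[OF P0] by (simp only: P00)
    from DERIV_chain2[OF this dP] show ?thesis .
  qed
  moreover have "(inverse (sqrt ?P0) / 2) * (?P0 * (4 * real ?k * \<xi> * ?s + 2 * real ?k * \<xi> + 2 * g ?p)) =
    gden f u * (fd \<eta> ?x ?p + \<eta> ?x * (real ?k + 2 * real ?k * (((norm ?x)\<^sup>2 - (norm ?p)\<^sup>2) / (1 - (norm ?x)\<^sup>2))))"
  proof -
    have key: "inverse (sqrt a) / 2 * (a * (2 * b)) = sqrt a * b" if "0 < a" for a b :: real
    proof -
      have "inverse (sqrt a) / 2 * (a * (2 * b)) = (a / sqrt a) * b" using that by (simp add: field_simps)
      also have "a / sqrt a = sqrt a" using that by (intro real_div_sqrt less_imp_le)
      finally show ?thesis .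
    qed
    have "4 * real ?k * \<xi> * ?s + 2 * real ?k * \<xi> + 2 * g ?p = 2 * (2 * real ?k * \<xi> * ?s + real ?k * \<xi> + g ?p)"
      by simp
    then have "(inverse (sqrt ?P0) / 2) * (?P0 * (4 * real ?k * \<xi> * ?s + 2 * real ?k * \<xi> + 2 * g ?p)) =
       sqrt ?P0 * (2 * real ?k * \<xi> * ?s + real ?k * \<xi> + g ?p)"
      using key[OF P0] by (simp only:)
    \<comment> \<open>By orthogonality the position and its tangential part have inner product
      \<open>|x\<^sup>T|\<^sup>2\<close>, so the gradient of \<open>conf_inv\<close> inside
      \<open>g\<close> contributes
      \<open>-2k \<xi> |x\<^sup>T|\<^sup>2 / (1 - |x|\<^sup>2)\<close>.\<close>
    also have "2 * real ?k * \<xi> * ?s + real ?k * \<xi> + g ?p =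
      ?c ?x * (fd \<eta> ?x ?p + \<eta> ?x * (real ?k + 2 * real ?k * (((norm ?x)\<^sup>2 - (norm ?p)\<^sup>2) / (1 - (norm ?x)\<^sup>2))))"
      unfolding g_def \<xi>_def xp by (simp add: diff_divide_distrib algebra_simps)
    finally show ?thesis unfolding mult.assoc[symmetric] sq .
  qed
  ultimately show ?thesis by simp
qed

lemma tC1_continuous: "tC1 T Z q \<Longrightarrow> t \<in> T \<Longrightarrow> continuous_on Z (q t)"
proof -
  assume *: "tC1 T Z q" "t \<in> T"
  then have "continuous_on (T \<times> Z) (\<lambda>p. q (fst p) (snd p))" unfolding tC1_def by blast
  then have "continuous_on Z (\<lambda>u. (\<lambda>p. q (fst p) (snd p)) (t, u))"
    by (rule continuous_on_compose2) (use * in \<open>auto intro!: continuous_intros\<close>)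
  then show ?thesis by simp
qed

lemma compact_closed_subset: "compact S \<Longrightarrow> closed T \<Longrightarrow> T \<subseteq> S \<Longrightarrow> compact T"
  for S T :: "'a::t2_space set"
  using compact_Int_closed[of S T] by (simp add: Int_absorb1)

section \<open>The first variation identity\<close>

text \<open>A support inside one chart and away from \<gamma> makes the localised volume one
  integral over a fixed parameter set. Its derivative is known pointwise from
  \<open>volume_density_variation\<close>, and minimality says that it is zero.\<close>

lemma first_variation_local:
  fixes f :: "real^'k \<Rightarrow> real^'n" and \<eta> :: "real^'n \<Rightarrow> real"
  assumes M: "minimal_submanifold TYPE('k) M" and cK: "compact (M \<union> \<gamma>)" and cl: "closed \<gamma>"
    and ch: "pchart M f U W \<kappa>"
    and \<eta>: "C1_on \<eta> UNIV" and S: "compact (closure {x. \<eta> x \<noteq> 0})" "closure {x. \<eta> x \<noteq> 0} \<subseteq> W"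
      "closure {x. \<eta> x \<noteq> 0} \<subseteq> ball 0 1" "closure {x. \<eta> x \<noteq> 0} \<inter> \<gamma> = {}"
  shows "((\<lambda>u. gden f u * (fd \<eta> (f u) (tpart f u) + \<eta> (f u) * (real CARD('k) +
        2 * real CARD('k) * (((norm (f u))\<^sup>2 - (norm (tpart f u))\<^sup>2) / (1 - (norm (f u))\<^sup>2)))))
      has_integral 0) U"
proof -
  let ?S = "closure {x. \<eta> x \<noteq> 0}"
  let ?k = "CARD('k)"
  define X where "X x = (\<eta> x * conf_inv ?k x) *\<^sub>R x" for x
  define E where "E u = gden f u * (fd \<eta> (f u) (tpart f u) + \<eta> (f u) * (real CARD('k) +
        2 * real CARD('k) * (((norm (f u))\<^sup>2 - (norm (tpart f u))\<^sup>2) / (1 - (norm (f u))\<^sup>2))))" for u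
  have ch': "open W" "C1_parametrisation f U" "f ` U = M \<inter> W" "\<And>x. x \<in> W \<Longrightarrow> \<kappa> differentiable (at x)"
    "\<And>u. u \<in> U \<Longrightarrow> \<kappa> (f u) = u" using ch unfolding pchart_def by auto
  have X: "C1_on X UNIV" unfolding X_def
    by (rule C1_on_scaleR[OF C1_on_mult[OF \<eta> C1_on_conf_inv] C1_on_id])
  have XS: "closure {x. X x \<noteq> 0} \<subseteq> ?S" by (rule closure_mono) (auto simp: X_def)
  have cX: "compact (closure {x. X x \<noteq> 0})"
    by (rule compact_closed_subset[OF S(1) closed_closure XS])
  have oV: "open (W \<inter> ball 0 1 \<inter> - \<gamma>)" using ch'(1) cl by (intro open_Int open_Compl open_ball)
  have SV: "?S \<subseteq> W \<inter> ball 0 1 \<inter> - \<gamma>" using S by blast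
  obtain \<zeta> :: "real^'n \<Rightarrow> real" and G where \<zeta>: "C1_on \<zeta> UNIV" "open G" "?S \<subseteq> G" "\<And>x. x \<in> G \<Longrightarrow> \<zeta> x = 1"
    "compact (closure {x. \<zeta> x \<noteq> 0})" "closure {x. \<zeta> x \<noteq> 0} \<subseteq> W \<inter> ball 0 1 \<inter> - \<gamma>"
    by (rule C1_bump[OF S(1) oV SV]) (rule that, assumption+)
  \<comment> \<open>The localising set must be open, contain the support and have its closure inside
    the chart, the ball and the complement of \<gamma>; the nonzero set of a bump function provides
    all of this.\<close>
  define \<Omega> where "\<Omega> = {x. \<zeta> x \<noteq> 0}"
  have o\<Omega>: "open \<Omega>" unfolding \<Omega>_def
    by (rule open_Collect_neq[OF C1_on_continuous[OF \<zeta>(1)] continuous_on_const])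
  have S\<Omega>: "?S \<subseteq> \<Omega>" using \<zeta>(3,4) by (auto simp: \<Omega>_def)
  have c\<Omega>: "compact (closure \<Omega>)" "closure \<Omega> \<subseteq> W" "closure \<Omega> \<subseteq> ball 0 1" "closure \<Omega> \<inter> \<gamma> = {}"
    using \<zeta>(5,6) unfolding \<Omega>_def by auto
  have \<Omega>W: "\<Omega> \<subseteq> W" using c\<Omega>(2) closure_subset by blast
  have Mc: "compact (M \<inter> closure \<Omega>)"
  proof -
    have "M \<inter> closure \<Omega> = (M \<union> \<gamma>) \<inter> closure \<Omega>" using c\<Omega>(4) by blast
    then show ?thesis using compact_Int_closed[OF cK closed_closure] by metis
  qed
  let ?F = "\<lambda>t x. x + t *\<^sub>R X x"
  let ?V = "\<lambda>t. enn2real (hyperbolic_volume TYPE('k) (?F t ` (M \<inter> \<Omega>)))"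
  have V0: "(?V has_real_derivative 0) (at 0)"
    using M X o\<Omega> c\<Omega>(3) Mc XS S\<Omega> unfolding minimal_submanifold_def by blast
  \<comment> \<open>A compact parameter set, as \<open>DERIV_integral_tC1\<close> demands; the
    integrals themselves run over its open subset \<open>U'\<close>.\<close>
  define Z where "Z = \<kappa> ` (M \<inter> closure \<Omega>)"
  have ck: "continuous_on W \<kappa>"
    using ch'(4) differentiable_imp_continuous_within continuous_at_imp_continuous_on by blast
  have cZ: "compact Z" unfolding Z_def
    by (rule compact_continuous_image[OF continuous_on_subset[OF ck] Mc]) (use c\<Omega>(2) in auto)
  have Z: "u \<in> U \<and> f u \<in> M \<inter> closure \<Omega>" if "u \<in> Z" for u
  proof -
    obtain x where x: "x \<in> M \<inter> closure \<Omega>" "u = \<kappa> x" using \<open>u \<in> Z\<close> unfolding Z_def by blast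
    then have "x \<in> f ` U" using ch'(3) c\<Omega>(2) by blast
    then show ?thesis using x ch'(5) by auto
  qed
  define U' where "U' = {u \<in> U. f u \<in> \<Omega>}"
  have oU': "open U'" unfolding U'_def
    using continuous_open_preimage[OF param_continuous[OF ch'(2)] param_open[OF ch'(2)] o\<Omega>]
    by (simp add: vimage_def Int_def)
  have U'Z: "U' \<subseteq> Z"
  proof
    fix u assume "u \<in> U'"
    then have "u \<in> U" "f u \<in> \<Omega>" by (auto simp: U'_def)
    then have "f u \<in> M \<inter> closure \<Omega>" using ch'(3) closure_subset by blast
    then show "u \<in> Z" unfolding Z_def using ch'(5)[OF \<open>u \<in> U\<close>] by (metis imageI)
  qed
  obtain r where r: "0 \<le> r" "r < 1" "\<And>x. x \<in> closure \<Omega> \<Longrightarrow> norm x \<le> r"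
  proof -
    \<comment> \<open>The origin is inserted so that the maximum of the norm is taken over a
      nonempty set.\<close>
    have "compact (insert 0 (closure \<Omega>))" using c\<Omega>(1) by simp
    then obtain y where y: "y \<in> insert 0 (closure \<Omega>)" "\<And>x. x \<in> insert 0 (closure \<Omega>) \<Longrightarrow> norm x \<le> norm y"
      using continuous_attains_sup[of "insert 0 (closure \<Omega>)" norm] continuous_on_norm_id by (metis insert_not_empty)
    moreover have "norm y < 1" using y(1) c\<Omega>(3) by auto
    ultimately show thesis using that[of "norm y"] by auto
  qed
  obtain B where B: "0 \<le> B" "\<And>x y. norm (X x - X y) \<le> B * norm (x - y)"
    "\<And>x v. norm (fd X x v) \<le> B * norm v" "\<And>x. norm (X x) \<le> B"
    using C1_compact_support_bounds[OF X cX] by blast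
  \<comment> \<open>Up to time \<open>d\<close> points move by at most \<open>(1 - r)/2\<close>, so
    those of \<Omega> stay in the unit ball; the Lipschitz constant of the displacement is below
    \<open>1/2\<close>, so the deformation stays an embedding.\<close>
  define d where "d = (1 - r) / (2 * (B + 1))"
  have d: "0 < d" using r B(1) by (simp add: d_def)
  have dB: "d * B < 1 / 2" "r + d * B < 1"
  proof -
    have "d * B \<le> d * (B + 1)" using d by simp
    also have "\<dots> = (1 - r) / 2" using B(1) by (simp add: d_def field_simps)
    finally show "r + d * B < 1" using r by (simp add: field_simps)
    show "d * B < 1 / 2"
    proof (cases "B = 0")
      case False
      then have "d * B < d * (B + 1)" using d by simp
      also have "\<dots> = (1 - r) / 2" using B(1) by (simp add: d_def field_simps)
      finally show ?thesis using r by simp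
    qed simp
  qed
  have tB: "\<bar>t\<bar> * B \<le> d * B" if "t \<in> {-d..d}" for t
    using that B(1) by (intro mult_right_mono) auto
  have FC: "C1_on (?F t) UNIV" for t
    using C1_on_add[OF C1_on_id C1_on_scaleR[OF C1_on_const[of t] X]] by simp
  have dX: "(X has_derivative fd X x) (at x)" for x by (rule C1_on_has_derivative[OF X]) simp
  have dF: "(?F t has_derivative (\<lambda>v. v + t *\<^sub>R fd X x v)) (at x)" for t x
    by (intro has_derivative_add has_derivative_ident has_derivative_scaleR_right dX)
  have lo1: "1 / 2 * norm (x - y) \<le> norm (?F t x - ?F t y)" if "t \<in> {-d..d}" for t x y
  proof -
    have "norm (x - y) = norm ((?F t x - ?F t y) - t *\<^sub>R (X x - X y))" by (simp add: algebra_simps)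
    also have "\<dots> \<le> norm (?F t x - ?F t y) + \<bar>t\<bar> * norm (X x - X y)" using norm_triangle_ineq4[of "?F t x - ?F t y"] by (metis norm_scaleR)
    also have "\<bar>t\<bar> * norm (X x - X y) \<le> \<bar>t\<bar> * (B * norm (x - y))" using B(2) by (intro mult_left_mono) auto
    also have "\<dots> = (\<bar>t\<bar> * B) * norm (x - y)" by simp
    also have "\<dots> \<le> 1 / 2 * norm (x - y)" using tB[OF that] dB(1) by (intro mult_right_mono) auto
    finally show ?thesis by simp
  qed
  have lo2: "1 / 2 * norm v \<le> norm (fd (?F t) x v)" if "t \<in> {-d..d}" for t x v
  proof -
    have "norm v = norm ((v + t *\<^sub>R fd X x v) - t *\<^sub>R fd X x v)" by simp
    also have "\<dots> \<le> norm (v + t *\<^sub>R fd X x v) + \<bar>t\<bar> * norm (fd X x v)" using norm_triangle_ineq4 by (metis norm_scaleR)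
    also have "\<bar>t\<bar> * norm (fd X x v) \<le> \<bar>t\<bar> * (B * norm v)" using B(3) by (intro mult_left_mono) auto
    also have "\<dots> = (\<bar>t\<bar> * B) * norm v" by simp
    also have "\<dots> \<le> 1 / 2 * norm v" using tB[OF that] dB(1) by (intro mult_right_mono) auto
    finally show ?thesis unfolding fdI[OF dF] by simp
  qed
  have jacF: "jac (\<lambda>u. ?F t (f u)) u = jac f u + t *\<^sub>R jac (\<lambda>u. X (f u)) u" if "u \<in> U" for t u
  proof -
    note df = param_has_derivative[OF ch'(2) that]
    have "jac (\<lambda>u. ?F t (f u)) u *v v = (jac f u + t *\<^sub>R jac (\<lambda>u. X (f u)) u) *v v" for v
      by (simp add: jac_works[OF has_derivative_compose[OF df dF]] jac_works[OF has_derivative_compose[OF df dX]]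
          param_jac[OF ch'(2) that] matrix_vector_mult_add_rdistrib scaleR_matrix_vector_assoc[symmetric])
    then show ?thesis by (simp add: matrix_eq)
  qed
  define H where "H t u = 4 / (1 - (norm (f u + t *\<^sub>R X (f u)))\<^sup>2)\<^sup>2" for t u
  define \<Gamma> where "\<Gamma> t u = transpose (jac f u + t *\<^sub>R jac (\<lambda>u. X (f u)) u) ** (jac f u + t *\<^sub>R jac (\<lambda>u. X (f u)) u)" for t u
  define D where "D t u = sqrt (H t u ^ ?k * det (\<Gamma> t u))" for t u
  have gram\<Gamma>: "gram (\<lambda>u. ?F t (f u)) u = \<Gamma> t u" if "u \<in> U" for t u
    by (simp add: gram_def \<Gamma>_def jacF[OF that])
  have nF: "norm (?F t (f u)) < 1" if "t \<in> {-d..d}" "u \<in> Z" for t u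
  proof -
    have "norm (?F t (f u)) \<le> norm (f u) + \<bar>t\<bar> * norm (X (f u))" using norm_triangle_ineq by (metis norm_scaleR)
    also have "\<dots> \<le> r + \<bar>t\<bar> * B" using r(3) Z[OF that(2)] B(4) by (intro add_mono mult_left_mono) auto
    also have "\<dots> \<le> r + d * B" using tB[OF that(1)] by simp
    finally show ?thesis using dB(2) by simp
  qed
  have pos1: "0 < 1 - (norm (?F t (f u)))\<^sup>2" if "t \<in> {-d..d}" "u \<in> Z" for t u
    using nF[OF that] by (simp add: power_less_one_iff abs_square_less_1)
  have par: "C1_parametrisation (\<lambda>u. ?F t (f u)) U" if "t \<in> {-d..d}" for t
  proof -
    have "C1_parametrisation (\<lambda>u. ?F t (f u)) {u \<in> U. f u \<in> W}"
      by (rule pchart_param[OF pchart_diffeo[OF ch ch'(1) order_refl FC _ lo1[OF that] lo2[OF that]]]) simp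
    moreover have "{u \<in> U. f u \<in> W} = U" using ch'(3) by blast
    ultimately show ?thesis by simp
  qed
  have pos2: "0 < det (\<Gamma> t u)" if "t \<in> {-d..d}" "u \<in> U" for t u
    using param_det_gram_pos[OF par[OF that(1)] that(2)] gram\<Gamma>[OF that(2)] by simp
  have subZ: "Z \<subseteq> U" using Z by blast
  have cA: "continuous_on Z (\<lambda>u. jac f u $ i $ j)" for i j
    by (rule continuous_on_subset[OF jac_continuous[OF ch'(2)] subZ])
  have cf: "continuous_on Z f" by (rule continuous_on_subset[OF param_continuous[OF ch'(2)] subZ])
  have Xf: "C1_on (\<lambda>u. X (f u)) U"
    by (rule C1_on_compose[OF param_C1[OF ch'(2)] X]) simp
  have cXf: "continuous_on Z (\<lambda>u. X (f u))" by (rule continuous_on_subset[OF C1_on_continuous[OF Xf] subZ])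
  have cB: "continuous_on Z (\<lambda>u. jac (\<lambda>u. X (f u)) u $ i $ j)" for i j
  proof -
    have "continuous_on U (\<lambda>u. fd (\<lambda>u. X (f u)) u (axis j 1) $ i)"
      by (intro continuous_on_component C1_on_continuous_fd[OF Xf] continuous_on_const)
    then show ?thesis by (intro continuous_on_subset[OF _ subZ]) (simp add: jac_def matrix_def)
  qed
  have tH: "tC1 {-d..d} Z (\<lambda>t u. H t u ^ ?k)"
  proof -
    have e: "1 - (norm (?F t (f u)))\<^sup>2 = 1 + (- 1) * (\<Sum>i\<in>UNIV. (f u $ i + t * X (f u) $ i) * (f u $ i + t * X (f u) $ i))" for t u
      by (simp add: power2_norm_eq_inner inner_vec_def)
    have b: "tC1 {-d..d} Z (\<lambda>t u. 1 - (norm (?F t (f u)))\<^sup>2)"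
      unfolding e by (intro tC1_add tC1_mult tC1_sum tC1_time tC1_space continuous_on_const continuous_on_component cf cXf)
    have "tC1 {-d..d} Z (\<lambda>t u. (4 * inverse ((1 - (norm (?F t (f u)))\<^sup>2) ^ 2)) ^ ?k)"
      by (rule tC1_power[OF tC1_mult[OF tC1_space[OF continuous_on_const] tC1_inverse[OF tC1_power[OF b] zero_less_power[OF pos1]]]])
    then show ?thesis by (simp add: H_def divide_inverse)
  qed
  have t\<Gamma>: "tC1 {-d..d} Z (\<lambda>t u. det (\<Gamma> t u))"
  proof (rule tC1_det)
    fix i j
    have "tC1 {-d..d} Z (\<lambda>t u. \<Sum>l\<in>UNIV. (jac f u $ l $ i + t * jac (\<lambda>u. X (f u)) u $ l $ i) * (jac f u $ l $ j + t * jac (\<lambda>u. X (f u)) u $ l $ j))"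
      by (intro tC1_add tC1_mult tC1_sum tC1_time tC1_space cA cB)
    then show "tC1 {-d..d} Z (\<lambda>t u. \<Gamma> t u $ i $ j)"
      by (simp add: \<Gamma>_def matrix_matrix_mult_def transpose_def)
  qed
  have Hpos: "0 < H t u" if "t \<in> {-d..d}" "u \<in> Z" for t u
    using pos1[OF that] by (simp add: H_def)
  have tD: "tC1 {-d..d} Z D"
    unfolding D_def[abs_def]
    by (intro tC1_sqrt tC1_mult tH t\<Gamma> mult_pos_pos zero_less_power Hpos pos2) (use subZ in auto)
  have D0: "((\<lambda>t. D t u) has_real_derivative E u) (at 0)" if "u \<in> U'" for u
  proof -
    have "f u \<in> \<Omega>" "u \<in> U" using that by (auto simp: U'_def)
    moreover from this have "f u \<in> ball 0 1" using c\<Omega>(3) closure_subset[of \<Omega>] by blast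
    ultimately have "u \<in> U" "norm (f u) < 1" by auto
    from volume_density_variation[OF ch'(2) this \<eta>] show ?thesis
      unfolding D_def H_def \<Gamma>_def E_def X_def .
  qed
  have bU': "U' \<in> sets borel" using oU' by simp
  have DI1: "((\<lambda>t. integral U' (D t)) has_real_derivative integral U' E) (at 0)"
    by (rule DERIV_integral_tC1(1)[OF tD d cZ bU' U'Z]) (rule D0)
  have DI2: "E integrable_on U'"
    by (rule DERIV_integral_tC1(2)[OF tD d cZ bU' U'Z]) (rule D0)
  have DI3: "D t absolutely_integrable_on U'" if t: "t \<in> {-d..d}" for t
    by (rule DERIV_integral_tC1(3)[OF tD d cZ bU' U'Z _ t]) (rule D0)
  have h: "(\<lambda>x::real^'n. 4 / (1 - (norm x)\<^sup>2)\<^sup>2) \<in> borel_measurable borel" by measurable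
  have V: "?V t = integral U' (D t)" if t: "t \<in> {-d..d}" for t
  proof -
    have Dnn: "0 \<le> D t u" if "u \<in> U'" for u
    proof -
      have "u \<in> Z" "u \<in> U" using that U'Z subZ by auto
      then have "0 \<le> H t u ^ ?k * det (\<Gamma> t u)"
        using Hpos[OF t, of u] pos2[OF t, of u] by (intro mult_nonneg_nonneg zero_le_power less_imp_le)
      then show ?thesis by (simp add: D_def)
    qed
    have c: "pchart (?F t ` (M \<inter> \<Omega>)) (\<lambda>u. ?F t (f u)) U' (?F t ` \<Omega>) (\<lambda>y. \<kappa> (inv (?F t) y))"
      unfolding U'_def by (rule pchart_diffeo[OF ch o\<Omega> \<Omega>W FC _ lo1[OF t] lo2[OF t]]) simp
    have "hyperbolic_volume TYPE('k) (?F t ` (M \<inter> \<Omega>)) =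
      (\<integral>\<^sup>+u\<in>U'. ennreal (volume_density (\<lambda>x. 4 / (1 - (norm x)\<^sup>2)\<^sup>2) (\<lambda>u. ?F t (f u)) u) \<partial>lborel)"
      unfolding hyperbolic_volume_def by (rule kvolume_single_chart[OF c _ h]) auto
    also have "\<dots> = (\<integral>\<^sup>+u\<in>U'. ennreal (D t u) \<partial>lborel)"
    proof (rule nn_integral_cong)
      fix u
      have "volume_density (\<lambda>x. 4 / (1 - (norm x)\<^sup>2)\<^sup>2) (\<lambda>u. ?F t (f u)) u = D t u" if "u \<in> U'"
        using that gram\<Gamma>[of u t]
        by (simp add: volume_density_eq gden_def D_def H_def real_sqrt_mult U'_def)
      then show "ennreal (volume_density (\<lambda>x. 4 / (1 - (norm x)\<^sup>2)\<^sup>2) (\<lambda>u. ?F t (f u)) u) * indicator U' u =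
         ennreal (D t u) * indicator U' u" by (simp add: indicator_def)
    qed
    also have "\<dots> = ennreal (integral U' (D t))"
    proof (rule absolutely_integrable_nonneg_iff(2)[OF _ _ DI3[OF t]])
      have "continuous_on U' (D t)" by (rule continuous_on_subset[OF tC1_continuous[OF tD t] U'Z])
      then have "(\<lambda>x. indicator U' x *\<^sub>R D t x) \<in> borel_measurable borel"
        by (rule borel_measurable_continuous_on_indicator[OF bU'])
      then show "(\<lambda>x. indicator U' x * D t x) \<in> borel_measurable borel" by (simp only: real_scaleR_def)
      show "0 \<le> D t u" if "u \<in> U'" for u
        by (rule Dnn[OF that])
    qed
    finally have e: "hyperbolic_volume TYPE('k) (?F t ` (M \<inter> \<Omega>)) = ennreal (integral U' (D t))" .
    have "0 \<le> integral U' (D t)"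
    proof (rule integral_nonneg)
      show "D t integrable_on U'" using DI3[OF t] by (simp add: absolutely_integrable_on_def)
      show "0 \<le> D t u" if "u \<in> U'" for u
        by (rule Dnn[OF that])
    qed
    then show ?thesis unfolding e by simp
  qed
  have "(?V has_real_derivative integral U' E) (at 0)"
    by (rule has_field_derivative_transform_within_open[OF DI1, of "{-d<..<d}"]) (use d V in auto)
  then have "integral U' E = 0" using V0 DERIV_unique by blast
  then have E0: "(E has_integral 0) U'" using DI2 by (metis integrable_integral)
  \<comment> \<open>Outside \<open>U'\<close> both \<eta> and its derivative vanish, so the integral
    extends from \<open>U'\<close> to the whole chart domain.\<close>
  have Ez: "E u = 0" if "u \<in> U - U'" for u
  proof -
    have "f u \<notin> ?S" using that S\<Omega> by (auto simp: U'_def)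
    then have "fd \<eta> (f u) = (\<lambda>_. 0)" "\<eta> (f u) = 0" using fd_eq_zero[of "f u" \<eta>] by blast+
    then show ?thesis by (simp only: E_def) simp
  qed
  have "(E has_integral 0) U"
  proof -
    have "U' \<subseteq> U" by (auto simp: U'_def)
    from has_integral_restrict[OF this, of E 0]
    have "((\<lambda>u. if u \<in> U' then E u else 0) has_integral 0) U" using E0 by blast
    then show ?thesis by (rule has_integral_eq[rotated]) (use Ez in auto)
  qed
  then show ?thesis by (simp only: E_def[abs_def])
qed

text \<open>The support of \<eta> may leave the unit ball. A cutoff that is 1 near the compact set
  where the support meets \<open>M\<close> brings it back inside, without changing \<eta> or its
  derivative at points of \<open>M\<close>.\<close>

lemma first_variation:
  fixes f :: "real^'k \<Rightarrow> real^'n" and \<eta> :: "real^'n \<Rightarrow> real"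
  assumes M: "minimal_submanifold TYPE('k) M" and cK: "compact (M \<union> \<gamma>)" and cl: "closed \<gamma>"
    and ch: "pchart M f U W \<kappa>"
    and \<eta>: "C1_on \<eta> UNIV" and S: "compact (closure {x. \<eta> x \<noteq> 0})" "closure {x. \<eta> x \<noteq> 0} \<subseteq> W"
      "closure {x. \<eta> x \<noteq> 0} \<inter> \<gamma> = {}"
  shows "((\<lambda>u. gden f u * (fd \<eta> (f u) (tpart f u) + \<eta> (f u) * (real CARD('k) +
        2 * real CARD('k) * (((norm (f u))\<^sup>2 - (norm (tpart f u))\<^sup>2) / (1 - (norm (f u))\<^sup>2)))))
      has_integral 0) U"
proof -
  let ?S = "closure {x. \<eta> x \<noteq> 0}"
  have "M \<inter> ?S = (M \<union> \<gamma>) \<inter> ?S" using S(3) by blast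
  then have cMS: "compact (M \<inter> ?S)" using compact_Int_closed[OF cK closed_closure] by metis
  have MS: "M \<inter> ?S \<subseteq> ball 0 1" using M unfolding minimal_submanifold_def by blast
  obtain \<zeta> :: "real^'n \<Rightarrow> real" and G where \<zeta>: "C1_on \<zeta> UNIV" "open G" "M \<inter> ?S \<subseteq> G" "\<And>x. x \<in> G \<Longrightarrow> \<zeta> x = 1"
    "compact (closure {x. \<zeta> x \<noteq> 0})" "closure {x. \<zeta> x \<noteq> 0} \<subseteq> ball 0 1"
    by (rule C1_bump[OF cMS open_ball MS]) (rule that, assumption+)
  let ?e = "\<lambda>x. \<eta> x * \<zeta> x"
  have s1: "closure {x. ?e x \<noteq> 0} \<subseteq> ?S" and s2: "closure {x. ?e x \<noteq> 0} \<subseteq> closure {x. \<zeta> x \<noteq> 0}"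
    by (rule closure_mono, force)+
  have ce: "compact (closure {x. ?e x \<noteq> 0})"
    by (rule compact_closed_subset[OF S(1) closed_closure s1])
  have C1e: "C1_on ?e UNIV" by (rule C1_on_mult[OF \<eta> \<zeta>(1)])
  have s3: "closure {x. ?e x \<noteq> 0} \<subseteq> W" using s1 S(2) by (rule subset_trans)
  have s4: "closure {x. ?e x \<noteq> 0} \<subseteq> ball 0 1" using s2 \<zeta>(6) by (rule subset_trans)
  have s5: "closure {x. ?e x \<noteq> 0} \<inter> \<gamma> = {}" using s1 S(3) by blast
  have eq: "fd ?e (f u) = fd \<eta> (f u) \<and> ?e (f u) = \<eta> (f u)" if "u \<in> U" for u
  proof (cases "f u \<in> ?S")
    case True
    then have G: "f u \<in> G" using pchart_image[OF ch] that \<zeta>(3) by blast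
    have "(?e has_derivative fd \<eta> (f u)) (at (f u))"
      by (rule has_derivative_transform_within_open[OF C1_on_has_derivative[OF \<eta> UNIV_I] \<zeta>(2) G])
         (simp add: \<zeta>(4))
    then show ?thesis using \<zeta>(4)[OF G] by (simp add: fdI)
  next
    case False
    then have "f u \<notin> closure {x. ?e x \<noteq> 0}" using s1 by blast
    then have "fd ?e (f u) = (\<lambda>_. 0)" "?e (f u) = 0" by (rule fd_eq_zero)+
    moreover have "fd \<eta> (f u) = (\<lambda>_. 0)" "\<eta> (f u) = 0" using fd_eq_zero[OF False] by blast+
    ultimately show ?thesis by (simp only: simp_thms)
  qed
  show ?thesis
    by (rule has_integral_eq[OF _ first_variation_local[OF M cK cl ch C1e ce s3 s4 s5]])
       (simp only: eq)
qed

section \<open>Collars of the boundary\<close>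

text \<open>The image of \<open>f\<close> continues the submanifold across its boundary, so
  densities and tangential parts are continuous up to \<gamma> and beyond. Closedness of that image
  in \<open>W\<close> makes compact supports compact in the parameters. Interior points use the same
  notion, with positive coordinate \<open>i0\<close> throughout.\<close>

definition collar_chart ::
    "'k::finite \<Rightarrow> (real^'n) set \<Rightarrow> (real^'n) set \<Rightarrow> (real^'n) set \<Rightarrow> (real^'k) set \<Rightarrow>
      (real^'k \<Rightarrow> real^'n) \<Rightarrow> (real^'n \<Rightarrow> real^'k) \<Rightarrow> bool" where
  "collar_chart i0 K \<gamma> W U f \<kappa> \<longleftrightarrow> open W \<and> C1_parametrisation f U \<and> C1_on \<kappa> W \<and>
     (\<forall>u\<in>U. \<kappa> (f u) = u) \<and> f ` U \<subseteq> W \<and> closedin (top_of_set W) (f ` U) \<and>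
     K \<inter> W = f ` {u \<in> U. 0 \<le> u $ i0} \<and> \<gamma> \<inter> W = f ` {u \<in> U. u $ i0 = 0}"

text \<open>A differentiable left inverse forces injectivity and, by the chain rule, an injective
  derivative.\<close>

lemma C1_parametrisationI:
  assumes f: "C1_on f U" "open U" and \<kappa>: "\<And>u. u \<in> U \<Longrightarrow> \<kappa> differentiable (at (f u))" "\<And>u. u \<in> U \<Longrightarrow> \<kappa> (f u) = u"
  shows "C1_parametrisation f U"
  unfolding C1_parametrisation_def
proof (intro conjI ballI f)
  show "inj_on f U" by (rule inj_on_inverseI[of _ \<kappa>]) (rule \<kappa>(2))
  fix u assume u: "u \<in> U"
  have "((\<lambda>u. \<kappa> (f u)) has_derivative (\<lambda>v. fd \<kappa> (f u) (fd f u v))) (at u)"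
    using has_derivative_compose[OF C1_on_has_derivative[OF f(1) u]] \<kappa>(1)[OF u] frechet_derivative_works by blast
  moreover have "((\<lambda>u. \<kappa> (f u)) has_derivative (\<lambda>v. v)) (at u)"
    by (rule has_derivative_transform_within_open[OF has_derivative_ident f(2) u]) (simp add: \<kappa>(2))
  ultimately have "(\<lambda>v. fd \<kappa> (f u) (fd f u v)) = (\<lambda>v. v)" by (rule has_derivative_unique)
  then show "inj (fd f u)" by (metis injI)
qed

text \<open>The shift \<open>a\<close> is free so that the coordinate \<open>i0\<close> of a given
  point can be prescribed.\<close>

lemma slice_parametrisation:
  fixes \<phi> :: "real^'n \<Rightarrow> real^'n" and \<iota> :: "real^'k \<Rightarrow> real^'n" and a :: "real^'k"
  assumes \<phi>: "C1_diffeo_on \<phi> W" and \<iota>: "linear \<iota>" "linear \<nu>" "\<And>u. \<nu> (\<iota> u) = u" "range \<iota> = L"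
  defines "f \<equiv> \<lambda>u. inv_into W \<phi> (\<iota> (u - a))" and "U \<equiv> {u. \<iota> (u - a) \<in> \<phi> ` W}" and "\<kappa> \<equiv> \<lambda>x. \<nu> (\<phi> x) + a"
  shows "C1_parametrisation f U" "C1_on \<kappa> W" "\<And>u. u \<in> U \<Longrightarrow> \<kappa> (f u) = u" "f ` U = {x \<in> W. \<phi> x \<in> L}"
    "\<And>u. u \<in> U \<Longrightarrow> \<phi> (f u) = \<iota> (u - a)" "open U" "\<And>x. x \<in> W \<Longrightarrow> \<phi> x \<in> L \<Longrightarrow> \<kappa> x \<in> U \<and> f (\<kappa> x) = x"
proof -
  have p: "open W" "open (\<phi> ` W)" "inj_on \<phi> W" "C1_on \<phi> W" "C1_on (inv_into W \<phi>) (\<phi> ` W)"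
    using \<phi> unfolding C1_diffeo_on_def by auto
  have bl: "bounded_linear \<iota>" "bounded_linear \<nu>" using \<iota> linear_conv_bounded_linear by blast+
  have Ca: "C1_on (\<lambda>u. \<iota> (u - a)) T" for T
    by (rule C1_on_compose[OF C1_on_diff[OF C1_on_id C1_on_const] C1_on_bounded_linear[OF bl(1), of UNIV]]) simp
  show oU: "open U"
    unfolding U_def using open_vimage[OF p(2) C1_on_continuous[OF Ca[of UNIV]]] by (simp add: vimage_def)
  show \<phi>f: "\<phi> (f u) = \<iota> (u - a)" if "u \<in> U" for u
    using that by (simp add: f_def U_def f_inv_into_f)
  show \<kappa>f: "\<kappa> (f u) = u" if "u \<in> U" for u
    using \<phi>f[OF that] \<iota>(3) by (simp add: \<kappa>_def)
  show C\<kappa>: "C1_on \<kappa> W" unfolding \<kappa>_def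
    by (rule C1_on_add[OF C1_on_compose[OF p(4) C1_on_bounded_linear[OF bl(2), of UNIV]] C1_on_const]) simp
  have fW: "f u \<in> W" if "u \<in> U" for u using that by (simp add: f_def U_def inv_into_into)
  have Cf: "C1_on f U" unfolding f_def by (rule C1_on_compose[OF Ca p(5)]) (auto simp: U_def)
  show "C1_parametrisation f U"
  proof (rule C1_parametrisationI[OF Cf oU _ \<kappa>f])
    show "\<kappa> differentiable (at (f u))" if "u \<in> U" for u
      using C1_on_has_derivative[OF C\<kappa> fW[OF that]] by (rule differentiableI)
  qed
  show inv: "\<kappa> x \<in> U \<and> f (\<kappa> x) = x" if "x \<in> W" "\<phi> x \<in> L" for x
  proof -
    obtain w where w: "\<phi> x = \<iota> w" using \<open>\<phi> x \<in> L\<close> \<iota>(4) by blast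
    then have "\<iota> (\<kappa> x - a) = \<phi> x" using \<iota>(3) by (simp add: \<kappa>_def)
    then show ?thesis using that(1) p(3) by (simp add: U_def f_def inv_into_f_f)
  qed
  show "f ` U = {x \<in> W. \<phi> x \<in> L}"
  proof (intro equalityI subsetI)
    fix x assume "x \<in> f ` U"
    then obtain u where u: "u \<in> U" "x = f u" by blast
    then show "x \<in> {x \<in> W. \<phi> x \<in> L}" using \<phi>f[OF u(1)] fW[OF u(1)] \<iota>(4) by auto
  next
    fix x assume "x \<in> {x \<in> W. \<phi> x \<in> L}"
    then show "x \<in> f ` U" using inv[of x] by (metis (mono_tags, lifting) image_eqI mem_Collect_eq)
  qed
qed

text \<open>An orthogonal map that turns the axis \<open>i0\<close> into the direction of
  \<open>e\<close>, followed by an isometry onto \<open>L\<close>, makes the half-space of a slice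
  chart a coordinate half-space.\<close>

lemma linear_coordinates_subspace:
  fixes L :: "(real^'n) set" and i0 :: "'k::finite"
  assumes L: "subspace L" "dim L = CARD('k)" and e: "e \<in> L" "e \<noteq> 0"
  obtains \<iota> :: "real^'k \<Rightarrow> real^'n" and \<nu> c where "linear \<iota>" "linear \<nu>" "\<And>u. \<nu> (\<iota> u) = u" "range \<iota> = L"
    "0 < c" "\<And>u. e \<bullet> \<iota> u = c * u $ i0"
proof -
  obtain f :: "real^'k \<Rightarrow> real^'n" and g where fg: "linear f" "linear g" "f ` UNIV = L" "g ` L = UNIV"
    "\<And>x. x \<in> UNIV \<Longrightarrow> norm (f x) = norm x" "\<And>x. x \<in> L \<Longrightarrow> norm (g x) = norm x"
    "\<And>x. x \<in> UNIV \<Longrightarrow> g (f x) = x" "\<And>x. x \<in> L \<Longrightarrow> f (g x) = x"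
    by (rule isometries_subspaces[of "UNIV :: (real^'k) set" L]) (use L in \<open>auto simp: dim_UNIV\<close>)
  define v where "v = g e"
  have nv: "norm v = norm e" "f v = e" using fg(6,8) e(1) by (auto simp: v_def)
  have "norm (axis i0 (norm v)) = norm v" by (simp add: norm_eq_sqrt_inner[of "axis i0 _"] inner_axis_axis)
  then obtain T where T: "orthogonal_transformation T" "T (axis i0 (norm v)) = v"
    using orthogonal_transformation_exists by blast
  have linT: "linear T" using T(1) orthogonal_transformation_linear by blast
  obtain T' where T': "linear T'" "\<And>u. T' (T u) = u"
    using linear_injective_left_inverse[OF linT orthogonal_transformation_inj[OF T(1)]] by (metis comp_apply id_apply)
  have lin: "linear (\<lambda>u. f (T u))" using linear_compose[OF linT fg(1)] by (simp add: o_def)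
  have nrm: "norm (f (T u)) = norm u" for u using fg(5) T(1) by (simp add: orthogonal_transformation_norm)
  \<comment> \<open>Polarisation: a linear map that preserves norms preserves inner
    products.\<close>
  have inn: "f (T u) \<bullet> f (T w) = u \<bullet> w" for u w
  proof -
    have "(norm (f (T (u + w))))\<^sup>2 = (norm (u + w))\<^sup>2" by (simp only: nrm)
    moreover have "f (T (u + w)) = f (T u) + f (T w)" using linear_add[OF lin] .
    ultimately have "(norm (f (T u)))\<^sup>2 + 2 * (f (T u) \<bullet> f (T w)) + (norm (f (T w)))\<^sup>2 =
      (norm u)\<^sup>2 + 2 * (u \<bullet> w) + (norm w)\<^sup>2"
      by (simp add: power2_norm_eq_inner inner_add_left inner_add_right inner_commute)
    then show ?thesis by (simp add: nrm)
  qed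
  show thesis
  proof (rule that[of "\<lambda>u. f (T u)" "\<lambda>x. T' (g x)" "norm v"])
    show "linear (\<lambda>x. T' (g x))" using linear_compose[OF fg(2) T'(1)] by (simp add: o_def)
    show "range (\<lambda>u. f (T u)) = L"
      using orthogonal_transformation_surj[OF T(1)] fg(3) by (metis image_image)
    show "0 < norm v" using nv e(2) by simp
    show "e \<bullet> f (T u) = norm v * u $ i0" for u
      using inn[of "axis i0 (norm v)" u] T(2) nv(2) by (simp add: inner_axis' )
  qed (use lin T' fg(7) in auto)
qed

lemma dim_subspace_exists_nonzero:
  fixes L :: "'a::euclidean_space set"
  assumes "0 < dim L" obtains e where "e \<in> L" "e \<noteq> 0"
  using assms by (metis dim_eq_0 less_irrefl singleton_iff subsetI)

lemma collar_chart_exists: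
  fixes K :: "(real^'n) set" and i0 :: "'k::finite"
  assumes sub: "submanifold_with_boundary CARD('k) K \<gamma>" and p: "p \<in> K"
  shows "\<exists>W U f \<kappa>. p \<in> W \<and> collar_chart i0 K \<gamma> W U f \<kappa>"
proof (cases "p \<in> \<gamma>")
  case True
  then obtain W \<phi> L e where W: "p \<in> W" "C1_diffeo_on \<phi> W" "subspace L" "dim L = CARD('k)" "e \<in> L" "e \<noteq> 0"
    "\<phi> ` (K \<inter> W) = \<phi> ` W \<inter> {y \<in> L. 0 \<le> e \<bullet> y}" "\<phi> ` (\<gamma> \<inter> W) = \<phi> ` W \<inter> {y \<in> L. e \<bullet> y = 0}"
    using sub unfolding submanifold_with_boundary_def by meson
  obtain \<iota> :: "real^'k \<Rightarrow> real^'n" and \<nu> c where \<iota>: "linear \<iota>" "linear \<nu>" "\<And>u. \<nu> (\<iota> u) = u" "range \<iota> = L"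
    "0 < c" "\<And>u. e \<bullet> \<iota> u = c * u $ i0"
    using linear_coordinates_subspace[OF W(3-6)] by metis
  note sp = slice_parametrisation[OF W(2) \<iota>(1-4), where a=0]
  let ?f = "\<lambda>u. inv_into W \<phi> (\<iota> (u - 0))" and ?U = "{u. \<iota> (u - 0) \<in> \<phi> ` W}" and ?\<kappa> = "\<lambda>x. \<nu> (\<phi> x) + 0"
  have oW: "open W" "inj_on \<phi> W" "C1_on \<phi> W" using W(2) unfolding C1_diffeo_on_def by auto
  have fUW: "?f ` ?U \<subseteq> W" using sp(4) by blast
  have ephi: "e \<bullet> \<phi> (?f u) = c * u $ i0" if "u \<in> ?U" for u using sp(5)[OF that] \<iota>(6) by simp
  \<comment> \<open>Stated for a set \<open>A\<close> and a predicate \<open>Q\<close> so that it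
    covers both the half-space of \<open>K\<close> and the hyperplane of \<gamma>.\<close>
  have mem: "x \<in> A \<longleftrightarrow> \<phi> x \<in> L \<and> Q (e \<bullet> \<phi> x)" if "x \<in> W" "\<phi> ` (A \<inter> W) = \<phi> ` W \<inter> {y \<in> L. Q (e \<bullet> y)}" for A x Q
  proof -
    have "x \<in> A \<longleftrightarrow> \<phi> x \<in> \<phi> ` (A \<inter> W)" using that(1) oW(2) by (auto dest: inj_onD)
    then show ?thesis unfolding that(2) using that(1) by auto
  qed
  have img: "A \<inter> W = ?f ` {u \<in> ?U. Q (c * u $ i0)}" if A: "\<phi> ` (A \<inter> W) = \<phi> ` W \<inter> {y \<in> L. Q (e \<bullet> y)}" for A Q
  proof (intro equalityI subsetI)
    fix x assume x: "x \<in> A \<inter> W"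
    then have "\<phi> x \<in> L" "Q (e \<bullet> \<phi> x)" using mem[OF _ A, of x] by auto
    moreover from this have "?\<kappa> x \<in> ?U \<and> ?f (?\<kappa> x) = x" using sp(7) x by blast
    moreover from this have "e \<bullet> \<phi> x = c * ?\<kappa> x $ i0" using ephi[of "?\<kappa> x"] by simp
    ultimately show "x \<in> ?f ` {u \<in> ?U. Q (c * u $ i0)}"
      by (intro image_eqI[of _ _ "?\<kappa> x"]) auto
  next
    fix x assume "x \<in> ?f ` {u \<in> ?U. Q (c * u $ i0)}"
    then obtain u where u: "u \<in> ?U" "Q (c * u $ i0)" "x = ?f u" by blast
    then have "x \<in> W" "\<phi> x \<in> L" "Q (e \<bullet> \<phi> x)" using sp(4) ephi[OF u(1)] by auto
    then show "x \<in> A \<inter> W" using mem[OF _ A] by blast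
  qed
  have "collar_chart i0 K \<gamma> W ?U ?f ?\<kappa>"
    unfolding collar_chart_def
  proof (intro conjI ballI)
    show "closedin (top_of_set W) (?f ` ?U)"
      unfolding sp(4) using continuous_closedin_preimage[OF C1_on_continuous[OF oW(3)] closed_subspace[OF W(3)]]
      by (simp add: vimage_def Int_def)
    show "K \<inter> W = ?f ` {u \<in> ?U. 0 \<le> u $ i0}" using img[OF W(7)] \<iota>(5) by (simp add: zero_le_mult_iff)
    show "\<gamma> \<inter> W = ?f ` {u \<in> ?U. u $ i0 = 0}" using img[OF W(8)] \<iota>(5) by simp
  qed (fact oW(1), fact sp(1), fact sp(2), erule sp(3), fact fUW)
  with W(1) show ?thesis by blast
next
  case False
  then obtain W \<phi> L where W: "p \<in> W" "C1_diffeo_on \<phi> W" "subspace L" "dim L = CARD('k)"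
    "W \<inter> \<gamma> = {}" "\<phi> ` (K \<inter> W) = \<phi> ` W \<inter> L"
    using sub p unfolding submanifold_with_boundary_def by (meson DiffI)
  obtain e where e: "e \<in> L" "e \<noteq> 0" using dim_subspace_exists_nonzero[of L] W(4) by auto
  obtain \<iota> :: "real^'k \<Rightarrow> real^'n" and \<nu> c where \<iota>: "linear \<iota>" "linear \<nu>" "\<And>u. \<nu> (\<iota> u) = u" "range \<iota> = L"
    "0 < c" "\<And>u. e \<bullet> \<iota> u = c * u $ i0"
    using linear_coordinates_subspace[OF W(3,4) e] by metis
  \<comment> \<open>The translation gives \<open>p\<close> the coordinate 1 in direction
    \<open>i0\<close>; the chart is then cut down to the region where that coordinate is
    positive.\<close>
  define a where "a = axis i0 1 - \<nu> (\<phi> p)"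
  note sp = slice_parametrisation[OF W(2) \<iota>(1-4), where a=a]
  define f where "f = (\<lambda>u. inv_into W \<phi> (\<iota> (u - a)))"
  define U where "U = {u. \<iota> (u - a) \<in> \<phi> ` W}"
  define \<kappa> where "\<kappa> = (\<lambda>x. \<nu> (\<phi> x) + a)"
  have sp': "C1_parametrisation f U" "C1_on \<kappa> W" "f ` U = {x \<in> W. \<phi> x \<in> L}" "open U"
    unfolding f_def U_def \<kappa>_def by (fact sp(1,2,4,6))+
  have \<kappa>f: "\<kappa> (f u) = u" if "u \<in> U" for u using sp(3)[of u] that by (simp only: f_def U_def \<kappa>_def)
  have f\<kappa>: "\<kappa> x \<in> U \<and> f (\<kappa> x) = x" if "x \<in> W" "\<phi> x \<in> L" for x
    using sp(7)[OF that] by (simp only: f_def U_def \<kappa>_def)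
  have oW: "open W" "inj_on \<phi> W" "C1_on \<phi> W" using W(2) unfolding C1_diffeo_on_def by auto
  define W' where "W' = {x \<in> W. 0 < \<kappa> x $ i0}"
  define U' where "U' = {u \<in> U. 0 < u $ i0}"
  have oW': "open W'"
  proof -
    have "continuous_on W (\<lambda>x. \<kappa> x $ i0)" by (intro continuous_on_component C1_on_continuous[OF sp'(2)])
    from continuous_open_preimage[OF this oW(1) open_greaterThan[of 0]] show ?thesis
      by (simp add: W'_def vimage_def Int_def)
  qed
  have oU': "open U'"
  proof -
    have "continuous_on U (\<lambda>u. u $ i0)" by (intro continuous_intros)
    from continuous_open_preimage[OF this sp'(4) open_greaterThan[of 0]] show ?thesis
      by (simp add: U'_def vimage_def Int_def)
  qed
  have im: "f ` U' = {x \<in> W'. \<phi> x \<in> L}"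
  proof (intro equalityI subsetI)
    fix x assume "x \<in> f ` U'"
    then obtain u where u: "u \<in> U" "0 < u $ i0" "x = f u" by (auto simp: U'_def)
    then show "x \<in> {x \<in> W'. \<phi> x \<in> L}" using sp'(3) \<kappa>f[OF u(1)] by (auto simp: W'_def)
  next
    fix x assume "x \<in> {x \<in> W'. \<phi> x \<in> L}"
    then have "\<kappa> x \<in> U \<and> f (\<kappa> x) = x" "0 < \<kappa> x $ i0" using f\<kappa>[of x] by (auto simp: W'_def)
    then show "x \<in> f ` U'" by (intro image_eqI[of _ _ "\<kappa> x"]) (auto simp: U'_def)
  qed
  have mem: "x \<in> K \<longleftrightarrow> \<phi> x \<in> L" if "x \<in> W" for x
  proof -
    have "x \<in> K \<longleftrightarrow> \<phi> x \<in> \<phi> ` (K \<inter> W)" using that oW(2) by (auto dest: inj_onD)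
    then show ?thesis unfolding W(6) using that by auto
  qed
  have "collar_chart i0 K \<gamma> W' U' f \<kappa>"
    unfolding collar_chart_def
  proof (intro conjI ballI)
    show "C1_parametrisation f U'" by (rule param_subset[OF sp'(1) _ oU']) (auto simp: U'_def)
    show "C1_on \<kappa> W'" by (rule C1_on_subset[OF sp'(2)]) (auto simp: W'_def)
    show "\<kappa> (f u) = u" if "u \<in> U'" for u using that \<kappa>f by (simp add: U'_def)
    show "f ` U' \<subseteq> W'" using im by blast
    have "continuous_on W' \<phi>" by (rule continuous_on_subset[OF C1_on_continuous[OF oW(3)]]) (auto simp: W'_def)
    from continuous_closedin_preimage[OF this closed_subspace[OF W(3)]]
    show "closedin (top_of_set W') (f ` U')" unfolding im by (simp add: vimage_def Int_def)
    have "{u \<in> U'. 0 \<le> u $ i0} = U'" by (auto simp: U'_def)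
    then show "K \<inter> W' = f ` {u \<in> U'. 0 \<le> u $ i0}"
      using im mem by (auto simp: W'_def)
    have "{u \<in> U'. u $ i0 = 0} = {}" by (auto simp: U'_def)
    moreover have "\<gamma> \<inter> W' = {}" using W(5) by (auto simp: W'_def)
    ultimately show "\<gamma> \<inter> W' = f ` {u \<in> U'. u $ i0 = 0}" by simp
  qed (fact oW')
  moreover have "p \<in> W'" using W(1) by (simp add: W'_def \<kappa>_def a_def)
  ultimately show ?thesis by blast
qed

lemma C1_on_differentiable: "C1_on f U \<Longrightarrow> x \<in> U \<Longrightarrow> f differentiable (at x)"
  by (rule differentiableI[OF C1_on_has_derivative])

lemma collar_chart_interior:
  assumes c: "collar_chart i0 (M \<union> \<gamma>) \<gamma> W U f \<kappa>" and d: "M \<inter> \<gamma> = {}"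
  shows "pchart M f {u \<in> U. 0 < u $ i0} W \<kappa>"
proof -
  have c': "open W" "C1_parametrisation f U" "C1_on \<kappa> W" "\<And>u. u \<in> U \<Longrightarrow> \<kappa> (f u) = u" "f ` U \<subseteq> W"
    "(M \<union> \<gamma>) \<inter> W = f ` {u \<in> U. 0 \<le> u $ i0}" "\<gamma> \<inter> W = f ` {u \<in> U. u $ i0 = 0}"
    using c unfolding collar_chart_def by auto
  have "open {u \<in> U. 0 < u $ i0}"
  proof -
    have "continuous_on U (\<lambda>u. u $ i0)" by (intro continuous_intros)
    from continuous_open_preimage[OF this param_open[OF c'(2)] open_greaterThan[of 0]] show ?thesis
      by (simp add: vimage_def Int_def)
  qed
  then have p: "C1_parametrisation f {u \<in> U. 0 < u $ i0}" by (intro param_subset[OF c'(2)]) auto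
  have im: "f ` {u \<in> U. 0 < u $ i0} = M \<inter> W"
  proof (intro equalityI subsetI)
    fix x assume "x \<in> f ` {u \<in> U. 0 < u $ i0}"
    then obtain u where u: "u \<in> U" "0 < u $ i0" "x = f u" by auto
    have "f u \<in> (M \<union> \<gamma>) \<inter> W" unfolding c'(6) using u by auto
    moreover have "f u \<notin> \<gamma>"
    proof
      assume "f u \<in> \<gamma>"
      then have "f u \<in> f ` {u \<in> U. u $ i0 = 0}" unfolding c'(7)[symmetric] using c'(5) u(1) by auto
      then obtain w where "w \<in> U" "w $ i0 = 0" "f u = f w" by auto
      then have "u = w" using c'(4) u(1) by metis
      then show False using u(2) \<open>w $ i0 = 0\<close> by simp
    qed
    ultimately show "x \<in> M \<inter> W" using u(3) by auto
  next
    fix x assume x: "x \<in> M \<inter> W"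
    then have "x \<in> f ` {u \<in> U. 0 \<le> u $ i0}" unfolding c'(6)[symmetric] by auto
    then obtain u where u: "u \<in> U" "0 \<le> u $ i0" "x = f u" by auto
    have "u $ i0 \<noteq> 0"
    proof
      assume "u $ i0 = 0"
      then have "x \<in> \<gamma> \<inter> W" unfolding c'(7) using u by auto
      then show False using x d by blast
    qed
    then show "x \<in> f ` {u \<in> U. 0 < u $ i0}" using u by auto
  qed
  show ?thesis unfolding pchart_def
    using c'(1,4) p im C1_on_differentiable[OF c'(3)] by auto
qed

text \<open>At a boundary point the coordinate \<open>i0\<close> of the transition map would have a
  minimum, so this component of its derivative would vanish, whereas the transition to the surface
  continued across \<gamma> has an invertible derivative.\<close>

lemma param_avoids_boundary:
  fixes g :: "real^'k \<Rightarrow> real^'n"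
  assumes sub: "submanifold_with_boundary CARD('k) K \<gamma>" and g: "C1_parametrisation g V" "g ` V \<subseteq> K"
  shows "g ` V \<inter> \<gamma> = {}"
proof (rule ccontr)
  assume "g ` V \<inter> \<gamma> \<noteq> {}"
  then obtain v where v: "v \<in> V" "g v \<in> \<gamma>" by auto
  define i0 :: 'k where "i0 = undefined"
  obtain W U f \<kappa> where W: "g v \<in> W" "collar_chart i0 K \<gamma> W U f \<kappa>"
    using collar_chart_exists[OF sub, of "g v" i0] g(2) v(1) by blast
  have c': "open W" "C1_parametrisation f U" "C1_on \<kappa> W" "\<And>u. u \<in> U \<Longrightarrow> \<kappa> (f u) = u" "f ` U \<subseteq> W"
    "K \<inter> W = f ` {u \<in> U. 0 \<le> u $ i0}" "\<gamma> \<inter> W = f ` {u \<in> U. u $ i0 = 0}"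
    using W(2) unfolding collar_chart_def by auto
  define V' where "V' = {w \<in> V. g w \<in> W}"
  have oV': "open V'" unfolding V'_def
    using continuous_open_preimage[OF param_continuous[OF g(1)] param_open[OF g(1)] c'(1)]
    by (simp add: vimage_def Int_def)
  \<comment> \<open>The continued surface, and not \<open>K\<close>, takes the role of the
    submanifold, since it has a chart around boundary points.\<close>
  have p: "pchart (f ` U) f U W \<kappa>"
    unfolding pchart_def using c'(1,2,4,5) C1_on_differentiable[OF c'(3)] by auto
  have g': "C1_parametrisation g V'" by (rule param_subset[OF g(1) _ oV']) (auto simp: V'_def)
  have gK: "g w \<in> f ` {u \<in> U. 0 \<le> u $ i0}" if "w \<in> V'" for w
    unfolding c'(6)[symmetric] using that g(2) by (auto simp: V'_def)
  then have gf: "g ` V' \<subseteq> f ` U" by blast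
  have vV': "v \<in> V'" using v W(1) by (simp add: V'_def)
  let ?t = "\<lambda>v. \<kappa> (g v)"
  note tr = transition[OF p g' gf vV' W(1)]
  have T: "(\<lambda>w. fd ?t v w $ i0) = (\<lambda>h. 0)"
  proof (rule has_derivative_local_min)
    show "((\<lambda>v. ?t v $ i0) has_derivative (\<lambda>w. fd ?t v w $ i0)) (at v)"
      using has_derivative_compose[OF tr(3) bounded_linear_imp_has_derivative[OF bounded_linear_vec_nth]] .
    have "?t v $ i0 = 0"
    proof -
      have "g v \<in> f ` {u \<in> U. u $ i0 = 0}" unfolding c'(7)[symmetric] using v(2) W(1) by simp
      then show ?thesis using c'(4) by auto
    qed
    moreover have "0 \<le> ?t w $ i0" if "w \<in> V'" for w using gK[OF that] c'(4) by auto
    ultimately show "\<forall>\<^sub>F w in at v. ?t v $ i0 \<le> ?t w $ i0"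
      unfolding eventually_at_topological using oV' vV' by (intro exI[of _ V']) auto
  qed
  have "det (matrix (fd ?t v)) \<noteq> 0"
    using tr(4) param_gden_pos[OF g' vV'] by auto
  then obtain B where "matrix (fd ?t v) ** B = mat 1" unfolding invertible_det_nz[symmetric] invertible_def by blast
  then have "matrix (fd ?t v) *v (B *v axis i0 1) = axis i0 1" by (simp add: matrix_vector_mul_assoc)
  moreover have "matrix (fd ?t v) *v w = fd ?t v w" for w
    using jac_works[OF tr(3)] by (simp add: jac_def)
  ultimately have "fd ?t v (B *v axis i0 1) = axis i0 1" by simp
  then have "fd ?t v (B *v axis i0 1) $ i0 = 1" by simp
  then show False using fun_cong[OF T, of "B *v axis i0 1"] by simp
qed

section \<open>The Jacobian of the cone compared with the boundary flux\<close>

definition drop_coord :: "'k::finite \<Rightarrow> real^'k \<Rightarrow> real^'k" where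
  "drop_coord i0 u = (\<chi> i. if i = i0 then 0 else u $ i)"

lemma drop_coord_nth [simp]: "drop_coord i0 u $ i = (if i = i0 then 0 else u $ i)"
  by (simp add: drop_coord_def)

lemma bounded_linear_drop_coord: "bounded_linear (drop_coord i0)"
  by (rule linear_conv_bounded_linear[THEN iffD1])
     (auto intro!: linearI simp: drop_coord_def vec_eq_iff)

text \<open>The Gram matrix of \<open>cone_map i0 f\<close> is, up to scaling, a \<open>block\<close>: the direction \<open>i0\<close> is radial, hence
  orthogonal to the others because the boundary lies in a sphere.\<close>

definition block :: "'k::finite \<Rightarrow> real \<Rightarrow> real^'k^'k \<Rightarrow> real^'k^'k" where
  "block i0 c G = (\<chi> i j. if i = i0 then (if j = i0 then c else 0) else if j = i0 then 0 else G $ i $ j)"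

lemma det_block: "det (block i0 c G) = c * det (block i0 1 G)"
proof -
  have e: "block i0 c G = (\<chi> i. if i = i0 then c *s axis i0 1 else (\<chi> j. if j = i0 then 0 else G $ i $ j))" for c
    by (auto simp: block_def vec_eq_iff axis_def)
  have "block i0 1 G = (\<chi> i. if i = i0 then axis i0 1 else (\<chi> j. if j = i0 then 0 else G $ i $ j))"
    using e[of 1] by (simp add: vec_eq_iff)
  then show ?thesis unfolding e[of c] by (simp add: det_row_mul)
qed

text \<open>Cramer's rule twice: replacing column \<open>i0\<close> of \<open>G\<close> by
  \<open>G *v \<beta>\<close>, and then row \<open>i0\<close> by the same combination of rows,
  multiplies the determinant by \<open>\<beta> $ i0\<close> each time and clears the rest of that
  row and column.\<close>

lemma det_block_solution:
  assumes sym: "\<And>i j. G $ i $ j = G $ j $ i" and s: "G *v \<beta> = axis i0 a"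
  shows "det (block i0 (a * \<beta> $ i0) G) = (\<beta> $ i0)\<^sup>2 * det G"
proof -
  define Y where "Y = (\<chi> i j. if j = i0 then (G *v \<beta>) $ i else G $ i $ j)"
  have Y: "det Y = \<beta> $ i0 * det G" unfolding Y_def by (rule cramer_lemma)
  have row: "(\<Sum>i\<in>UNIV. \<beta> $ i *s row i Y) $ j = (if j = i0 then a * \<beta> $ i0 else 0)" for j
  proof (cases "j = i0")
    case True
    have "(\<Sum>i\<in>UNIV. \<beta> $ i *s row i Y) $ j = (\<Sum>i\<in>UNIV. \<beta> $ i * (if i = i0 then a else 0))"
      using True by (simp add: row_def Y_def s axis_def)
    also have "\<dots> = \<beta> $ i0 * a" by (subst sum.remove[of _ i0]) (auto intro!: sum.neutral)
    finally show ?thesis using True by simp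
  next
    case False
    have "(\<Sum>i\<in>UNIV. \<beta> $ i *s row i Y) $ j = (\<Sum>i\<in>UNIV. G $ j $ i * \<beta> $ i)"
      using False by (simp add: row_def Y_def sym[of _ j] mult.commute)
    also have "\<dots> = (G *v \<beta>) $ j" by (simp add: matrix_vector_mult_def)
    finally show ?thesis using False by (simp add: s axis_def)
  qed
  have "block i0 (a * \<beta> $ i0) G = (\<chi> i. if i = i0 then (\<Sum>i\<in>UNIV. \<beta> $ i *s row i Y) else row i Y)"
  proof -
    have "block i0 (a * \<beta> $ i0) G $ i $ j = (\<chi> i. if i = i0 then (\<Sum>i\<in>UNIV. \<beta> $ i *s row i Y) else row i Y) $ i $ j" for i j
    proof (cases "i = i0")
      case True
      then show ?thesis using row[of j] by (simp add: block_def)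
    next
      case False
      then show ?thesis by (simp add: block_def row_def Y_def s axis_def)
    qed
    then show ?thesis by (simp add: vec_eq_iff)
  qed
  then show ?thesis using cramer_lemma_transpose[of i0 \<beta> Y] Y by (simp add: power2_eq_square)
qed

text \<open>Only values \<open>1 < u $ i0 < 2\<close> are of interest, where \<open>step\<close> runs through \<open>(0, 1)\<close>.\<close>

definition cone_map :: "'k::finite \<Rightarrow> (real^'k \<Rightarrow> real^'n) \<Rightarrow> real^'k \<Rightarrow> real^'n" where
  "cone_map i0 f u = step (u $ i0) *\<^sub>R f (drop_coord i0 u)"

lemma cone_map_has_derivative:
  assumes f: "C1_parametrisation f U" and u: "drop_coord i0 u \<in> U"
  shows "(cone_map i0 f has_derivative (\<lambda>v. step (u $ i0) *\<^sub>R fd f (drop_coord i0 u) (drop_coord i0 v) +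
      (step' (u $ i0) * v $ i0) *\<^sub>R f (drop_coord i0 u))) (at u)"
proof -
  have s: "((\<lambda>u. step (u $ i0)) has_derivative (\<lambda>v. step' (u $ i0) * v $ i0)) (at u)"
  proof -
    have "(step has_derivative (*) (step' (u $ i0))) (at (u $ i0))"
      using step_DERIV by (simp add: has_field_derivative_def)
    from has_derivative_compose[OF bounded_linear_imp_has_derivative[OF bounded_linear_vec_nth] this]
    show ?thesis .
  qed
  have d: "((\<lambda>u. f (drop_coord i0 u)) has_derivative (\<lambda>v. fd f (drop_coord i0 u) (drop_coord i0 v))) (at u)"
    using has_derivative_compose[OF bounded_linear_imp_has_derivative[OF bounded_linear_drop_coord] param_has_derivative[OF f u]] .
  show ?thesis unfolding cone_map_def[abs_def] by (rule has_derivative_scaleR[OF s d])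
qed

text \<open>Column \<open>i0\<close> of the Jacobian is \<open>step'\<close> times the position, the
  others are \<open>step\<close> times those of \<open>f\<close>; a diagonal matrix on either side
  of the block collects these factors.\<close>

lemma gden_cone_map:
  fixes f :: "real^'k \<Rightarrow> real^'n"
  assumes f: "C1_parametrisation f U" and u: "drop_coord i0 u \<in> U"
    and orth: "\<And>i. i \<noteq> i0 \<Longrightarrow> f (drop_coord i0 u) \<bullet> fd f (drop_coord i0 u) (axis i 1) = 0"
  shows "gden (cone_map i0 f) u = \<bar>step' (u $ i0) * step (u $ i0) ^ (CARD('k) - 1)\<bar> *
    sqrt (det (block i0 ((norm (f (drop_coord i0 u)))\<^sup>2) (gram f (drop_coord i0 u))))"
proof -
  let ?y = "drop_coord i0 u"
  let ?x = "f ?y" and ?G = "gram f ?y"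
  let ?l = "step (u $ i0)" and ?l' = "step' (u $ i0)"
  define s where "s i = (if i = i0 then ?l' else ?l)" for i
  define e where "e j = (if j = i0 then ?x else fd f ?y (axis j 1))" for j
  define Dg :: "real^'k^'k" where "Dg = (\<chi> i j. if i = j then s i else 0)"
  have lin: "linear (fd f ?y)" using param_has_derivative[OF f u] has_derivative_linear by blast
  have col: "jac (cone_map i0 f) u *v axis j 1 = s j *\<^sub>R e j" for j
  proof -
    have "drop_coord i0 (axis j 1) = (if j = i0 then 0 else axis j 1)"
      by (auto simp: vec_eq_iff axis_def)
    then show ?thesis
      unfolding jac_works[OF cone_map_has_derivative[OF f u]]
      by (cases "j = i0") (simp_all add: s_def e_def linear_0[OF lin] axis_def)
  qed
  have gr: "gram g w $ i $ j = (jac g w *v axis i 1) \<bullet> (jac g w *v axis j 1)" for g :: "real^'k \<Rightarrow> real^'n" and w i j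
    by (simp add: gram_def matrix_matrix_mult_def transpose_def inner_vec_def matrix_vector_mult_basis column_def)
  have ee: "e i \<bullet> e j = block i0 ((norm ?x)\<^sup>2) ?G $ i $ j" for i j
    using orth[of i] orth[of j]
    by (auto simp: e_def block_def gr param_jac[OF f u] power2_norm_eq_inner inner_commute)
  have "gram (cone_map i0 f) u = Dg ** block i0 ((norm ?x)\<^sup>2) ?G ** Dg"
  proof -
    have "(Dg ** B ** Dg) $ i $ j = s i * (s j * B $ i $ j)" for B i j
      by (simp add: matrix_matrix_mult_def Dg_def if_distrib if_distribR sum.delta' cong: if_cong)
    then show ?thesis by (simp add: vec_eq_iff gr col ee[symmetric])
  qed
  moreover have "det Dg = ?l' * ?l ^ (CARD('k) - 1)"
  proof -
    have "det Dg = (\<Prod>i\<in>UNIV. Dg $ i $ i)" by (rule det_diagonal) (simp add: Dg_def)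
    also have "\<dots> = s i0 * (\<Prod>i\<in>UNIV - {i0}. s i)" by (simp add: Dg_def prod.remove)
    also have "(\<Prod>i\<in>UNIV - {i0}. s i) = (\<Prod>i\<in>UNIV - {i0}. ?l)" by (rule prod.cong) (auto simp: s_def)
    finally show ?thesis by (simp add: s_def card_Diff_singleton)
  qed
  ultimately have "det (gram (cone_map i0 f) u) = (?l' * ?l ^ (CARD('k) - 1))\<^sup>2 * det (block i0 ((norm ?x)\<^sup>2) ?G)"
    by (simp add: det_mul power2_eq_square)
  then show ?thesis by (simp add: gden_def real_sqrt_mult)
qed

text \<open>Up to the common factor both sides are roots of determinants of the same block matrix.
  Its corner is the squared length of the tangential part of the position on the left, and of the
  whole position on the right. This is the pointwise comparison of flux and cone volume.\<close>

lemma gden_rad_le_gden_cone_map: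
  fixes f :: "real^'k \<Rightarrow> real^'n"
  assumes f: "C1_parametrisation f U" and u: "drop_coord i0 u \<in> U"
    and orth: "\<And>i. i \<noteq> i0 \<Longrightarrow> f (drop_coord i0 u) \<bullet> fd f (drop_coord i0 u) (axis i 1) = 0"
    and pos: "0 < gden (cone_map i0 f) u"
  shows "\<bar>step' (u $ i0) * step (u $ i0) ^ (CARD('k) - 1)\<bar> * (gden f (drop_coord i0 u) * \<bar>rad f (drop_coord i0 u) $ i0\<bar>)
     \<le> gden (cone_map i0 f) u"
proof -
  let ?y = "drop_coord i0 u"
  let ?x = "f ?y" and ?G = "gram f ?y" and ?b = "rad f ?y"
  let ?a = "transpose (jac f ?y) *v ?x"
  have gc: "gden (cone_map i0 f) u = \<bar>step' (u $ i0) * step (u $ i0) ^ (CARD('k) - 1)\<bar> *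
    sqrt (det (block i0 ((norm ?x)\<^sup>2) ?G))"
    by (rule gden_cone_map[OF f u]) (rule orth)
  have a: "?a $ i = ?x \<bullet> fd f ?y (axis i 1)" for i
  proof -
    have "?a $ i = ?a \<bullet> axis i 1" by (simp add: inner_axis)
    also have "\<dots> = ?x \<bullet> (jac f ?y *v axis i 1)" by (metis dot_lmul_matrix transpose_matrix_vector)
    finally show ?thesis by (simp only: param_jac[OF f u])
  qed
  have aa: "?a = axis i0 (?a $ i0)" using orth a by (auto simp: vec_eq_iff axis_def)
  have sym: "?G $ i $ j = ?G $ j $ i" for i j
    by (simp add: gram_def matrix_matrix_mult_def transpose_def mult.commute)
  have s: "?G *v ?b = axis i0 (?a $ i0)" using param_rad[OF f u] aa by simp
  have d: "det (block i0 (?a $ i0 * ?b $ i0) ?G) = (?b $ i0)\<^sup>2 * det ?G"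
    by (rule det_block_solution[OF sym s])
  let ?q = "?a $ i0 * ?b $ i0"
  have q: "?q = (norm (tpart f ?y))\<^sup>2"
  proof -
    have "(norm (tpart f ?y))\<^sup>2 = (?G *v ?b) \<bullet> ?b"
      by (simp add: tpart_def power2_norm_eq_inner gram_def gram_mult_vec_inner)
    also have "\<dots> = ?q" unfolding s by (simp add: inner_axis')
    finally show ?thesis by simp
  qed
  have qR: "0 \<le> ?q" "?q \<le> (norm ?x)\<^sup>2" using tpart_pythagoras[OF f u] unfolding q by auto
  have dG: "0 < det ?G" by (rule param_det_gram_pos[OF f u])
  have "(?b $ i0)\<^sup>2 * det ?G \<le> (norm ?x)\<^sup>2 * det (block i0 1 ?G)"
  \<comment> \<open>A nonzero corner determines the sign of the determinant of the boundary block.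
    If the corner is zero, the left side vanishes and positivity of the cone density settles the
    right.\<close>
  proof (cases "?q = 0")
    case True
    have "det (block i0 ?q ?G) = 0" unfolding True using det_block[of i0 0 ?G] by simp
    then have "(?b $ i0)\<^sup>2 * det ?G = 0" by (simp only: d)
    moreover have "0 \<le> det (block i0 ((norm ?x)\<^sup>2) ?G)"
    proof (rule ccontr)
      assume "\<not> 0 \<le> det (block i0 ((norm ?x)\<^sup>2) ?G)"
      then have "sqrt (det (block i0 ((norm ?x)\<^sup>2) ?G)) \<le> 0" by simp
      then have "gden (cone_map i0 f) u \<le> 0"
        unfolding gc by (intro mult_nonneg_nonpos) auto
      then show False using pos by simp
    qed
    ultimately show ?thesis unfolding det_block[of i0 "(norm ?x)\<^sup>2" ?G] by linarith
  next
    case False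
    have "?q * det (block i0 1 ?G) = (?b $ i0)\<^sup>2 * det ?G" using d det_block[of i0 ?q ?G] by simp
    moreover from this have "0 \<le> det (block i0 1 ?G)"
      using False qR(1) dG by (metis less_eq_real_def mult_nonneg_nonneg zero_le_mult_iff zero_le_power2 not_le)
    ultimately show ?thesis using qR(2) by (metis mult_right_mono)
  qed
  then have "sqrt ((?b $ i0)\<^sup>2 * det ?G) \<le> sqrt (det (block i0 ((norm ?x)\<^sup>2) ?G))"
    using det_block[of i0 "(norm ?x)\<^sup>2" ?G] by simp
  then have "gden f ?y * \<bar>?b $ i0\<bar> \<le> sqrt (det (block i0 ((norm ?x)\<^sup>2) ?G))"
    by (simp add: real_sqrt_mult gden_def mult.commute)
  then show ?thesis unfolding gc by (intro mult_left_mono) auto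
qed

section \<open>Polar coordinates on the cone\<close>

definition inv_step :: "real \<Rightarrow> real" where
  "inv_step = inv_into {1..2} step"

lemma step_inj: "inj_on step {1..2}"
proof (rule inj_onI)
  fix a b :: real assume *: "a \<in> {1..2}" "b \<in> {1..2}" "step a = step b"
  then show "a = b"
    using step_strict_decreasing[of a b] step_strict_decreasing[of b a] by (cases a b rule: linorder_cases) auto
qed

lemma inv_step_step: "1 \<le> s \<Longrightarrow> s \<le> 2 \<Longrightarrow> inv_step (step s) = s"
  unfolding inv_step_def by (rule inv_into_f_f[OF step_inj]) simp

lemma step_surj:
  assumes "0 < y" "y < 1" obtains s where "1 < s" "s < 2" "step s = y"
proof -
  have "step 1 = 1" "step 2 = 0" by (simp_all add: step_def)
  then obtain s where s: "1 \<le> s" "s \<le> 2" "step s = y"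
    using IVT2'[of step 2 y 1] assms C1_on_continuous[OF C1_on_step] by auto
  moreover have "s \<noteq> 1" "s \<noteq> 2" using s assms by (auto simp: step_def)
  ultimately show thesis using that[of s] by simp
qed

text \<open>The slope of \<open>step\<close> vanishes at the ends of its transition interval but not
  inside, hence the open range of values.\<close>

lemma inv_step_differentiable:
  assumes "0 < y" "y < 1" shows "inv_step differentiable (at y)"
proof -
  obtain s where s: "1 < s" "s < 2" "step s = y" using step_surj[OF assms] by blast
  have "isCont inv_step (step s)"
    by (rule isCont_inverse_function2[of 1 s 2]) (use s inv_step_step DERIV_isCont[OF step_DERIV] in auto)
  moreover have "step (inv_step z) = z" if "0 < z" "z < 1" for z
    using step_surj[OF that] inv_step_step by (metis less_imp_le)
  ultimately have "DERIV inv_step y :> inverse (step' s)"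
    using s step'_neg[OF s(1,2)] inv_step_step[of s] assms
    by (intro DERIV_inverse_function[where f=step and a=0 and b=1]) (use step_DERIV[of s] in auto)
  then show ?thesis unfolding has_field_derivative_def by (rule differentiableI)
qed

text \<open>Polar coordinates: the norm of a point gives the coordinate \<open>i0\<close> through
  \<open>inv_step\<close>, and its projection to the sphere of radius \<open>R\<close> gives the
  boundary point. The vertex and \<gamma> itself stay outside the chart.\<close>

lemma cone_chart:
  fixes f :: "real^'k \<Rightarrow> real^'n"
  assumes c: "collar_chart i0 K \<gamma> W U f \<kappa>" and R: "0 < R" "\<gamma> \<subseteq> sphere 0 R"
  shows "pchart (radial_cone \<gamma>) (cone_map i0 f) {u. 1 < u $ i0 \<and> u $ i0 < 2 \<and> drop_coord i0 u \<in> U}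
    {x. x \<noteq> 0 \<and> norm x < R \<and> (R / norm x) *\<^sub>R x \<in> W}
    (\<lambda>x. \<kappa> ((R / norm x) *\<^sub>R x) + axis i0 (inv_step (norm x / R)))"
    (is "pchart _ _ ?V ?W ?\<kappa>")
proof -
  have c': "open W" "C1_parametrisation f U" "C1_on \<kappa> W" "\<And>u. u \<in> U \<Longrightarrow> \<kappa> (f u) = u" "f ` U \<subseteq> W"
    "\<gamma> \<inter> W = f ` {u \<in> U. u $ i0 = 0}"
    using c unfolding collar_chart_def by auto
  let ?r = "\<lambda>x::real^'n. (R / norm x) *\<^sub>R x"
  have f\<gamma>: "f u \<in> \<gamma>" "norm (f u) = R" if "u \<in> U" "u $ i0 = 0" for u
  proof -
    show "f u \<in> \<gamma>" using that c'(6) by blast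
    then show "norm (f u) = R" using R(2) by auto
  qed
  have oW: "open ?W"
  proof -
    have "continuous_on (- {0}) ?r" by (intro continuous_intros) auto
    from continuous_open_preimage[OF this open_Compl[OF closed_singleton] c'(1)]
    have "open ((- {0} \<inter> ?r -` W) \<inter> ball 0 R)" by (rule open_Int[OF _ open_ball])
    moreover have "(- {0} \<inter> ?r -` W) \<inter> ball 0 R = ?W" by auto
    ultimately show ?thesis by simp
  qed
  have oV: "open ?V"
  proof -
    have "continuous_on UNIV (drop_coord i0)" by (rule linear_continuous_on[OF bounded_linear_drop_coord])
    then have "open (drop_coord i0 -` U)" by (rule open_vimage[OF param_open[OF c'(2)]])
    moreover have "open {u::real^'k. 1 < u $ i0}" "open {u::real^'k. u $ i0 < 2}"
      by (intro open_Collect_less continuous_intros)+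
    ultimately have "open ({u. 1 < u $ i0} \<inter> {u. u $ i0 < 2} \<inter> drop_coord i0 -` U)" by (intro open_Int)
    moreover have "{u. 1 < u $ i0} \<inter> {u. u $ i0 < 2} \<inter> drop_coord i0 -` U = ?V" by auto
    ultimately show ?thesis by simp
  qed
  have val: "norm (cone_map i0 f u) = step (u $ i0) * R" "?r (cone_map i0 f u) = f (drop_coord i0 u)"
    "0 < step (u $ i0)" "step (u $ i0) < 1" "cone_map i0 f u \<in> ?W" if u: "u \<in> ?V" for u
  proof -
    show sp: "0 < step (u $ i0)" using u by (intro step_pos) auto
    have s1: "step 1 = 1" by (simp add: step_def)
    show sl: "step (u $ i0) < 1" using step_strict_decreasing[of 1 "u $ i0"] u s1 by auto
    have nf: "norm (f (drop_coord i0 u)) = R" using u by (intro f\<gamma>) auto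
    show n: "norm (cone_map i0 f u) = step (u $ i0) * R" using sp by (simp add: cone_map_def nf)
    show rr: "?r (cone_map i0 f u) = f (drop_coord i0 u)"
      unfolding n using sp R(1) by (simp add: cone_map_def)
    have "f (drop_coord i0 u) \<in> W" using u c'(5) by auto
    moreover have "norm (cone_map i0 f u) \<noteq> 0" using n sp R(1) by simp
    moreover have "norm (cone_map i0 f u) < R" using n sl R(1) by simp
    ultimately show "cone_map i0 f u \<in> ?W" using rr by auto
  qed
  have inv: "?\<kappa> (cone_map i0 f u) = u" if u: "u \<in> ?V" for u
  proof -
    have "\<kappa> (?r (cone_map i0 f u)) = drop_coord i0 u" unfolding val(2)[OF u] using u c'(4) by simp
    moreover have "inv_step (norm (cone_map i0 f u) / R) = u $ i0"
      unfolding val(1)[OF u] using u R(1) inv_step_step[of "u $ i0"] by simp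
    ultimately show ?thesis by (simp add: vec_eq_iff axis_def)
  qed
  have diff: "?\<kappa> differentiable (at x)" if x: "x \<in> ?W" for x
  proof -
    have n: "(\<lambda>x::real^'n. norm x) differentiable (at x)" using x by simp
    have "(\<lambda>x::real^'n. R / norm x) differentiable (at x)"
      using x n by (intro differentiable_divide) auto
    then have r: "?r differentiable (at x)" by (intro differentiable_scaleR) auto
    have "\<kappa> differentiable (at (?r x))"
      by (rule C1_on_differentiable[OF c'(3)]) (use x in simp)
    from differentiable_chain_at[OF r this] have 1: "(\<lambda>x. \<kappa> (?r x)) differentiable (at x)" by (simp add: o_def)
    have nR: "(\<lambda>x::real^'n. norm x / R) differentiable (at x)"
      using n R(1) by (intro differentiable_divide) auto
    have "inv_step differentiable (at (norm x / R))" using x R(1) by (intro inv_step_differentiable) auto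
    from differentiable_chain_at[OF nR this] have 2: "(\<lambda>x. inv_step (norm x / R)) differentiable (at x)" by (simp add: o_def)
    have "(\<lambda>x. inv_step (norm x / R) *\<^sub>R (axis i0 1 :: real^'k)) differentiable (at x)"
      by (rule differentiable_scaleR[OF 2 differentiable_const])
    moreover have "s *\<^sub>R (axis i0 1 :: real^'k) = axis i0 s" for s by (auto simp: vec_eq_iff axis_def)
    ultimately show ?thesis using 1 by (intro differentiable_add) simp_all
  qed
  have C1: "C1_on (cone_map i0 f) ?V"
  proof -
    have "C1_on (\<lambda>u::real^'k. step (u $ i0)) ?V"
      by (rule C1_on_compose[OF C1_on_bounded_linear[OF bounded_linear_vec_nth] C1_on_step[of UNIV]]) simp
    moreover have "C1_on (\<lambda>u. f (drop_coord i0 u)) ?V"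
      by (rule C1_on_compose[OF C1_on_bounded_linear[OF bounded_linear_drop_coord] param_C1[OF c'(2)]]) auto
    ultimately show ?thesis unfolding cone_map_def[abs_def] by (rule C1_on_scaleR)
  qed
  have par: "C1_parametrisation (cone_map i0 f) ?V"
    by (rule C1_parametrisationI[OF C1 oV diff[OF val(5)] inv])
  have im: "cone_map i0 f ` ?V = radial_cone \<gamma> \<inter> ?W"
  proof (intro equalityI subsetI)
    fix x assume "x \<in> cone_map i0 f ` ?V"
    then obtain u where u: "u \<in> ?V" "x = cone_map i0 f u" by blast
    have "f (drop_coord i0 u) \<in> \<gamma>" using u by (intro f\<gamma>) auto
    moreover have "x \<in> closed_segment 0 (f (drop_coord i0 u))"
      unfolding in_segment u(2) cone_map_def
      by (intro exI[of _ "step (u $ i0)"]) (simp add: step_bounds)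
    ultimately have "x \<in> radial_cone \<gamma>" unfolding radial_cone_def by blast
    moreover have "x \<in> ?W" unfolding u(2) by (rule val(5)[OF u(1)])
    ultimately show "x \<in> radial_cone \<gamma> \<inter> ?W" by (rule IntI)
  next
    fix x assume "x \<in> radial_cone \<gamma> \<inter> ?W"
    then obtain p where x: "p \<in> \<gamma>" "x \<in> closed_segment 0 p" "x \<in> ?W" unfolding radial_cone_def by blast
    then obtain t where t: "0 \<le> t" "t \<le> 1" "x = t *\<^sub>R p" unfolding in_segment by auto
    have np: "norm p = R" using x(1) R(2) by auto
    have t1: "0 < t" "t < 1"
      using x(3) t np R(1) by (auto simp: less_le)
    have "?r x = p" using t1 R(1) by (simp add: t(3) np)
    then have "p \<in> \<gamma> \<inter> W" using x by auto
    then obtain y where y: "y \<in> U" "y $ i0 = 0" "p = f y" unfolding c'(6) by auto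
    obtain s where s: "1 < s" "s < 2" "step s = t" using step_surj[OF t1] by blast
    have d: "drop_coord i0 (y + axis i0 s) = y" using y(2) by (auto simp: vec_eq_iff axis_def)
    have si: "(y + axis i0 s) $ i0 = s" using y(2) by (simp add: axis_def)
    have "cone_map i0 f (y + axis i0 s) = x" unfolding cone_map_def d si using t(3) y(3) s(3) by simp
    moreover have "y + axis i0 s \<in> ?V" using d si s y(1) by simp
    ultimately show "x \<in> cone_map i0 f ` ?V" by (intro image_eqI[of x _ "y + axis i0 s"]) (simp_all only:)
  qed
  show ?thesis unfolding pchart_def
  proof (intro conjI ballI)
    show "?\<kappa> differentiable (at x)" if "x \<in> ?W" for x by (rule diff[OF that])
    show "?\<kappa> (cone_map i0 f u) = u" if "u \<in> ?V" for u by (rule inv[OF that])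
  qed (fact oW par im)+
qed

lemma compact_support_absolutely_integrable:
  fixes h :: "'a::euclidean_space \<Rightarrow> real"
  assumes h: "continuous_on S h" "S \<in> sets borel" "\<And>x. x \<in> S \<Longrightarrow> \<bar>h x\<bar> \<le> B" and Z: "bounded Z" "\<And>x. x \<in> S - Z \<Longrightarrow> h x = 0"
  shows "h absolutely_integrable_on S"
proof -
  obtain r where r: "Z \<subseteq> cball 0 r" using bounded_subset_ballD[OF Z(1), of 0] ball_subset_cball by blast
  have "h absolutely_integrable_on (S \<inter> cball 0 r)"
    by (rule bounded_continuous_absolutely_integrable[of _ _ B])
       (use h in \<open>auto intro: continuous_on_subset bounded_subset[OF bounded_cball]\<close>)
  moreover have "indicator (S \<inter> cball 0 r) x *\<^sub>R h x = indicator S x *\<^sub>R h x" for x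
    using Z(2)[of x] subsetD[OF r, of x] by (auto simp: indicator_def)
  ultimately show ?thesis unfolding set_integrable_def by (simp only:)
qed

lemma extend_by_zero:
  fixes h :: "'a::euclidean_space \<Rightarrow> real"
  assumes h: "continuous_on U h" "open U" and Z: "compact Z" "Z \<subseteq> U" "\<And>u. u \<in> U - Z \<Longrightarrow> h u = 0"
  shows "continuous_on UNIV (\<lambda>u. if u \<in> U then h u else 0)"
    and "\<exists>B. \<forall>u. \<bar>if u \<in> U then h u else 0\<bar> \<le> B"
proof -
  let ?h = "\<lambda>u. if u \<in> U then h u else 0"
  have "continuous_on U ?h" using h(1) by (simp cong: continuous_on_cong)
  moreover have "continuous_on (- Z) ?h"
  proof -
    have "?h u = 0" if "u \<in> - Z" for u using Z(3)[of u] that by auto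
    then show ?thesis by (intro continuous_on_eq[OF continuous_on_const[of _ 0]]) (simp only:)
  qed
  ultimately have "continuous_on (U \<union> - Z) ?h"
    using h(2) Z(1) by (intro continuous_on_open_Un open_Compl compact_imp_closed)
  moreover have "U \<union> - Z = UNIV" using Z(2) by auto
  ultimately show c: "continuous_on UNIV ?h" by simp
  obtain B where B: "\<And>u. u \<in> Z \<Longrightarrow> \<bar>?h u\<bar> \<le> B"
    using compact_imp_bounded[OF compact_continuous_image[OF continuous_on_subset[OF c] Z(1)]]
    unfolding bounded_iff by fastforce
  have "\<bar>?h u\<bar> \<le> \<bar>B\<bar>" for u
  proof (cases "u \<in> Z")
    case True then show ?thesis using B[OF True] by linarith
  next
    case False then show ?thesis using Z(3)[of u] by auto
  qed
  then show "\<exists>B. \<forall>u. \<bar>?h u\<bar> \<le> B" by blast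
qed

text \<open>Carries a collar of fixed size to one of width proportional to \<open>e\<close>; as
  \<open>e\<close> tends to 0 the map degenerates to \<open>drop_coord\<close>.\<close>

definition stretch_coord :: "'k::finite \<Rightarrow> real \<Rightarrow> real^'k \<Rightarrow> real^'k" where
  "stretch_coord i0 e u = (\<chi> i. if i = i0 then e * u $ i else u $ i)"

lemma has_integral_stretch_coord:
  fixes g :: "real^'k \<Rightarrow> real"
  assumes g: "continuous_on UNIV g" and Z: "bounded Z" "\<And>u. u \<notin> Z \<Longrightarrow> g u = 0" and e: "0 < e"
  shows "((\<lambda>u. e * g (stretch_coord i0 e u)) has_integral integral UNIV g) UNIV"
proof -
  obtain a where a: "Z \<subseteq> cbox (- a) a" using bounded_subset_cbox_symmetric[OF Z(1)] by blast
  define m :: "real^'k \<Rightarrow> real" where "m b = (if b = axis i0 1 then e else 1)" for b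
  have i: "g integrable_on cbox (- a) a"
    by (rule integrable_continuous[OF continuous_on_subset[OF g]]) simp
  have "(g has_integral integral (cbox (- a) a) g) UNIV"
    by (rule has_integral_on_superset[OF integrable_integral[OF i]]) (use Z(2) a in auto)
  then have I: "integral (cbox (- a) a) g = integral UNIV g" by (simp add: integral_unique)
  have st: "(\<Sum>k\<in>Basis. (n k * (x \<bullet> k)) *\<^sub>R k) = (\<chi> i. n (axis i 1) * x $ i)" for n and x :: "real^'k"
  proof -
    have "(\<Sum>k\<in>Basis. (n k * (x \<bullet> k)) *\<^sub>R k) $ i = n (axis i 1) * x $ i" for i
    proof -
      have "(\<Sum>k\<in>Basis. (n k * (x \<bullet> k)) *\<^sub>R k) \<bullet> axis i 1 = n (axis i 1) * (x \<bullet> axis i 1)"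
        by (rule inner_sum_left_Basis) simp
      then show ?thesis by (simp add: inner_axis)
    qed
    then show ?thesis by (simp add: vec_eq_iff)
  qed
  have s1: "(\<Sum>k\<in>Basis. (m k * (x \<bullet> k)) *\<^sub>R k) = stretch_coord i0 e x" for x
    unfolding st by (subst vec_eq_iff) (simp add: stretch_coord_def m_def axis_eq_axis)
  have s2: "(\<Sum>k\<in>Basis. (1 / m k * (x \<bullet> k)) *\<^sub>R k) = stretch_coord i0 (1 / e) x" for x
    unfolding st by (subst vec_eq_iff) (simp add: stretch_coord_def m_def axis_eq_axis)
  have pm: "prod m Basis = e"
  proof -
    have "prod m Basis = m (axis i0 1) * prod m (Basis - {axis i0 1})" by (rule prod.remove) auto
    also have "prod m (Basis - {axis i0 1}) = 1" by (rule prod.neutral) (auto simp: m_def)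
    finally show ?thesis by (simp add: m_def)
  qed
  have "((\<lambda>x. g (\<Sum>k\<in>Basis. (m k * (x\<bullet>k))*\<^sub>R k)) has_integral ((1/ \<bar>prod m Basis\<bar>) *\<^sub>R integral UNIV g))
     ((\<lambda>x. (\<Sum>k\<in>Basis. (1 / m k * (x\<bullet>k))*\<^sub>R k)) ` cbox (- a) a)"
    using integrable_integral[OF i] unfolding I by (rule has_integral_stretch) (use e in \<open>simp add: m_def\<close>)
  then have "((\<lambda>u. e * g (stretch_coord i0 e u)) has_integral e * ((1 / \<bar>e\<bar>) * integral UNIV g))
     (stretch_coord i0 (1 / e) ` cbox (- a) a)"
    unfolding s1 s2 pm real_scaleR_def by (rule has_integral_mult_right)
  then have "((\<lambda>u. e * g (stretch_coord i0 e u)) has_integral e * ((1 / \<bar>e\<bar>) * integral UNIV g)) UNIV"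
  proof (rule has_integral_on_superset)
    fix x assume x: "x \<notin> stretch_coord i0 (1 / e) ` cbox (- a) a"
    have "x = stretch_coord i0 (1 / e) (stretch_coord i0 e x)"
      using e by (simp add: stretch_coord_def vec_eq_iff)
    then have "stretch_coord i0 e x \<notin> cbox (- a) a" using x by blast
    then show "e * g (stretch_coord i0 e x) = 0" using Z(2) a by auto
  qed simp
  then show ?thesis using e by simp
qed

text \<open>Moving along coordinate \<open>i\<close> stays in \<gamma>, where the norm is constant;
  differentiating the squared norm gives the orthogonality.\<close>

lemma collar_boundary_orthogonal:
  fixes f :: "real^'k \<Rightarrow> real^'n"
  assumes c: "collar_chart i0 K \<gamma> W U f \<kappa>" and R: "\<gamma> \<subseteq> sphere 0 R"
    and y: "y \<in> U" "y $ i0 = 0" and i: "i \<noteq> i0"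
  shows "f y \<bullet> fd f y (axis i 1) = 0"
proof -
  have c': "C1_parametrisation f U" "\<gamma> \<inter> W = f ` {u \<in> U. u $ i0 = 0}"
    using c unfolding collar_chart_def by auto
  let ?e = "axis i 1 :: real^'k"
  have d: "((\<lambda>s::real. f (y + s *\<^sub>R ?e)) has_derivative (\<lambda>s. fd f y (s *\<^sub>R ?e))) (at 0)"
  proof -
    have 1: "((\<lambda>s::real. y + s *\<^sub>R ?e) has_derivative (\<lambda>s. s *\<^sub>R ?e)) (at 0)"
      by (auto intro!: derivative_eq_intros)
    have 2: "(f has_derivative fd f y) (at (y + 0 *\<^sub>R ?e))"
      using param_has_derivative[OF c'(1) y(1)] by simp
    show ?thesis using has_derivative_compose[OF 1 2] .
  qed
  have D: "((\<lambda>s::real. f (y + s *\<^sub>R ?e) \<bullet> f (y + s *\<^sub>R ?e)) has_derivative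
     (\<lambda>s. f y \<bullet> fd f y (s *\<^sub>R ?e) + fd f y (s *\<^sub>R ?e) \<bullet> f y)) (at 0)"
    using has_derivative_inner[OF d d] by simp
  have "((\<lambda>s::real. f (y + s *\<^sub>R ?e) \<bullet> f (y + s *\<^sub>R ?e)) has_derivative (\<lambda>_. 0)) (at 0)"
  proof (rule has_derivative_transform_within_open[OF has_derivative_const[of "R\<^sup>2"]])
    have "continuous_on UNIV (\<lambda>s::real. y + s *\<^sub>R ?e)" by (intro continuous_intros)
    then show "open ((\<lambda>s::real. y + s *\<^sub>R ?e) -` U)" by (rule open_vimage[OF param_open[OF c'(1)]])
    show "0 \<in> (\<lambda>s::real. y + s *\<^sub>R ?e) -` U" using y(1) by simp
    show "R\<^sup>2 = f (y + s *\<^sub>R ?e) \<bullet> f (y + s *\<^sub>R ?e)" if s: "s \<in> (\<lambda>s::real. y + s *\<^sub>R ?e) -` U" for s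
    proof -
      have "(y + s *\<^sub>R ?e) $ i0 = 0" using y(2) i by (simp add: axis_def)
      then have "f (y + s *\<^sub>R ?e) \<in> \<gamma>" using s c'(2) by blast
      then show ?thesis using R by (auto simp: power2_norm_eq_inner[symmetric])
    qed
  qed
  then have "(\<lambda>s::real. f y \<bullet> fd f y (s *\<^sub>R ?e) + fd f y (s *\<^sub>R ?e) \<bullet> f y) = (\<lambda>_. 0)"
    using D by (rule has_derivative_unique[rotated])
  from fun_cong[OF this, of 1] show ?thesis by (simp add: inner_commute)
qed

section \<open>The flux through the boundary\<close>

text \<open>The power \<open>k\<close> makes \<open>cutoff'\<close> equal to \<open>k\<close> times the radial part of the volume density of \<open>cone_map\<close>. The
  flux through \<open>\<gamma>\<close> and the volume of the cone are then compared pointwise, as integrals over the same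
  \<open>k\<close>-dimensional domain, and Fubini's theorem is not needed.\<close>

definition cutoff :: "nat \<Rightarrow> real \<Rightarrow> real" where "cutoff k s = 1 - step s ^ k"
definition cutoff' :: "nat \<Rightarrow> real \<Rightarrow> real" where "cutoff' k s = - (real k * step s ^ (k - 1) * step' s)"

lemma cutoff_DERIV: "DERIV (cutoff k) s :> cutoff' k s"
proof -
  have "((\<lambda>s. 1 - step s ^ k) has_real_derivative 0 - real k * (step' s * step s ^ (k - Suc 0))) (at s)"
    by (intro DERIV_diff DERIV_const DERIV_power step_DERIV)
  then show ?thesis by (simp add: cutoff_def[abs_def] cutoff'_def mult_ac)
qed

lemma C1_on_cutoff: "C1_on (cutoff k) U"
  unfolding cutoff_def[abs_def] by (intro C1_on_diff C1_on_const C1_on_power C1_on_step)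

lemma cutoff_bounds: "0 \<le> cutoff k s" "cutoff k s \<le> 1"
  using power_le_one[OF step_bounds, of s k] step_bounds(1)[of s] by (auto simp: cutoff_def)

lemma cutoff_eq: "s \<le> 1 \<Longrightarrow> cutoff k s = 0" "2 \<le> s \<Longrightarrow> 0 < k \<Longrightarrow> cutoff k s = 1"
  by (auto simp: cutoff_def step_def)

lemma cutoff'_eq: "s \<le> 1 \<or> 2 \<le> s \<Longrightarrow> cutoff' k s = 0"
  by (auto simp: cutoff'_def step'_def)

lemma step'_nonpos: "step' s \<le> 0"
  unfolding step'_eq by (simp add: mult_nonneg_nonneg)

lemma cutoff'_continuous: "continuous_on A (cutoff' k)"
  unfolding cutoff'_def[abs_def]
  by (intro continuous_intros step'_continuous C1_on_continuous[OF C1_on_step])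

lemma cutoff'_bounded: "\<exists>B. \<forall>s. \<bar>cutoff' k s\<bar> \<le> B"
proof -
  obtain B where B: "\<And>s. s \<in> {1..2} \<Longrightarrow> \<bar>cutoff' k s\<bar> \<le> B"
    using compact_imp_bounded[OF compact_continuous_image[OF cutoff'_continuous compact_Icc[of 1 2]], of k]
    unfolding bounded_iff by fastforce
  have "\<bar>cutoff' k s\<bar> \<le> \<bar>B\<bar>" for s
  proof (cases "s \<in> {1..2}")
    case True then show ?thesis using B[OF True] by linarith
  next
    case False then show ?thesis using cutoff'_eq[of s k] by auto
  qed
  then show ?thesis by blast
qed

text \<open>The truncation by \<open>min 1\<close> keeps the integrand bounded where \<open>|x|\<close> tends to 1.\<close>

lemma flux_inequality:
  fixes f :: "real^'k \<Rightarrow> real^'n" and \<rho> :: "real^'n \<Rightarrow> real" and U :: "(real^'k) set"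
  assumes M: "minimal_submanifold TYPE('k) M" and cK: "compact (M \<union> \<gamma>)" and cl: "closed \<gamma>" and dj: "M \<inter> \<gamma> = {}"
    and c: "collar_chart i0 (M \<union> \<gamma>) \<gamma> W U f \<kappa>" and R: "0 < R" "\<gamma> \<subseteq> sphere 0 R"
    and \<rho>: "C1_on \<rho> UNIV" "\<And>x. 0 \<le> \<rho> x" "compact (closure {x. \<rho> x \<noteq> 0})" "closure {x. \<rho> x \<noteq> 0} \<subseteq> W"
  defines "Up \<equiv> {u \<in> U. 0 < u $ i0}"
    and "V \<equiv> {u. 1 < u $ i0 \<and> u $ i0 < 2 \<and> drop_coord i0 u \<in> U}"
    and "G \<equiv> \<lambda>u. gden f u * (fd \<rho> (f u) (tpart f u) + \<rho> (f u) * (real CARD('k) + 2 * real CARD('k) *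
        min 1 (((norm (f u))\<^sup>2 - (norm (tpart f u))\<^sup>2) / (1 - (norm (f u))\<^sup>2))))"
  shows "G absolutely_integrable_on Up"
    and "(\<lambda>u. gden f u * fd \<rho> (f u) (tpart f u)) absolutely_integrable_on Up"
    and "(\<lambda>u. gden f u * \<rho> (f u)) absolutely_integrable_on Up"
    and "(\<lambda>u. gden f u * \<rho> (f u) * min 1 (((norm (f u))\<^sup>2 - (norm (tpart f u))\<^sup>2) / (1 - (norm (f u))\<^sup>2)))
       absolutely_integrable_on Up"
    and "ennreal (integral Up G) \<le> ennreal (real CARD('k)) *
      (\<integral>\<^sup>+u\<in>V. ennreal (\<rho> (f (drop_coord i0 u)) * gden (cone_map i0 f) u) \<partial>lborel)"
proof -
  let ?k = "CARD('k)" and ?S = "closure {x. \<rho> x \<noteq> 0}"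
  have c': "open W" "C1_parametrisation f U" "C1_on \<kappa> W" "\<And>u. u \<in> U \<Longrightarrow> \<kappa> (f u) = u" "f ` U \<subseteq> W"
    "closedin (top_of_set W) (f ` U)" "\<gamma> \<inter> W = f ` {u \<in> U. u $ i0 = 0}"
    using c unfolding collar_chart_def by auto
  have ch: "pchart M f Up W \<kappa>" unfolding Up_def by (rule collar_chart_interior[OF c dj])
  have oU: "open U" by (rule param_open[OF c'(2)])
  have oUp: "open Up" by (rule param_open[OF pchart_param[OF ch]])
  have UpU: "Up \<subseteq> U" by (auto simp: Up_def)
  have ball: "norm (f u) < 1" if "u \<in> Up" for u
  proof -
    have "M \<subseteq> ball 0 1" using M unfolding minimal_submanifold_def by blast
    moreover have "f u \<in> M" using pchart_image[OF ch] that by blast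
    ultimately have "f u \<in> ball 0 1" by (rule subsetD)
    then show ?thesis by simp
  qed
  \<comment> \<open>The parameters at which \<rho> can be felt. As the image of \<open>f\<close> is
    closed in \<open>W\<close>, this set is compact, although it may cross the boundary
    hyperplane.\<close>
  define Z where "Z = \<kappa> ` (?S \<inter> f ` U)"
  have cZ: "compact Z"
  proof -
    obtain T where T: "closed T" "f ` U = W \<inter> T" using c'(6) unfolding closedin_closed by auto
    have "?S \<inter> f ` U = ?S \<inter> T" using T(2) \<rho>(4) by blast
    then have "compact (?S \<inter> f ` U)" using compact_Int_closed[OF \<rho>(3) T(1)] by simp
    then show ?thesis unfolding Z_def
      by (rule compact_continuous_image[rotated]) (use c'(5) in \<open>auto intro!: continuous_on_subset[OF C1_on_continuous[OF c'(3)]]\<close>)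
  qed
  have ZU: "Z \<subseteq> U" using c'(4) by (auto simp: Z_def)
  have zero: "\<rho> (f u) = 0" "fd \<rho> (f u) = (\<lambda>_. 0)" if u: "u \<in> U - Z" for u
  proof -
    have "f u \<notin> ?S"
    proof
      assume "f u \<in> ?S"
      then have "\<kappa> (f u) \<in> Z" using u unfolding Z_def by blast
      then show False using u c'(4)[of u] by simp
    qed
    then show "\<rho> (f u) = 0" "fd \<rho> (f u) = (\<lambda>_. 0)" using fd_eq_zero[of "f u" \<rho>] by blast+
  qed
  define hA where "hA u = gden f u * fd \<rho> (f u) (tpart f u)" for u
  define hB where "hB u = gden f u * \<rho> (f u)" for u
  \<comment> \<open>Density of the flux: the derivative of the coordinate \<open>i0\<close> along
    the tangential part of the position is the component \<open>i0\<close> of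
    \<open>rad\<close>.\<close>
  define hP where "hP u = \<rho> (f u) * (gden f u * rad f u $ i0)" for u
  define q where "q u = ((norm (f u))\<^sup>2 - (norm (tpart f u))\<^sup>2) / (1 - (norm (f u))\<^sup>2)" for u
  have cf: "continuous_on U f" by (rule param_continuous[OF c'(2)])
  have d\<rho>f: "((\<lambda>u. \<rho> (f u)) has_derivative (\<lambda>v. fd \<rho> (f u) (fd f u v))) (at u)" if "u \<in> U" for u
    using has_derivative_compose[OF param_has_derivative[OF c'(2) that] C1_on_has_derivative[OF \<rho>(1) UNIV_I]] .
  have C\<rho>f: "C1_on (\<lambda>u. \<rho> (f u)) U" by (rule C1_on_compose[OF param_C1[OF c'(2)] \<rho>(1)]) simp
  have chA: "continuous_on U hA"
  proof -
    have "continuous_on U (\<lambda>u. gden f u * fd (\<lambda>u. \<rho> (f u)) u (rad f u))"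
      by (intro continuous_on_mult gden_continuous[OF c'(2)] C1_on_continuous_fd[OF C\<rho>f] rad_continuous[OF c'(2)])
    moreover have "fd (\<lambda>u. \<rho> (f u)) u (rad f u) = fd \<rho> (f u) (tpart f u)" if "u \<in> U" for u
      by (simp add: fdI[OF d\<rho>f[OF that]] tpart_eq[OF c'(2) that])
    ultimately show ?thesis unfolding hA_def[abs_def] by (simp cong: continuous_on_cong)
  qed
  have c\<rho>f: "continuous_on U (\<lambda>u. \<rho> (f u))" by (rule C1_on_continuous[OF C\<rho>f])
  have chB: "continuous_on U hB" unfolding hB_def[abs_def]
    by (intro continuous_on_mult gden_continuous[OF c'(2)] c\<rho>f)
  have chP: "continuous_on U hP" unfolding hP_def[abs_def]
    by (intro continuous_on_mult gden_continuous[OF c'(2)] c\<rho>f continuous_on_component rad_continuous[OF c'(2)])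
  have hA0: "hA u = 0" if "u \<in> U - Z" for u by (simp only: hA_def zero[OF that] mult_zero_right)
  have hB0: "hB u = 0" if "u \<in> U - Z" for u by (simp only: hB_def zero[OF that] mult_zero_right)
  have hP0: "hP u = 0" if "u \<in> U - Z" for u by (simp only: hP_def zero[OF that] mult_zero_left)
  have hBnn: "0 \<le> hB u" if "u \<in> U" for u
    using param_gden_pos[OF c'(2) that] \<rho>(2) by (simp add: hB_def)
  \<comment> \<open>Extension by zero to the whole parameter space, so that the collar integrals can
    be rescaled over a fixed domain.\<close>
  define Ph where "Ph u = (if u \<in> U then hP u else 0)" for u
  have cPh: "continuous_on UNIV Ph" unfolding Ph_def[abs_def] by (rule extend_by_zero(1)[OF chP oU cZ ZU hP0])
  obtain BP where BP: "\<And>u. \<bar>Ph u\<bar> \<le> BP" using extend_by_zero(2)[OF chP oU cZ ZU hP0] unfolding Ph_def by blast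
  obtain BA where BA: "\<And>u. u \<in> U \<Longrightarrow> \<bar>hA u\<bar> \<le> BA" using extend_by_zero(2)[OF chA oU cZ ZU hA0] by metis
  obtain BB where BB: "\<And>u. u \<in> U \<Longrightarrow> \<bar>hB u\<bar> \<le> BB" using extend_by_zero(2)[OF chB oU cZ ZU hB0] by metis
  have Ph0: "Ph u = 0" if "u \<notin> Z" for u using hP0[of u] that by (auto simp: Ph_def)
  have bZ: "bounded Z" by (rule compact_imp_bounded[OF cZ])
  have bUp: "Up \<in> sets borel" using oUp by simp
  have den: "0 < 1 - (norm (f u))\<^sup>2" if "u \<in> Up" for u
    using ball[OF that] by (simp add: power_less_one_iff abs_square_less_1)
  have q0: "0 \<le> q u" if "u \<in> Up" for u
  proof -
    have "u \<in> U" using that UpU by blast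
    then show ?thesis using den[OF that] tpart_pythagoras[OF c'(2)] by (simp add: q_def)
  qed
  have cq: "continuous_on Up (\<lambda>u. min 1 (q u))"
    unfolding q_def
    by (intro continuous_on_min continuous_on_const continuous_on_divide continuous_on_diff continuous_on_power
        continuous_on_norm continuous_on_subset[OF cf UpU] continuous_on_subset[OF tpart_continuous[OF c'(2)] UpU])
       (use den in force)
  have m01: "0 \<le> min 1 (q u)" "min 1 (q u) \<le> 1" if "u \<in> Up" for u using q0[OF that] by auto
  have G: "G u = hA u + hB u * (real ?k + 2 * real ?k * min 1 (q u))" for u
    by (simp add: G_def hA_def hB_def q_def distrib_left mult.assoc)
  have cG: "continuous_on Up G"
    unfolding G[abs_def]
    by (intro continuous_on_add continuous_on_mult continuous_on_const cq continuous_on_subset[OF chA UpU] continuous_on_subset[OF chB UpU])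
  have G0: "G u = 0" if "u \<in> Up - Z" for u
  proof -
    have "u \<in> U - Z" using that UpU by blast
    then show ?thesis unfolding G using hA0 hB0 by simp
  qed
  have GB: "\<bar>G u\<bar> \<le> BA + BB * (3 * real ?k)" if u: "u \<in> Up" for u
  proof -
    have U: "u \<in> U" using u UpU by blast
    have "0 \<le> real ?k + 2 * real ?k * min 1 (q u)" using m01[OF u] by simp
    moreover have "real ?k + 2 * real ?k * min 1 (q u) \<le> 3 * real ?k" using m01[OF u] by simp
    ultimately have "\<bar>hB u * (real ?k + 2 * real ?k * min 1 (q u))\<bar> \<le> BB * (3 * real ?k)"
      unfolding abs_mult using BB[OF U] by (intro mult_mono) auto
    then show ?thesis unfolding G using BA[OF U] by linarith
  qed
  show aiG: "G absolutely_integrable_on Up"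
    by (rule compact_support_absolutely_integrable[OF cG bUp GB bZ G0])
  have "hA absolutely_integrable_on Up"
    by (rule compact_support_absolutely_integrable[OF continuous_on_subset[OF chA UpU] bUp BA bZ hA0]) (use UpU in auto)
  then show "(\<lambda>u. gden f u * fd \<rho> (f u) (tpart f u)) absolutely_integrable_on Up" by (simp only: hA_def[abs_def])
  have "hB absolutely_integrable_on Up"
    by (rule compact_support_absolutely_integrable[OF continuous_on_subset[OF chB UpU] bUp BB bZ hB0]) (use UpU in auto)
  then show "(\<lambda>u. gden f u * \<rho> (f u)) absolutely_integrable_on Up" by (simp only: hB_def[abs_def])
  have "(\<lambda>u. hB u * min 1 (q u)) absolutely_integrable_on Up"
  proof (rule compact_support_absolutely_integrable[OF _ bUp _ bZ, of _ "BB * 1"])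
    show "continuous_on Up (\<lambda>u. hB u * min 1 (q u))"
      by (intro continuous_on_mult cq continuous_on_subset[OF chB UpU])
    show "\<bar>hB u * min 1 (q u)\<bar> \<le> BB * 1" if "u \<in> Up" for u
      unfolding abs_mult using BB[of u] m01[OF that] that UpU by (intro mult_mono) auto
    show "hB u * min 1 (q u) = 0" if "u \<in> Up - Z" for u using hB0[of u] that UpU by auto
  qed
  then show "(\<lambda>u. gden f u * \<rho> (f u) * min 1 (((norm (f u))\<^sup>2 - (norm (tpart f u))\<^sup>2) / (1 - (norm (f u))\<^sup>2)))
       absolutely_integrable_on Up" by (simp only: hB_def[abs_def] q_def)
  obtain BT where BT: "\<And>s. \<bar>cutoff' ?k s\<bar> \<le> BT" using cutoff'_bounded by blast
  have BT0: "0 \<le> BT" "0 \<le> BP" using BT[of 0] BP[of 0] by linarith+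
  define L where "L e u = G u * cutoff ?k (u $ i0 / e)" for e u
  have ineq: "L e integrable_on Up" "(\<lambda>u. Ph (stretch_coord i0 e u) * cutoff' ?k (u $ i0)) integrable_on UNIV"
    "integral Up (L e) \<le> - integral UNIV (\<lambda>u. Ph (stretch_coord i0 e u) * cutoff' ?k (u $ i0))" if e: "0 < e" for e
  proof -
    \<comment> \<open>The test function is \<rho> switched off in a collar of \<gamma> with width of
      order \<open>e\<close>; \<kappa> makes the collar coordinate a function on the ambient
      space.\<close>
    define \<eta> where "\<eta> x = (if x \<in> W then \<rho> x * cutoff ?k (\<kappa> x $ i0 * (1 / e)) else 0)" for x
    have C\<kappa>0: "C1_on (\<lambda>x. cutoff ?k (\<kappa> x $ i0 * (1 / e))) W"
    proof -
      have "C1_on (\<lambda>x. \<kappa> x $ i0) W"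
        by (rule C1_on_compose[OF c'(3) C1_on_bounded_linear[OF bounded_linear_vec_nth, where U=UNIV]]) simp
      then have "C1_on (\<lambda>x. \<kappa> x $ i0 * (1 / e)) W" by (intro C1_on_mult C1_on_const)
      from C1_on_compose[OF this C1_on_cutoff[of ?k UNIV]] show ?thesis by simp
    qed
    have "C1_on \<eta> W"
      by (rule C1_on_cong_open[OF C1_on_mult[OF C1_on_subset[OF \<rho>(1) subset_UNIV] C\<kappa>0] c'(1)]) (simp add: \<eta>_def)
    then have C\<eta>: "C1_on \<eta> UNIV"
    proof (rule C1_on_extend_zero[OF _ c'(1) closed_closure \<rho>(4)])
      fix x assume "x \<notin> ?S"
      then have "\<rho> x = 0" by (rule fd_eq_zero(2))
      then show "\<eta> x = 0" by (simp add: \<eta>_def)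
    qed
    have ne: "{x. \<eta> x \<noteq> 0} \<subseteq> {x \<in> ?S. e \<le> \<kappa> x $ i0}"
    proof
      fix x assume "x \<in> {x. \<eta> x \<noteq> 0}"
      then have x: "\<rho> x \<noteq> 0" "cutoff ?k (\<kappa> x $ i0 * (1 / e)) \<noteq> 0" by (auto simp: \<eta>_def split: if_splits)
      have "x \<in> ?S" using x(1) closure_subset[of "{x. \<rho> x \<noteq> 0}"] by blast
      moreover have "1 < \<kappa> x $ i0 * (1 / e)" using x(2) cutoff_eq(1)[of "\<kappa> x $ i0 * (1 / e)" ?k] by linarith
      ultimately show "x \<in> {x \<in> ?S. e \<le> \<kappa> x $ i0}" using e by (simp add: field_simps)
    qed
    have "closed {x \<in> ?S. e \<le> \<kappa> x $ i0}"
      by (intro continuous_closed_preimage_constant continuous_on_closed_Collect_le continuous_on_const continuous_on_component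
          continuous_on_subset[OF C1_on_continuous[OF c'(3)] \<rho>(4)] closed_closure)
    then have cs: "closure {x. \<eta> x \<noteq> 0} \<subseteq> {x \<in> ?S. e \<le> \<kappa> x $ i0}" using ne by (rule closure_minimal[rotated])
    have S1: "compact (closure {x. \<eta> x \<noteq> 0})"
      by (rule compact_closed_subset[OF \<rho>(3) closed_closure]) (use cs in blast)
    have S2: "closure {x. \<eta> x \<noteq> 0} \<subseteq> W" using cs \<rho>(4) by blast
    have S3: "closure {x. \<eta> x \<noteq> 0} \<inter> \<gamma> = {}"
    proof (rule ccontr)
      assume "closure {x. \<eta> x \<noteq> 0} \<inter> \<gamma> \<noteq> {}"
      then obtain x where x: "x \<in> \<gamma>" "x \<in> ?S" "e \<le> \<kappa> x $ i0" using cs by blast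
      then have "x \<in> f ` {u \<in> U. u $ i0 = 0}" unfolding c'(7)[symmetric] using \<rho>(4) by blast
      then have "\<kappa> x $ i0 = 0" using c'(4) by auto
      then show False using x(3) e by simp
    qed
    \<comment> \<open>The part of the first variation in which the derivative falls on the cutoff:
      minus the flux through the collar.\<close>
    define T where "T u = hP u * (cutoff' ?k (u $ i0 / e) / e)" for u
    define E where "E u = hA u * cutoff ?k (u $ i0 / e) + T u + hB u * cutoff ?k (u $ i0 / e) * (real ?k + 2 * real ?k * q u)" for u
    have fv: "((\<lambda>u. gden f u * (fd \<eta> (f u) (tpart f u) + \<eta> (f u) * (real CARD('k) +
        2 * real CARD('k) * (((norm (f u))\<^sup>2 - (norm (tpart f u))\<^sup>2) / (1 - (norm (f u))\<^sup>2)))))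
      has_integral 0) Up" by (rule first_variation[OF M cK cl ch C\<eta> S1 S2 S3])
    have "(E has_integral 0) Up"
    proof (rule has_integral_eq[OF _ fv])
      fix u assume u: "u \<in> Up"
      then have U: "u \<in> U" using UpU by blast
      have fW: "f u \<in> W" using U c'(5) by blast
      let ?\<theta> = "cutoff ?k (u $ i0 / e)" and ?\<theta>' = "cutoff' ?k (u $ i0 / e)"
      have \<eta>f: "\<eta> (f w) = \<rho> (f w) * cutoff ?k (w $ i0 / e)" if "w \<in> U" for w
        using that c'(4,5) by (auto simp: \<eta>_def)
      have "((\<lambda>w. w $ i0 / e) has_derivative (\<lambda>v. v $ i0 / e)) (at u)"
        by (rule bounded_linear_imp_has_derivative[OF bounded_linear_compose[OF bounded_linear_divide bounded_linear_vec_nth]])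
      from has_derivative_compose[OF this, of "cutoff ?k" "(*) ?\<theta>'"]
      have d\<theta>: "((\<lambda>w. cutoff ?k (w $ i0 / e)) has_derivative (\<lambda>v. ?\<theta>' * (v $ i0 / e))) (at u)"
        using cutoff_DERIV[of ?k "u $ i0 / e"] by (simp add: has_field_derivative_def)
      have "((\<lambda>w. \<eta> (f w)) has_derivative (\<lambda>v. \<rho> (f u) * (?\<theta>' * (v $ i0 / e)) + fd \<rho> (f u) (fd f u v) * ?\<theta>)) (at u)"
        by (rule has_derivative_transform_within_open[OF has_derivative_mult[OF d\<rho>f[OF U] d\<theta>] oU U]) (simp add: \<eta>f)
      moreover have "((\<lambda>w. \<eta> (f w)) has_derivative (\<lambda>v. fd \<eta> (f u) (fd f u v))) (at u)"
        using has_derivative_compose[OF param_has_derivative[OF c'(2) U] C1_on_has_derivative[OF C\<eta> UNIV_I]] .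
      ultimately have "(\<lambda>v. \<rho> (f u) * (?\<theta>' * (v $ i0 / e)) + fd \<rho> (f u) (fd f u v) * ?\<theta>) = (\<lambda>v. fd \<eta> (f u) (fd f u v))"
        by (rule has_derivative_unique)
      from fun_cong[OF this, of "rad f u"]
      have fd\<eta>: "fd \<eta> (f u) (tpart f u) = \<rho> (f u) * (?\<theta>' * (rad f u $ i0 / e)) + fd \<rho> (f u) (tpart f u) * ?\<theta>"
        by (simp add: tpart_eq[OF c'(2) U])
      show "gden f u * (fd \<eta> (f u) (tpart f u) + \<eta> (f u) * (real CARD('k) +
        2 * real CARD('k) * (((norm (f u))\<^sup>2 - (norm (tpart f u))\<^sup>2) / (1 - (norm (f u))\<^sup>2)))) = E u"
        unfolding fd\<eta> \<eta>f[OF U] E_def T_def hA_def hB_def hP_def q_def[symmetric]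
        by (simp add: distrib_left mult_ac)
    qed
    have c\<theta>: "continuous_on Up (\<lambda>u. cutoff ?k (u $ i0 / e))" "continuous_on Up (\<lambda>u. cutoff' ?k (u $ i0 / e))"
    proof -
      have "continuous_on Up (\<lambda>u. u $ i0 / e)" using e by (intro continuous_intros) auto
      then show "continuous_on Up (\<lambda>u. cutoff ?k (u $ i0 / e))" "continuous_on Up (\<lambda>u. cutoff' ?k (u $ i0 / e))"
        by (auto intro!: continuous_on_compose2[OF C1_on_continuous[OF C1_on_cutoff[of _ UNIV]]]
          continuous_on_compose2[OF cutoff'_continuous[of UNIV]])
    qed
    have LG: "\<bar>L e u\<bar> \<le> \<bar>G u\<bar>" for u
      unfolding L_def abs_mult using cutoff_bounds[of ?k "u $ i0 / e"] by (intro mult_left_le) auto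
    have "L e absolutely_integrable_on Up"
    proof (rule compact_support_absolutely_integrable[OF _ bUp _ bZ])
      show "continuous_on Up (L e)" unfolding L_def[abs_def] by (intro continuous_on_mult cG c\<theta>)
      show "\<bar>L e u\<bar> \<le> BA + BB * (3 * real ?k)" if "u \<in> Up" for u using LG[of u] GB[OF that] by linarith
      show "L e u = 0" if "u \<in> Up - Z" for u by (simp only: L_def G0[OF that] mult_zero_left)
    qed
    then show iL: "L e integrable_on Up" by (simp add: absolutely_integrable_on_def)
    have "T absolutely_integrable_on Up"
    proof (rule compact_support_absolutely_integrable[OF _ bUp _ bZ])
      show "continuous_on Up T" unfolding T_def[abs_def]
        by (intro continuous_on_mult continuous_on_divide continuous_on_const c\<theta> continuous_on_subset[OF chP UpU]) (use e in auto)
      show "\<bar>T u\<bar> \<le> BP * (BT / e)" if "u \<in> Up" for u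
      proof -
        have "\<bar>hP u\<bar> \<le> BP" using BP[of u] that UpU by (auto simp: Ph_def)
        moreover have "\<bar>cutoff' ?k (u $ i0 / e) / e\<bar> \<le> BT / e" using BT[of "u $ i0 / e"] e by (simp add: divide_right_mono)
        ultimately show ?thesis unfolding T_def abs_mult using BT0 by (intro mult_mono) auto
      qed
      show "T u = 0" if u: "u \<in> Up - Z" for u
      proof -
        have "u \<in> U - Z" using u UpU by blast
        then show ?thesis by (simp only: T_def hP0 mult_zero_left)
      qed
    qed
    then have iT: "T integrable_on Up" by (simp add: absolutely_integrable_on_def)
    \<comment> \<open>Truncating the quotient only lowers the integrand, because its weight is
      nonnegative. The possibly unbounded term is thus gone before \<open>e\<close> tends to
      0.\<close>
    have LE: "L e u \<le> E u - T u" if u: "u \<in> Up" for u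
    proof -
      have U: "u \<in> U" using u UpU by blast
      have "hB u * cutoff ?k (u $ i0 / e) * (real ?k + 2 * real ?k * min 1 (q u)) \<le>
        hB u * cutoff ?k (u $ i0 / e) * (real ?k + 2 * real ?k * q u)"
        using hBnn[OF U] cutoff_bounds(1) by (intro mult_left_mono) auto
      then show ?thesis unfolding L_def G E_def by (simp add: algebra_simps)
    qed
    have "((\<lambda>u. E u - T u) has_integral 0 - integral Up T) Up"
      by (rule has_integral_diff[OF \<open>(E has_integral 0) Up\<close> integrable_integral[OF iT]])
    then have "integral Up (L e) \<le> - integral Up T"
      using has_integral_le[OF integrable_integral[OF iL]] LE by fastforce
    also have "integral Up T = integral UNIV (\<lambda>u. Ph u * (cutoff' ?k (u $ i0 / e) / e))"
    proof -
      have "(if u \<in> Up then T u else 0) = Ph u * (cutoff' ?k (u $ i0 / e) / e)" for u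
      proof (cases "u \<in> Up")
        case True then show ?thesis using UpU by (auto simp: T_def Ph_def)
      next
        case False
        show ?thesis
        proof (cases "u \<in> U")
          case True
          then have "u $ i0 \<le> 0" using False by (auto simp: Up_def)
          then have "u $ i0 / e \<le> 1" using e by (simp add: divide_le_eq)
          then show ?thesis using False cutoff'_eq by simp
        qed (use False in \<open>simp add: Ph_def\<close>)
      qed
      then show ?thesis using integral_restrict_UNIV[of Up T] by simp
    qed
    finally have le: "integral Up (L e) \<le> - integral UNIV (\<lambda>u. Ph u * (cutoff' ?k (u $ i0 / e) / e))" .
    \<comment> \<open>Rescaling the coordinate \<open>i0\<close> absorbs the factor
      \<open>1 / e\<close> of the derivative: the cutoff profile becomes independent of
      \<open>e\<close>, which remains only in the argument of \<open>Ph\<close>.\<close>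
    have "((\<lambda>u. e * (Ph (stretch_coord i0 e u) * (cutoff' ?k (stretch_coord i0 e u $ i0 / e) / e))) has_integral
      integral UNIV (\<lambda>u. Ph u * (cutoff' ?k (u $ i0 / e) / e))) UNIV"
    proof (rule has_integral_stretch_coord[OF _ bZ _ e])
      have "continuous_on UNIV (\<lambda>u::real^'k. u $ i0 / e)" using e by (intro continuous_intros) auto
      then have "continuous_on UNIV (\<lambda>u::real^'k. cutoff' ?k (u $ i0 / e))"
        by (rule continuous_on_compose2[OF cutoff'_continuous[of UNIV]]) simp
      then show "continuous_on UNIV (\<lambda>u. Ph u * (cutoff' ?k (u $ i0 / e) / e))"
        using e by (intro continuous_on_mult cPh continuous_on_divide continuous_on_const) auto
      show "Ph u * (cutoff' ?k (u $ i0 / e) / e) = 0" if "u \<notin> Z" for u by (simp add: Ph0[OF that])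
    qed
    moreover have "e * (Ph (stretch_coord i0 e u) * (cutoff' ?k (stretch_coord i0 e u $ i0 / e) / e)) =
      Ph (stretch_coord i0 e u) * cutoff' ?k (u $ i0)" for u
      using e by (simp add: stretch_coord_def)
    ultimately have h: "((\<lambda>u. Ph (stretch_coord i0 e u) * cutoff' ?k (u $ i0)) has_integral
      integral UNIV (\<lambda>u. Ph u * (cutoff' ?k (u $ i0 / e) / e))) UNIV" by simp
    then show "(\<lambda>u. Ph (stretch_coord i0 e u) * cutoff' ?k (u $ i0)) integrable_on UNIV" by blast
    show "integral Up (L e) \<le> - integral UNIV (\<lambda>u. Ph (stretch_coord i0 e u) * cutoff' ?k (u $ i0))"
      using le integral_unique[OF h] by simp
  qed
  define ep where "ep n = 1 / real (Suc n)" for n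
  have ep: "0 < ep n" for n by (simp add: ep_def)
  have ep0: "ep \<longlonglongrightarrow> 0" unfolding ep_def[abs_def] using LIMSEQ_inverse_real_of_nat by (simp add: inverse_eq_divide)
  have lim1: "(\<lambda>n. integral Up (L (ep n))) \<longlonglongrightarrow> integral Up G"
  proof (rule dominated_convergence(2)[where h="\<lambda>u. \<bar>G u\<bar>"])
    show "L (ep n) integrable_on Up" for n by (rule ineq(1)[OF ep])
    show "(\<lambda>u. \<bar>G u\<bar>) integrable_on Up" using aiG by (simp add: absolutely_integrable_on_def)
    show "norm (L (ep n) u) \<le> \<bar>G u\<bar>" if "u \<in> Up" for n u
      unfolding L_def real_norm_def abs_mult using cutoff_bounds[of ?k "u $ i0 / ep n"] by (intro mult_left_le) auto
    show "(\<lambda>n. L (ep n) u) \<longlonglongrightarrow> G u" if u: "u \<in> Up" for u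
    proof (rule tendsto_eventually)
      have p: "0 < u $ i0" using u by (simp add: Up_def)
      then have "\<forall>\<^sub>F n in sequentially. ep n < u $ i0 / 2" using order_tendstoD(2)[OF ep0, of "u $ i0 / 2"] by simp
      then show "\<forall>\<^sub>F n in sequentially. L (ep n) u = G u"
      proof (rule eventually_mono)
        fix n assume "ep n < u $ i0 / 2"
        then have "2 \<le> u $ i0 / ep n" using ep[of n] by (simp add: le_divide_eq)
        then have "cutoff ?k (u $ i0 / ep n) = 1" by (intro cutoff_eq(2)) simp_all
        then show "L (ep n) u = G u" by (simp add: L_def)
      qed
    qed
  qed
  obtain r where r: "0 < r" "Z \<subseteq> cball 0 r"
    using bounded_subset_ballD[OF bZ, of 0] ball_subset_cball by blast
  \<comment> \<open>Where the integrands are nonzero, the tangential coordinates are bounded by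
    \<open>r\<close> and coordinate \<open>i0\<close> lies between 1 and 2; the margin 2 covers the
    latter.\<close>
  define Bx where "Bx = cbox (\<chi> i::'k. - (r + 2)) (\<chi> i. r + 2)"
  have box: "Ph w * cutoff' ?k (u $ i0) = 0" if u: "u \<notin> Bx" and w: "\<And>i. i \<noteq> i0 \<Longrightarrow> w $ i = u $ i" for u w
  proof (cases "u $ i0 \<in> {1..2}")
    case True
    obtain i where i: "\<not> (- (r + 2) \<le> u $ i \<and> u $ i \<le> r + 2)" using u by (auto simp: Bx_def mem_box_cart)
    then have "i \<noteq> i0" using True r(1) by auto
    then have "r < \<bar>w $ i\<bar>" using i w[of i] by auto
    then have "r < norm w" using component_le_norm_cart[of w i] by linarith
    then have "w \<notin> Z" using r(2) by auto
    then show ?thesis by (simp add: Ph0)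
  next
    case False
    then show ?thesis using cutoff'_eq[of "u $ i0" ?k] by auto
  qed
  have bnd: "\<bar>Ph w * cutoff' ?k s\<bar> \<le> BP * BT" for w s
    unfolding abs_mult using BP BT BT0 by (intro mult_mono) auto
  have lim2: "(\<lambda>n. integral UNIV (\<lambda>u. Ph (stretch_coord i0 (ep n) u) * cutoff' ?k (u $ i0))) \<longlonglongrightarrow>
    integral UNIV (\<lambda>u. Ph (drop_coord i0 u) * cutoff' ?k (u $ i0))"
  proof (rule dominated_convergence(2)[where h="\<lambda>u. if u \<in> Bx then BP * BT else 0"])
    show "(\<lambda>u. Ph (stretch_coord i0 (ep n) u) * cutoff' ?k (u $ i0)) integrable_on UNIV" for n by (rule ineq(2)[OF ep])
    have "(\<lambda>u::real^'k. BP * BT) integrable_on Bx" unfolding Bx_def by (rule integrable_const)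
    then show "(\<lambda>u. if u \<in> Bx then BP * BT else 0) integrable_on UNIV" by (simp only: integrable_restrict_UNIV)
    show "norm (Ph (stretch_coord i0 (ep n) u) * cutoff' ?k (u $ i0)) \<le> (if u \<in> Bx then BP * BT else 0)" for n u
      using bnd[of "stretch_coord i0 (ep n) u" "u $ i0"] box[of u "stretch_coord i0 (ep n) u"]
      by (simp add: stretch_coord_def)
    show "(\<lambda>n. Ph (stretch_coord i0 (ep n) u) * cutoff' ?k (u $ i0)) \<longlonglongrightarrow> Ph (drop_coord i0 u) * cutoff' ?k (u $ i0)" for u
    proof (intro tendsto_mult tendsto_const)
      have "(\<lambda>n. stretch_coord i0 (ep n) u) \<longlonglongrightarrow> drop_coord i0 u"
      proof (rule vec_tendstoI)
        fix i
        have "(\<lambda>n. ep n * u $ i) \<longlonglongrightarrow> 0 * u $ i" by (intro tendsto_mult ep0 tendsto_const)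
        then show "(\<lambda>n. stretch_coord i0 (ep n) u $ i) \<longlonglongrightarrow> drop_coord i0 u $ i"
          by (cases "i = i0") (simp_all add: stretch_coord_def)
      qed
      then show "(\<lambda>n. Ph (stretch_coord i0 (ep n) u)) \<longlonglongrightarrow> Ph (drop_coord i0 u)"
        by (rule continuous_on_tendsto_compose[OF cPh]) auto
    qed
  qed
  \<comment> \<open>The flux density in the limit. It is negative where the position points into the
    submanifold; its positive part is taken below, as only an upper bound is wanted.\<close>
  define N where "N u = - (Ph (drop_coord i0 u) * cutoff' ?k (u $ i0))" for u
  have le1: "integral Up G \<le> integral UNIV N"
    unfolding N_def integral_neg
    by (rule LIMSEQ_le[OF lim1 tendsto_minus[OF lim2]]) (use ineq(3)[OF ep] in blast)
  have cN: "continuous_on UNIV N"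
  proof -
    have "continuous_on UNIV (\<lambda>u::real^'k. u $ i0)" by (intro continuous_intros)
    then have "continuous_on UNIV (\<lambda>u::real^'k. cutoff' ?k (u $ i0))"
      by (rule continuous_on_compose2[OF cutoff'_continuous[of UNIV]]) simp
    moreover have "continuous_on UNIV (\<lambda>u. Ph (drop_coord i0 u))"
      by (rule continuous_on_compose2[OF cPh linear_continuous_on[OF bounded_linear_drop_coord]]) simp
    ultimately show ?thesis unfolding N_def[abs_def] by (intro continuous_on_minus continuous_on_mult)
  qed
  have N0: "N u = 0" if "u \<in> UNIV - Bx" for u
    using box[of u "drop_coord i0 u"] that by (simp add: N_def)
  have NB: "\<bar>N u\<bar> \<le> BP * BT" for u using bnd by (simp add: N_def)
  have bBx: "bounded Bx" unfolding Bx_def by (rule bounded_cbox)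
  have aiN: "N absolutely_integrable_on UNIV"
    by (rule compact_support_absolutely_integrable[OF cN _ NB bBx N0]) simp
  have cN': "continuous_on UNIV (\<lambda>u. max 0 (N u))" by (intro continuous_on_max continuous_on_const cN)
  have aiN': "(\<lambda>u. max 0 (N u)) absolutely_integrable_on UNIV"
  proof (rule compact_support_absolutely_integrable[OF cN' _ _ bBx])
    show "\<bar>max 0 (N u)\<bar> \<le> BP * BT" for u using NB[of u] by linarith
    show "max 0 (N u) = 0" if "u \<in> UNIV - Bx" for u using N0[OF that] by simp
  qed simp
  have le2: "integral UNIV N \<le> integral UNIV (\<lambda>u. max 0 (N u))"
    by (rule integral_le) (use aiN aiN' in \<open>auto simp: absolutely_integrable_on_def\<close>)
  have mN: "(\<lambda>u. indicator UNIV u * max 0 (N u)) \<in> borel_measurable borel"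
    using borel_measurable_continuous_onI[OF cN'] by simp
  note cch = cone_chart[OF c R, folded V_def]
  note pV = pchart_param[OF cch]
  have Vy: "drop_coord i0 u \<in> U" "1 < u $ i0" "u $ i0 < 2" if "u \<in> V" for u using that by (auto simp: V_def)
  have pt: "max 0 (N u) \<le> real ?k * (\<rho> (f (drop_coord i0 u)) * gden (cone_map i0 f) u)" if u: "u \<in> V" for u
  proof -
    let ?y = "drop_coord i0 u"
    let ?c = "\<bar>step' (u $ i0) * step (u $ i0) ^ (?k - 1)\<bar>"
    have t: "cutoff' ?k (u $ i0) = real ?k * ?c"
    proof -
      have "?c = - (step' (u $ i0) * step (u $ i0) ^ (?k - 1))"
        using step'_nonpos[of "u $ i0"] step_bounds(1)[of "u $ i0"]
        by (intro abs_of_nonpos mult_nonpos_nonneg zero_le_power)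
      then show ?thesis by (simp add: cutoff'_def)
    qed
    have key: "?c * (gden f ?y * \<bar>rad f ?y $ i0\<bar>) \<le> gden (cone_map i0 f) u"
    proof (rule gden_rad_le_gden_cone_map[OF c'(2) Vy(1)[OF u]])
      show "f ?y \<bullet> fd f ?y (axis i 1) = 0" if "i \<noteq> i0" for i
        by (rule collar_boundary_orthogonal[OF c R(2) Vy(1)[OF u] _ that]) simp
      show "0 < gden (cone_map i0 f) u" by (rule param_gden_pos[OF pV u])
    qed
    have g0: "0 \<le> gden f ?y" using param_gden_pos[OF c'(2) Vy(1)[OF u]] by simp
    have "\<bar>N u\<bar> = \<rho> (f ?y) * (real ?k * (?c * (gden f ?y * \<bar>rad f ?y $ i0\<bar>)))"
      unfolding N_def t using Vy(1)[OF u] g0 \<rho>(2) by (simp add: Ph_def hP_def abs_mult)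
    also have "\<dots> \<le> \<rho> (f ?y) * (real ?k * gden (cone_map i0 f) u)"
      using key \<rho>(2) by (intro mult_left_mono) auto
    finally have "\<bar>N u\<bar> \<le> real ?k * (\<rho> (f ?y) * gden (cone_map i0 f) u)" by (simp add: mult_ac)
    then show ?thesis by linarith
  qed
  have NV: "N u = 0" if "u \<notin> V" for u
  proof (cases "drop_coord i0 u \<in> U")
    case True
    then have "u $ i0 \<le> 1 \<or> 2 \<le> u $ i0" using that by (auto simp: V_def)
    then show ?thesis using cutoff'_eq by (simp add: N_def)
  qed (simp add: N_def Ph_def)
  have "ennreal (integral Up G) \<le> ennreal (integral UNIV (\<lambda>u. max 0 (N u)))"
    using le1 le2 by (intro ennreal_leI) linarith
  also have "\<dots> = (\<integral>\<^sup>+u\<in>UNIV. ennreal (max 0 (N u)) \<partial>lborel)"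
    by (rule absolutely_integrable_nonneg_iff(2)[OF mN _ aiN', symmetric]) simp
  also have "\<dots> \<le> (\<integral>\<^sup>+u. ennreal (real ?k) * (ennreal (\<rho> (f (drop_coord i0 u)) * gden (cone_map i0 f) u) * indicator V u) \<partial>lborel)"
  proof (rule nn_integral_mono)
    fix u
    show "ennreal (max 0 (N u)) * indicator UNIV u \<le>
      ennreal (real ?k) * (ennreal (\<rho> (f (drop_coord i0 u)) * gden (cone_map i0 f) u) * indicator V u)"
    proof (cases "u \<in> V")
      case True
      have "ennreal (max 0 (N u)) \<le> ennreal (real ?k * (\<rho> (f (drop_coord i0 u)) * gden (cone_map i0 f) u))"
        by (rule ennreal_leI[OF pt[OF True]])
      also have "\<dots> = ennreal (real ?k) * ennreal (\<rho> (f (drop_coord i0 u)) * gden (cone_map i0 f) u)"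
        by (rule ennreal_mult') simp
      finally show ?thesis using True by simp
    qed (simp add: NV)
  qed
  also have "\<dots> = ennreal (real ?k) * (\<integral>\<^sup>+u\<in>V. ennreal (\<rho> (f (drop_coord i0 u)) * gden (cone_map i0 f) u) \<partial>lborel)"
  proof (rule nn_integral_cmult)
    have oV: "open V" by (rule param_open[OF pV])
    have cfd: "continuous_on V (\<lambda>u. f (drop_coord i0 u))"
      by (rule continuous_on_compose2[OF cf linear_continuous_on[OF bounded_linear_drop_coord]]) (use Vy in auto)
    have "\<rho> \<in> borel_measurable borel" by (rule borel_measurable_continuous_onI[OF C1_on_continuous[OF \<rho>(1)]])
    then have "(\<lambda>u. indicator V u * (\<rho> (f (drop_coord i0 u)) * gden (cone_map i0 f) u)) \<in> borel_measurable borel"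
      by (intro borel_measurable_indicator_times[OF cfd gden_continuous[OF pV]]) (use oV in auto)
    then have "(\<lambda>u. ennreal (indicator V u * (\<rho> (f (drop_coord i0 u)) * gden (cone_map i0 f) u))) \<in> borel_measurable borel"
      by (rule measurable_compose[OF _ measurable_ennreal])
    moreover have "ennreal (indicator V u * (\<rho> (f (drop_coord i0 u)) * gden (cone_map i0 f) u)) =
      ennreal (\<rho> (f (drop_coord i0 u)) * gden (cone_map i0 f) u) * indicator V u" for u
      by (simp add: indicator_def)
    ultimately show "(\<lambda>u. ennreal (\<rho> (f (drop_coord i0 u)) * gden (cone_map i0 f) u) * indicator V u) \<in> borel_measurable lborel"
      by simp
  qed
  finally show "ennreal (integral Up G) \<le> ennreal (real CARD('k)) *
      (\<integral>\<^sup>+u\<in>V. ennreal (\<rho> (f (drop_coord i0 u)) * gden (cone_map i0 f) u) \<partial>lborel)" .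
qed

section \<open>Transfer of signed integrals between charts, and auxiliary facts for the
  summation\<close>

lemma absolutely_integrable_bounded_continuous_mult:
  fixes g h :: "'a::euclidean_space \<Rightarrow> real"
  assumes h: "continuous_on S h" "\<And>x. x \<in> S \<Longrightarrow> \<bar>h x\<bar> \<le> B" and S: "S \<in> sets borel" and g: "g absolutely_integrable_on S"
  shows "(\<lambda>x. h x * g x) absolutely_integrable_on S"
proof (rule absolutely_integrable_bounded_measurable_product[OF bilinear_times _ _ _ g])
  show "S \<in> sets lebesgue" using S by simp
  then show "h \<in> borel_measurable (lebesgue_on S)" by (rule continuous_imp_measurable_on_sets_lebesgue[OF h(1)])
  show "bounded (h ` S)" unfolding bounded_iff using h(2) by auto
qed

lemma integral_eq_nn_integrals:
  fixes h :: "'a::euclidean_space \<Rightarrow> real"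
  assumes "h absolutely_integrable_on S"
  shows "integral S h = enn2real (\<integral>\<^sup>+x\<in>S. ennreal (h x) \<partial>lborel) - enn2real (\<integral>\<^sup>+x\<in>S. ennreal (- h x) \<partial>lborel)"
proof -
  have "integral S h = (LINT x:S | lebesgue. h x)" using set_lebesgue_integral_eq_integral(2)[OF assms] by simp
  also have "\<dots> = enn2real (\<integral>\<^sup>+x. ennreal (indicator S x *\<^sub>R h x) \<partial>lebesgue) - enn2real (\<integral>\<^sup>+x. ennreal (- (indicator S x *\<^sub>R h x)) \<partial>lebesgue)"
    using assms unfolding set_lebesgue_integral_def set_integrable_def by (rule real_lebesgue_integral_def)
  also have "(\<integral>\<^sup>+x. ennreal (indicator S x *\<^sub>R h x) \<partial>lebesgue) = (\<integral>\<^sup>+x\<in>S. ennreal (h x) \<partial>lborel)"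
    unfolding nn_integral_completion by (rule nn_integral_cong) (simp add: indicator_def)
  also have "(\<integral>\<^sup>+x. ennreal (- (indicator S x *\<^sub>R h x)) \<partial>lebesgue) = (\<integral>\<^sup>+x\<in>S. ennreal (- h x) \<partial>lborel)"
    unfolding nn_integral_completion by (rule nn_integral_cong) (simp add: indicator_def)
  finally show ?thesis .
qed

text \<open>Since \<open>ennreal\<close> cuts off negative values, the equality concerns the
  positive part of \<Psi>. Both integrals reduce to the overlap, where
  \<open>nn_integral_reparametrise\<close> identifies them.\<close>

lemma nn_integral_overlap:
  fixes f g :: "real^'k \<Rightarrow> real^'n" and \<Psi> :: "real^'n \<Rightarrow> real"
  assumes A: "pchart M f U W \<kappa>" and B: "pchart M g V W' \<kappa>'" and M: "M \<in> sets borel"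
    and c: "continuous_on (M \<inter> (W \<inter> W')) \<Psi>" and z: "\<And>x. x \<in> M - (W \<inter> W') \<Longrightarrow> \<Psi> x = 0"
  shows "(\<integral>\<^sup>+v\<in>V. ennreal (\<Psi> (g v) * gden g v) \<partial>lborel) = (\<integral>\<^sup>+u\<in>U. ennreal (\<Psi> (f u) * gden f u) \<partial>lborel)"
proof -
  let ?B = "M \<inter> (W \<inter> W')"
  have bB: "?B \<in> sets borel" by (intro sets.Int M borel_open open_Int pchart_open[OF A] pchart_open[OF B])
  define F where "F x = indicator ?B x *\<^sub>R max 0 (\<Psi> x)" for x
  have F: "F \<in> borel_measurable borel" unfolding F_def[abs_def]
    by (rule borel_measurable_continuous_on_indicator[OF bB]) (intro continuous_on_max continuous_on_const c)
  have Fn: "0 \<le> F x" for x by (simp add: F_def)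
  have e: "ennreal (\<Psi> x * r) = ennreal (F x * r)" if "x \<in> M" "0 \<le> r" for x r
  proof (cases "x \<in> W \<inter> W'")
    case True
    show ?thesis
    proof (cases "0 \<le> \<Psi> x")
      case True
      then show ?thesis using \<open>x \<in> W \<inter> W'\<close> that by (simp add: F_def)
    next
      case False
      then have "\<Psi> x * r \<le> 0" using that(2) by (simp add: mult_nonpos_nonneg)
      then show ?thesis using False by (simp add: F_def ennreal_neg)
    qed
  next
    case False
    then show ?thesis using z[of x] that by (auto simp: F_def)
  qed
  note pf = pchart_param[OF A] and pg = pchart_param[OF B]
  have imf: "f ` U = M \<inter> W" and img: "g ` V = M \<inter> W'" using pchart_image[OF A] pchart_image[OF B] by auto
  define T where "T = {v \<in> V. g v \<in> W}"
  have T: "T \<in> sets borel" "T \<subseteq> V" "g ` T \<subseteq> W"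
  proof -
    have "open T" unfolding T_def
      using continuous_open_preimage[OF param_continuous[OF pg] param_open[OF pg] pchart_open[OF A]]
      by (simp add: vimage_def Int_def)
    then show "T \<in> sets borel" by simp
  qed (auto simp: T_def)
  have "(\<integral>\<^sup>+v\<in>V. ennreal (\<Psi> (g v) * gden g v) \<partial>lborel) = (\<integral>\<^sup>+v\<in>T. ennreal (F (g v) * gden g v) \<partial>lborel)"
  proof (rule nn_integral_cong)
    fix v
    show "ennreal (\<Psi> (g v) * gden g v) * indicator V v = ennreal (F (g v) * gden g v) * indicator T v"
    proof (cases "v \<in> V")
      case True
      then have "ennreal (\<Psi> (g v) * gden g v) = ennreal (F (g v) * gden g v)"
        using img param_gden_pos[OF pg True] by (intro e) auto
      moreover have "F (g v) = 0" if "v \<notin> T" using that True by (simp add: T_def F_def)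
      ultimately show ?thesis using True by (cases "v \<in> T") auto
    qed (simp add: T_def)
  qed
  also have "\<dots> = (\<integral>\<^sup>+u\<in>{u \<in> U. f u \<in> g ` T}. ennreal (F (f u) * gden f u) \<partial>lborel)"
    by (rule nn_integral_reparametrise(2)[OF A pg _ T F Fn]) (use img in auto)
  also have "\<dots> = (\<integral>\<^sup>+u\<in>U. ennreal (\<Psi> (f u) * gden f u) \<partial>lborel)"
  proof (rule nn_integral_cong)
    fix u
    show "ennreal (F (f u) * gden f u) * indicator {u \<in> U. f u \<in> g ` T} u = ennreal (\<Psi> (f u) * gden f u) * indicator U u"
    proof (cases "u \<in> U")
      case True
      then have "ennreal (\<Psi> (f u) * gden f u) = ennreal (F (f u) * gden f u)"
        using imf param_gden_pos[OF pf True] by (intro e) auto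
      moreover have "F (f u) = 0" if n: "f u \<notin> g ` T"
      proof -
        have "f u \<in> M \<inter> W" using imf True by blast
        have "f u \<notin> W'"
        proof
          assume "f u \<in> W'"
          then have "f u \<in> g ` V" unfolding img using \<open>f u \<in> M \<inter> W\<close> by blast
          then have "f u \<in> g ` T" using \<open>f u \<in> M \<inter> W\<close> by (auto simp: T_def)
          then show False using n by blast
        qed
        then show ?thesis by (simp add: F_def)
      qed
      ultimately show ?thesis using True by (cases "f u \<in> g ` T") auto
    qed simp
  qed
  finally show ?thesis .
qed

text \<open>The previous lemma is applied to \<Psi> and to its negative, which yields the positive
  and the negative part of the integral.\<close>

lemma integral_overlap:
  fixes f g :: "real^'k \<Rightarrow> real^'n" and \<Psi> :: "real^'n \<Rightarrow> real"
  assumes A: "pchart M f U W \<kappa>" and B: "pchart M g V W' \<kappa>'" and M: "M \<in> sets borel"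
    and c: "continuous_on (M \<inter> (W \<inter> W')) \<Psi>" and z: "\<And>x. x \<in> M - (W \<inter> W') \<Longrightarrow> \<Psi> x = 0"
    and i: "(\<lambda>v. \<Psi> (g v) * gden g v) absolutely_integrable_on V" "(\<lambda>u. \<Psi> (f u) * gden f u) absolutely_integrable_on U"
  shows "integral V (\<lambda>v. \<Psi> (g v) * gden g v) = integral U (\<lambda>u. \<Psi> (f u) * gden f u)"
proof -
  have 1: "(\<integral>\<^sup>+v\<in>V. ennreal (\<Psi> (g v) * gden g v) \<partial>lborel) = (\<integral>\<^sup>+u\<in>U. ennreal (\<Psi> (f u) * gden f u) \<partial>lborel)"
    by (rule nn_integral_overlap[OF A B M c z])
  have "(\<integral>\<^sup>+v\<in>V. ennreal (- \<Psi> (g v) * gden g v) \<partial>lborel) = (\<integral>\<^sup>+u\<in>U. ennreal (- \<Psi> (f u) * gden f u) \<partial>lborel)"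
    by (rule nn_integral_overlap[OF A B M, of "\<lambda>x. - \<Psi> x"]) (use c z in \<open>auto intro: continuous_on_minus\<close>)
  then show ?thesis unfolding integral_eq_nn_integrals[OF i(1)] integral_eq_nn_integrals[OF i(2)] using 1 by simp
qed

text \<open>On a closed box around \<open>x\<close> the integral is squeezed to 0, and there a
  nonnegative continuous function with integral 0 vanishes.\<close>

lemma nonneg_continuous_integral_zero:
  fixes h :: "'a::euclidean_space \<Rightarrow> real"
  assumes h: "continuous_on S h" "open S" "\<And>x. x \<in> S \<Longrightarrow> 0 \<le> h x" "h integrable_on S" "integral S h = 0" and x: "x \<in> S"
  shows "h x = 0"
proof -
  obtain a b where ab: "x \<in> box a b" "cbox a b \<subseteq> S"
    using open_contains_cbox[OF h(2) x] by metis
  have ih: "h integrable_on cbox a b" by (rule integrable_continuous[OF continuous_on_subset[OF h(1) ab(2)]])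
  have "integral (cbox a b) h \<le> integral S h"
    by (rule integral_subset_le[OF ab(2) ih h(4)]) (use h(3) in blast)
  moreover have "0 \<le> integral (cbox a b) h" by (rule integral_nonneg[OF ih]) (use h(3) ab(2) in blast)
  ultimately have "(h has_integral 0) (cbox a b)" using h(5) ih by (metis integrable_integral order_antisym)
  then show ?thesis
    using has_integral_0_cbox_imp_0[of a b h x] continuous_on_subset[OF h(1) ab(2)] h(3) ab box_subset_cbox by blast
qed

text \<open>The slice charts at all other points of \<open>K\<close> avoid \<gamma>, so \<gamma> is
  what remains of a compact set after open sets are removed.\<close>

lemma closed_boundary:
  assumes s: "submanifold_with_boundary d K \<gamma>" and K: "compact K"
  shows "closed \<gamma>"
proof -
  let ?C = "{W. open W \<and> W \<inter> \<gamma> = {}}"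
  have g: "\<gamma> \<subseteq> K" using s by (simp add: submanifold_with_boundary_def)
  have int: "\<exists>W. p \<in> W \<and> open W \<and> W \<inter> \<gamma> = {}" if p: "p \<in> K - \<gamma>" for p
  proof -
    have "\<exists>W \<phi> L. p \<in> W \<and> C1_diffeo_on \<phi> W \<and> subspace L \<and> dim L = d \<and> W \<inter> \<gamma> = {} \<and> \<phi> ` (K \<inter> W) = \<phi> ` W \<inter> L"
      using s p by (simp only: submanifold_with_boundary_def)
    then show ?thesis unfolding C1_diffeo_on_def by blast
  qed
  have "\<gamma> = K \<inter> - \<Union>?C"
  proof (intro equalityI subsetI)
    fix p assume p: "p \<in> K \<inter> - \<Union>?C"
    show "p \<in> \<gamma>"
    proof (rule ccontr)
      assume "p \<notin> \<gamma>"
      then obtain W where "p \<in> W" "open W" "W \<inter> \<gamma> = {}"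
        using int[of p] p by blast
      then show False using p by blast
    qed
  qed (use g in blast)
  moreover have "closed (K \<inter> - \<Union>?C)"
    by (intro closed_Int compact_imp_closed[OF K] closed_Compl open_Union) blast
  ultimately show ?thesis by (rule ssubst)
qed

lemma cone_map_normalise:
  assumes c: "collar_chart i0 K \<gamma> W U f \<kappa>" and R: "0 < R" "\<gamma> \<subseteq> sphere 0 R"
    and u: "1 < u $ i0" "u $ i0 < 2" "drop_coord i0 u \<in> U"
  shows "(R / norm (cone_map i0 f u)) *\<^sub>R cone_map i0 f u = f (drop_coord i0 u)"
proof -
  have "\<gamma> \<inter> W = f ` {u \<in> U. u $ i0 = 0}" using c unfolding collar_chart_def by auto
  then have "f (drop_coord i0 u) \<in> \<gamma>" using u(3) by (metis (mono_tags, lifting) IntD1 drop_coord_nth image_eqI mem_Collect_eq)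
  then have "norm (f (drop_coord i0 u)) = R" using R(2) by auto
  moreover have "0 < step (u $ i0)" by (rule step_pos[OF u(2)])
  ultimately show ?thesis using R(1) by (simp add: cone_map_def)
qed

text \<open>Negative terms count as 0 on the right but lower the sum on the left.\<close>

lemma ennreal_sum_le:
  assumes "finite I" shows "ennreal (\<Sum>i\<in>I. g i) \<le> (\<Sum>i\<in>I. ennreal (g i))"
proof -
  have "ennreal (\<Sum>i\<in>I. g i) \<le> ennreal (\<Sum>i\<in>I. max 0 (g i))" by (intro ennreal_leI sum_mono) auto
  also have "\<dots> = (\<Sum>i\<in>I. ennreal (max 0 (g i)))" by (rule sum_ennreal[symmetric]) simp
  also have "\<dots> = (\<Sum>i\<in>I. ennreal (g i))" by (intro sum.cong refl) (simp add: max_def ennreal_neg)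
  finally show ?thesis .
qed

section \<open>The position vector is tangent\<close>

text \<open>Summed over a partition of unity, the flux inequalities say that \<open>k\<close> times
  the volume of \<open>M\<close>, plus the truncated normal part with its factor, is at most
  \<open>k\<close> times the volume of the cone. With \<open>M \<union> \<gamma>\<close> as
  competitor of the minimising cone, nothing is left for the normal part.\<close>

lemma minimal_tangent_position:
  fixes f0 :: "real^'k \<Rightarrow> real^'n"
  assumes M: "minimal_submanifold TYPE('k) M" and hb: "has_boundary CARD('k) M \<gamma>"
    and R: "0 < R" "\<gamma> \<subseteq> sphere 0 R" and em: "euclidean_minimising TYPE('k) (radial_cone \<gamma>) \<gamma>"
    and ch0: "pchart M f0 U0 W0 \<kappa>0" and u0: "u0 \<in> U0"
  shows "tpart f0 u0 = f0 u0"
proof -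
  let ?k = "CARD('k)"
  \<comment> \<open>Any coordinate can serve as the normal one.\<close>
  define i0 :: 'k where "i0 = undefined"
  let ?K = "M \<union> \<gamma>"
  have dj: "M \<inter> \<gamma> = {}" and cK: "compact ?K" and sub: "submanifold_with_boundary ?k ?K \<gamma>"
    using hb unfolding has_boundary_def by auto
  have cl: "closed \<gamma>" by (rule closed_boundary[OF sub cK])
  have bM: "M \<in> sets borel"
  proof -
    have "M = ?K - \<gamma>" using dj by blast
    moreover have "?K - \<gamma> \<in> sets borel" using compact_imp_closed[OF cK] cl by (intro sets.Diff borel_closed)
    ultimately show ?thesis by simp
  qed
  have "\<exists>W U (f :: real^'k \<Rightarrow> real^'n) \<kappa>. p \<in> W \<and> collar_chart i0 ?K \<gamma> W U f \<kappa>" if "p \<in> ?K" for p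
    by (rule collar_chart_exists[OF sub that])
  then obtain Wp Up fp \<kappa>p where cp: "\<And>p. p \<in> ?K \<Longrightarrow> p \<in> Wp p"
    "\<And>p. p \<in> ?K \<Longrightarrow> collar_chart i0 ?K \<gamma> (Wp p) (Up p) (fp p :: real^'k \<Rightarrow> real^'n) (\<kappa>p p)"
    by metis
  have oW: "open (Wp p)" if "p \<in> ?K" for p using cp(2)[OF that] unfolding collar_chart_def by blast
  obtain N :: nat and p \<rho> Gn where \<rho>: "\<And>i. i < N \<Longrightarrow> p i \<in> ?K" "\<And>i. C1_on (\<rho> i :: real^'n \<Rightarrow> real) UNIV"
    "\<And>i x. 0 \<le> \<rho> i x" "\<And>i. i < N \<Longrightarrow> compact (closure {x. \<rho> i x \<noteq> 0})"
    "\<And>i. i < N \<Longrightarrow> closure {x. \<rho> i x \<noteq> 0} \<subseteq> Wp (p i)" "open Gn" "?K \<subseteq> Gn"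
    "\<And>x. x \<in> Gn \<Longrightarrow> (\<Sum>i<N. \<rho> i x) = 1" "\<And>x. (\<Sum>i<N. \<rho> i x) \<le> 1"
    by (rule C1_partition_of_unity[OF cK, where W=Wp]) (erule oW, erule cp(1), rule that, assumption+)
  define W U f \<kappa> where "W i = Wp (p i)" and "U i = Up (p i)" and "f i = fp (p i)" and "\<kappa> i = \<kappa>p (p i)" for i
  have cc: "collar_chart i0 ?K \<gamma> (W i) (U i) (f i) (\<kappa> i)" if "i < N" for i
    unfolding W_def U_def f_def \<kappa>_def by (rule cp(2)[OF \<rho>(1)[OF that]])
  have \<rho>W: "closure {x. \<rho> i x \<noteq> 0} \<subseteq> W i" if "i < N" for i unfolding W_def by (rule \<rho>(5)[OF that])
  have \<rho>1: "\<rho> i x \<le> 1" if "i < N" for i x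
  proof -
    have "\<rho> i x \<le> (\<Sum>i<N. \<rho> i x)" by (rule member_le_sum) (use that \<rho>(3) in auto)
    then show ?thesis using \<rho>(9)[of x] by linarith
  qed
  have \<rho>0: "\<rho> i x = 0" "fd (\<rho> i) x = (\<lambda>_. 0)" if "i < N" "x \<notin> W i" for i x
  proof -
    have "x \<notin> closure {x. \<rho> i x \<noteq> 0}" using \<rho>W[OF that(1)] that(2) by blast
    then show "\<rho> i x = 0" "fd (\<rho> i) x = (\<lambda>_. 0)" using fd_eq_zero[of x "\<rho> i"] by blast+
  qed
  have m\<rho>: "\<rho> i \<in> borel_measurable borel" for i
    by (rule borel_measurable_continuous_onI[OF C1_on_continuous[OF \<rho>(2)]])
  define P where "P i = {u \<in> U i. 0 < u $ i0}" for i
  have ch: "pchart M (f i) (P i) (W i) (\<kappa> i)" if "i < N" for i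
    unfolding P_def by (rule collar_chart_interior[OF cc[OF that] dj])
  define V where "V i = {u. 1 < u $ i0 \<and> u $ i0 < 2 \<and> drop_coord i0 u \<in> U i}" for i
  define mq where "mq i u = min 1 (((norm (f i u))\<^sup>2 - (norm (tpart (f i) u))\<^sup>2) / (1 - (norm (f i u))\<^sup>2))" for i u
  define h where "h i j u = gden (f i) u * fd (\<rho> j) (f i u) (tpart (f i) u)" for i j u
  define B where "B i u = gden (f i) u * \<rho> i (f i u)" for i u
  define G where "G i u = gden (f i) u * (fd (\<rho> i) (f i u) (tpart (f i) u) + \<rho> i (f i u) * (real ?k + 2 * real ?k * mq i u))" for i u
  define cv where "cv i = (\<integral>\<^sup>+u\<in>V i. ennreal (\<rho> i (f i (drop_coord i0 u)) * gden (cone_map i0 (f i)) u) \<partial>lborel)" for i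
  have ai: "G i absolutely_integrable_on P i" "h i i absolutely_integrable_on P i" "B i absolutely_integrable_on P i"
      "(\<lambda>u. B i u * mq i u) absolutely_integrable_on P i" 
      "ennreal (integral (P i) (G i)) \<le> ennreal (real ?k) * cv i" if "i < N" for i
    using flux_inequality[OF M cK cl dj cc[OF that] R \<rho>(2,3) \<rho>(4)[OF that] \<rho>W[OF that]]
    unfolding G_def h_def B_def cv_def P_def V_def mq_def by blast+
  have parP: "C1_parametrisation (f i) (P i)" if "i < N" for i by (rule pchart_param[OF ch[OF that]])
  have oP: "open (P i)" if "i < N" for i by (rule param_open[OF parP[OF that]])
  have fM: "f i u \<in> M \<and> f i u \<in> W i" if "i < N" "u \<in> P i" for i u
    using pchart_image[OF ch[OF that(1)]] that(2) by blast
  have Bnn: "0 \<le> B i u" if "i < N" "u \<in> P i" for i u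
    using param_gden_pos[OF parP[OF that(1)] that(2)] \<rho>(3) by (simp add: B_def)
  have Mball: "M \<subseteq> ball 0 1" using M unfolding minimal_submanifold_def by blast
  have mq0: "0 \<le> mq i u" if "i < N" "u \<in> P i" for i u
  proof -
    have "norm (f i u) < 1" using fM[OF that] Mball by auto
    then have "0 < 1 - (norm (f i u))\<^sup>2" by (simp add: power_less_one_iff abs_square_less_1)
    then show ?thesis using tpart_pythagoras[OF parP[OF that(1)] that(2)] by (simp add: mq_def)
  qed
  \<comment> \<open>\<open>I i\<close> is the share of chart \<open>i\<close> in the volume of
    \<open>M\<close>, and \<open>m i\<close> its share in the truncated normal part.\<close>
  define I where "I i = integral (P i) (B i)" for i
  define m where "m i = integral (P i) (\<lambda>u. B i u * mq i u)" for i
  have I0: "0 \<le> I i" if "i < N" for i unfolding I_def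
    by (rule integral_nonneg) (use ai(3)[OF that] Bnn[OF that] in \<open>auto simp: absolutely_integrable_on_def\<close>)
  have m0: "0 \<le> m i" if "i < N" for i unfolding m_def
    by (rule integral_nonneg) (use ai(4)[OF that] Bnn[OF that] mq0[OF that] in \<open>auto simp: absolutely_integrable_on_def\<close>)
  have split: "integral (P i) (G i) = integral (P i) (h i i) + real ?k * I i + 2 * real ?k * m i" if "i < N" for i
  proof -
    have i1: "h i i integrable_on P i" "B i integrable_on P i" "(\<lambda>u. B i u * mq i u) integrable_on P i"
      using ai[OF that] by (simp_all add: absolutely_integrable_on_def)
    have "((\<lambda>u. h i i u + real ?k * B i u + 2 * real ?k * (B i u * mq i u)) has_integral
       integral (P i) (h i i) + real ?k * I i + 2 * real ?k * m i) (P i)"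
      unfolding I_def m_def by (intro has_integral_add has_integral_mult_right integrable_integral i1)
    moreover have "h i i u + real ?k * B i u + 2 * real ?k * (B i u * mq i u) = G i u" for u
      by (simp add: h_def B_def G_def distrib_left mult_ac)
    ultimately show ?thesis by (simp add: integral_unique)
  qed
  \<comment> \<open>The derivatives of the partition functions add up to 0 on \<open>M\<close>, but
    the integrals are taken in different charts. With the partition inserted a second time, each
    product of \<open>\<rho> i\<close> and the derivative of \<open>\<rho> j\<close> moves from
    chart \<open>j\<close> to chart \<open>i\<close>, where the sum over \<open>j\<close> can be
    formed under the integral.\<close>
  have sumh: "(\<Sum>j<N. integral (P j) (h j j)) = 0"
  proof -
    have Bd: "\<exists>C. \<forall>u\<in>P i. \<bar>fd (\<rho> j) (f i u) (tpart (f i) u)\<bar> \<le> C" if i: "i < N" and j: "j < N" for i j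
    proof -
      obtain C where C: "0 \<le> C" "\<And>x v. norm (fd (\<rho> j) x v) \<le> C * norm v"
        using C1_compact_support_bounds[OF \<rho>(2) \<rho>(4)[OF j]] by metis
      have "\<bar>fd (\<rho> j) (f i u) (tpart (f i) u)\<bar> \<le> C * 1" if u: "u \<in> P i" for u
      proof -
        have "(norm (tpart (f i) u))\<^sup>2 \<le> (norm (f i u))\<^sup>2" using tpart_pythagoras[OF parP[OF \<open>i < N\<close>] u] by simp
        then have "norm (tpart (f i) u) \<le> norm (f i u)" by (rule power2_le_imp_le) simp
        also have "\<dots> \<le> 1" using fM[OF \<open>i < N\<close> u] Mball by auto
        finally have "C * norm (tpart (f i) u) \<le> C * 1" using C(1) by (intro mult_left_mono)
        then show ?thesis using C(2)[of "f i u" "tpart (f i) u"] by simp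
      qed
      then show ?thesis by blast
    qed
    have cfd: "continuous_on (P i) (\<lambda>u. fd (\<rho> j) (f i u) (tpart (f i) u))" if "i < N" for i j
    proof -
      have C: "C1_on (\<lambda>u. \<rho> j (f i u)) (P i)" by (rule C1_on_compose[OF param_C1[OF parP[OF that]] \<rho>(2)]) simp
      have "continuous_on (P i) (\<lambda>u. fd (\<lambda>u. \<rho> j (f i u)) u (rad (f i) u))"
        by (rule C1_on_continuous_fd[OF C rad_continuous[OF parP[OF that]]])
      moreover have "fd (\<lambda>u. \<rho> j (f i u)) u (rad (f i) u) = fd (\<rho> j) (f i u) (tpart (f i) u)" if u: "u \<in> P i" for u
        using fdI[OF has_derivative_compose[OF param_has_derivative[OF parP[OF \<open>i < N\<close>] u] C1_on_has_derivative[OF \<rho>(2) UNIV_I]]]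
        by (simp add: tpart_eq[OF parP[OF \<open>i < N\<close>] u])
      ultimately show ?thesis by (simp cong: continuous_on_cong)
    qed
    have c\<rho>f: "continuous_on (P i) (\<lambda>u. \<rho> j (f i u))" if "i < N" for i j
      by (rule continuous_on_compose2[OF C1_on_continuous[OF \<rho>(2)] param_continuous[OF parP[OF that]]]) simp
    have bP: "P i \<in> sets borel" if "i < N" for i using oP[OF that] by simp
    have ai1: "(\<lambda>v. \<rho> i (f j v) * h j j v) absolutely_integrable_on P j" if "i < N" "j < N" for i j
      by (rule absolutely_integrable_bounded_continuous_mult[OF c\<rho>f[OF that(2)] _ bP[OF that(2)] ai(2)[OF that(2)], of _ 1])
         (use \<rho>(3) \<rho>1[OF that(1)] in auto)
    have ai2: "(\<lambda>u. \<rho> i (f i u) * h i j u) absolutely_integrable_on P i" if i: "i < N" and j: "j < N" for i j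
    proof -
      obtain C where "\<And>u. u \<in> P i \<Longrightarrow> \<bar>fd (\<rho> j) (f i u) (tpart (f i) u)\<bar> \<le> C" using Bd[OF i j] by blast
      from absolutely_integrable_bounded_continuous_mult[OF cfd[OF i] this bP[OF i] ai(3)[OF i]]
      show ?thesis by (simp add: B_def h_def mult_ac)
    qed
    have swap: "integral (P j) (\<lambda>v. \<rho> i (f j v) * h j j v) = integral (P i) (\<lambda>u. \<rho> i (f i u) * h i j u)"
      if i: "i < N" and j: "j < N" for i j
    proof -
      \<comment> \<open>A function on \<open>M\<close> itself: the tangential part is computed in
        chart \<open>i\<close>, and by \<open>transition\<close> it agrees with that of chart
        \<open>j\<close> on the overlap.\<close>
      define \<Psi> where "\<Psi> x = \<rho> i x * fd (\<rho> j) x (tpart (f i) (\<kappa> i x))" for x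
      have e1: "\<Psi> (f i u) * gden (f i) u = \<rho> i (f i u) * h i j u" if "u \<in> P i" for u
        using pchart_inverse[OF ch[OF i] that] by (simp add: \<Psi>_def h_def)
      have e2: "\<Psi> (f j v) * gden (f j) v = \<rho> i (f j v) * h j j v" if v: "v \<in> P j" for v
      proof (cases "f j v \<in> W i")
        case True
        have "tpart (f j) v = tpart (f i) (\<kappa> i (f j v))"
          by (rule transition(5)[OF ch[OF i] parP[OF j] _ v True]) (use fM[OF j] in blast)
        then show ?thesis by (simp add: \<Psi>_def h_def)
      next
        case False
        then show ?thesis using \<rho>0(1)[OF i False] by (simp add: \<Psi>_def)
      qed
      have "integral (P j) (\<lambda>v. \<Psi> (f j v) * gden (f j) v) = integral (P i) (\<lambda>u. \<Psi> (f i u) * gden (f i) u)"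
      proof (rule integral_overlap[OF ch[OF i] ch[OF j] bM])
        show "continuous_on (M \<inter> (W i \<inter> W j)) \<Psi>"
        proof -
          have "\<kappa> i ` (M \<inter> W i) \<subseteq> P i"
            unfolding pchart_image[OF ch[OF i], symmetric] using pchart_inverse[OF ch[OF i]] by auto
          moreover have "continuous_on (M \<inter> W i) (\<kappa> i)"
            using ch[OF i] unfolding pchart_def
            by (intro continuous_at_imp_continuous_on ballI differentiable_imp_continuous_within) auto
          ultimately have "continuous_on (M \<inter> W i) (\<lambda>x. tpart (f i) (\<kappa> i x))"
            by (intro continuous_on_compose2[OF tpart_continuous[OF parP[OF i]]])
          then have "continuous_on (M \<inter> (W i \<inter> W j)) (\<lambda>x. tpart (f i) (\<kappa> i x))"
            by (rule continuous_on_subset) auto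
          then show ?thesis unfolding \<Psi>_def[abs_def]
            by (intro continuous_on_mult C1_on_continuous_fd[OF C1_on_subset[OF \<rho>(2) subset_UNIV]]
                C1_on_continuous[OF C1_on_subset[OF \<rho>(2) subset_UNIV]])
        qed
        show "\<Psi> x = 0" if "x \<in> M - (W i \<inter> W j)" for x
        proof (cases "x \<in> W i")
          case True
          then have "x \<notin> W j" using that by blast
          then have "fd (\<rho> j) x = (\<lambda>_. 0)" by (rule \<rho>0(2)[OF j])
          then show ?thesis by (simp add: \<Psi>_def)
        next
          case False
          then have "\<rho> i x = 0" by (rule \<rho>0(1)[OF i])
          then show ?thesis by (simp add: \<Psi>_def)
        qed
        show "(\<lambda>v. \<Psi> (f j v) * gden (f j) v) absolutely_integrable_on P j"
          using ai1[OF i j] by (rule set_integrable_cong[THEN iffD2, rotated -1]) (use e2 in auto)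
        show "(\<lambda>u. \<Psi> (f i u) * gden (f i) u) absolutely_integrable_on P i"
          using ai2[OF i j] by (rule set_integrable_cong[THEN iffD2, rotated -1]) (use e1 in auto)
      qed
      then show ?thesis using integral_cong[of "P j", OF e2] integral_cong[of "P i", OF e1] by simp
    qed
    have one: "(\<Sum>i<N. \<rho> i x) = 1" if "x \<in> M" for x using \<rho>(7,8) that by blast
    have "integral (P j) (h j j) = (\<Sum>i<N. integral (P j) (\<lambda>v. \<rho> i (f j v) * h j j v))" if j: "j < N" for j
    proof -
      have "integral (P j) (h j j) = integral (P j) (\<lambda>v. \<Sum>i<N. \<rho> i (f j v) * h j j v)"
      proof (rule integral_cong)
        fix v assume "v \<in> P j"
        then have "(\<Sum>i<N. \<rho> i (f j v)) = 1" using one fM[OF j] by blast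
        then show "h j j v = (\<Sum>i<N. \<rho> i (f j v) * h j j v)" by (simp add: sum_distrib_right[symmetric])
      qed
      also have "\<dots> = (\<Sum>i<N. integral (P j) (\<lambda>v. \<rho> i (f j v) * h j j v))"
        by (rule integral_sum) (use ai1[OF _ j] in \<open>auto simp: absolutely_integrable_on_def\<close>)
      finally show ?thesis .
    qed
    then have "(\<Sum>j<N. integral (P j) (h j j)) = (\<Sum>j<N. \<Sum>i<N. integral (P j) (\<lambda>v. \<rho> i (f j v) * h j j v))"
      by (intro sum.cong) auto
    also have "\<dots> = (\<Sum>j<N. \<Sum>i<N. integral (P i) (\<lambda>u. \<rho> i (f i u) * h i j u))"
      by (intro sum.cong refl swap) auto
    also have "\<dots> = (\<Sum>i<N. \<Sum>j<N. integral (P i) (\<lambda>u. \<rho> i (f i u) * h i j u))" by (rule sum.swap)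
    also have "\<dots> = (\<Sum>i<N. integral (P i) (\<lambda>u. \<Sum>j<N. \<rho> i (f i u) * h i j u))"
      by (intro sum.cong refl integral_sum[symmetric]) (use ai2 in \<open>auto simp: absolutely_integrable_on_def\<close>)
    also have "\<dots> = (\<Sum>i<N. 0)"
    proof (intro sum.cong refl)
      fix i assume "i \<in> {..<N}"
      then have i: "i < N" by simp
      have "(\<Sum>j<N. \<rho> i (f i u) * h i j u) = 0" if u: "u \<in> P i" for u
      proof -
        have x: "f i u \<in> Gn" using fM[OF i u] \<rho>(7) by blast
        have "((\<lambda>x. \<Sum>j<N. \<rho> j x) has_derivative (\<lambda>v. \<Sum>j<N. fd (\<rho> j) (f i u) v)) (at (f i u))"
          by (intro has_derivative_sum C1_on_has_derivative[OF \<rho>(2) UNIV_I])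
        moreover have "((\<lambda>x. \<Sum>j<N. \<rho> j x) has_derivative (\<lambda>_. 0)) (at (f i u))"
          by (rule has_derivative_transform_within_open[OF has_derivative_const[of 1] \<rho>(6) x]) (simp add: \<rho>(8))
        ultimately have "(\<lambda>v. \<Sum>j<N. fd (\<rho> j) (f i u) v) = (\<lambda>_. 0)" by (rule has_derivative_unique)
        then have "(\<Sum>j<N. fd (\<rho> j) (f i u) (tpart (f i) u)) = 0" by metis
        then show ?thesis by (simp add: h_def sum_distrib_left[symmetric])
      qed
      then show "integral (P i) (\<lambda>u. \<Sum>j<N. \<rho> i (f i u) * h i j u) = 0"
        using integral_cong[of "P i" "\<lambda>u. \<Sum>j<N. \<rho> i (f i u) * h i j u" "\<lambda>_. 0"] by simp
    qed
    finally show ?thesis by simp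
  qed
  have vd1: "volume_density (\<lambda>_. 1) g u = gden g u" for g :: "real^'k \<Rightarrow> real^'n" and u
    by (simp add: volume_density_eq)
  \<comment> \<open>No parametrisation inside \<open>M \<union> \<gamma>\<close> touches \<gamma>,
    so charts of \<open>M\<close> alone bound its volume. The bound is a finite real, which permits
    the subtraction at the end.\<close>
  have volK: "euclidean_volume TYPE('k) ?K \<le> ennreal (\<Sum>i<N. I i)"
  proof -
    have "kvolume TYPE('k) (\<lambda>_. 1) ?K \<le> kvolume TYPE('k) (\<lambda>_. 1) M"
    proof (rule kvolume_mono_param)
      fix g :: "real^'k \<Rightarrow> real^'n" and T assume "C1_parametrisation g T" "g ` T \<subseteq> ?K"
      then show "g ` T \<subseteq> M" using param_avoids_boundary[OF sub] by blast
    qed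
    also have "\<dots> \<le> (\<Sum>j<N. \<integral>\<^sup>+u\<in>P j. ennreal (\<rho> j (f j u) * volume_density (\<lambda>_. 1) (f j) u) \<partial>lborel)"
      by (rule kvolume_le_weighted_sum[OF ch]) (use m\<rho> \<rho>(3,7,8) \<rho>0(1) in auto)
    also have "\<dots> = (\<Sum>j<N. ennreal (I j))"
    proof (intro sum.cong refl)
      fix j assume "j \<in> {..<N}"
      then have j: "j < N" by simp
      have "(\<lambda>u. indicator (P j) u * (\<rho> j (f j u) * gden (f j) u)) \<in> borel_measurable borel"
        by (rule borel_measurable_indicator_times[OF param_continuous[OF parP[OF j]] gden_continuous[OF parP[OF j]] _ _ _ m\<rho>])
           (use oP[OF j] in auto)
      then have m: "(\<lambda>u. indicator (P j) u * B j u) \<in> borel_measurable borel" by (simp add: B_def mult_ac)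
      show "(\<integral>\<^sup>+u\<in>P j. ennreal (\<rho> j (f j u) * volume_density (\<lambda>_. 1) (f j) u) \<partial>lborel) = ennreal (I j)"
        using absolutely_integrable_nonneg_iff(2)[OF m Bnn[OF j] ai(3)[OF j]]
        by (simp add: vd1 I_def B_def mult.commute)
    qed
    also have "\<dots> = ennreal (\<Sum>i<N. I i)" by (rule sum_ennreal) (use I0 in auto)
    finally show ?thesis unfolding euclidean_volume_def .
  qed
  have volC: "(\<Sum>i<N. cv i) \<le> euclidean_volume TYPE('k) (radial_cone \<gamma>)"
  proof -
    \<comment> \<open>Composed with the radial projection to the sphere, the partition functions
      become weights on the cone that are constant along rays.\<close>
    let ?\<rho> = "\<lambda>i x. \<rho> i ((R / norm x) *\<^sub>R x)"
    have "(\<Sum>j<N. \<integral>\<^sup>+u\<in>V j. ennreal (?\<rho> j (cone_map i0 (f j) u) * volume_density (\<lambda>_. 1) (cone_map i0 (f j)) u) \<partial>lborel)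
       \<le> kvolume TYPE('k) (\<lambda>_. 1) (radial_cone \<gamma>)"
    proof (rule kvolume_ge_weighted_sum)
      show "pchart (radial_cone \<gamma>) (cone_map i0 (f j)) (V j) {x. x \<noteq> 0 \<and> norm x < R \<and> (R / norm x) *\<^sub>R x \<in> W j}
        (\<lambda>x. \<kappa> j ((R / norm x) *\<^sub>R x) + axis i0 (inv_step (norm x / R)))" if "j < N" for j
        unfolding V_def by (rule cone_chart[OF cc[OF that] R])
      have "(\<lambda>x::real^'n. (R / norm x) *\<^sub>R x) \<in> borel_measurable borel" by measurable
      then show "?\<rho> j \<in> borel_measurable borel" for j by (rule measurable_compose[OF _ m\<rho>])
    qed (use \<rho>(3,9) in auto)
    also have "(\<Sum>j<N. \<integral>\<^sup>+u\<in>V j. ennreal (?\<rho> j (cone_map i0 (f j) u) * volume_density (\<lambda>_. 1) (cone_map i0 (f j)) u) \<partial>lborel) = (\<Sum>i<N. cv i)"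
      unfolding cv_def
    proof (intro sum.cong refl nn_integral_cong)
      fix j u assume "j \<in> {..<N}"
      then have j: "j < N" by simp
      show "ennreal (?\<rho> j (cone_map i0 (f j) u) * volume_density (\<lambda>_. 1) (cone_map i0 (f j)) u) * indicator (V j) u =
         ennreal (\<rho> j (f j (drop_coord i0 u)) * gden (cone_map i0 (f j)) u) * indicator (V j) u"
      proof (cases "u \<in> V j")
        case True
        then show ?thesis using cone_map_normalise[OF cc[OF j] R, of u] by (simp add: V_def vd1)
      qed simp
    qed
    finally show ?thesis unfolding euclidean_volume_def .
  qed
  have "ennreal (\<Sum>i<N. integral (P i) (G i)) \<le> (\<Sum>i<N. ennreal (integral (P i) (G i)))"
    by (rule ennreal_sum_le) simp
  also have "\<dots> \<le> (\<Sum>i<N. ennreal (real ?k) * cv i)" by (rule sum_mono) (use ai(5) in auto)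
  also have "\<dots> = ennreal (real ?k) * (\<Sum>i<N. cv i)" by (simp add: sum_distrib_left)
  also have "\<dots> \<le> ennreal (real ?k) * ennreal (\<Sum>i<N. I i)"
  proof (rule mult_left_mono)
    have "euclidean_volume TYPE('k) (radial_cone \<gamma>) \<le> euclidean_volume TYPE('k) ?K"
      using em cK sub unfolding euclidean_minimising_def by blast
    then show "(\<Sum>i<N. cv i) \<le> ennreal (\<Sum>i<N. I i)" using volC volK by (meson order_trans)
  qed simp
  also have "\<dots> = ennreal (real ?k * (\<Sum>i<N. I i))" by (rule ennreal_mult'[symmetric]) simp
  finally have "ennreal (\<Sum>i<N. integral (P i) (G i)) \<le> ennreal (real ?k * (\<Sum>i<N. I i))" .
  moreover have "0 \<le> real ?k * (\<Sum>i<N. I i)" by (intro mult_nonneg_nonneg sum_nonneg) (use I0 in auto)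
  ultimately have "(\<Sum>i<N. integral (P i) (G i)) \<le> real ?k * (\<Sum>i<N. I i)" by (simp add: ennreal_le_iff)
  moreover have "(\<Sum>i<N. integral (P i) (G i)) = real ?k * (\<Sum>i<N. I i) + 2 * real ?k * (\<Sum>i<N. m i)"
  proof -
    have "(\<Sum>i<N. integral (P i) (G i)) = (\<Sum>i<N. integral (P i) (h i i) + real ?k * I i + 2 * real ?k * m i)"
      by (intro sum.cong refl split) simp
    then show ?thesis using sumh by (simp add: sum.distrib sum_distrib_left)
  qed
  ultimately have "real ?k * (\<Sum>i<N. m i) \<le> 0" by linarith
  then have "(\<Sum>i<N. m i) \<le> 0" by (simp add: mult_le_0_iff)
  moreover have "0 \<le> (\<Sum>i<N. m i)" by (rule sum_nonneg) (use m0 in auto)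
  ultimately have "(\<Sum>i<N. m i) = 0" by linarith
  then have mz: "m i = 0" if "i < N" for i
    using sum_nonneg_eq_0_iff[of "{..<N}" m] m0 that by auto
  \<comment> \<open>A nonnegative continuous integrand with integral 0 vanishes. Where
    \<open>\<rho> i\<close> is nonzero this leaves \<open>mq i u = 0\<close>, and the truncation by
    \<open>min 1\<close> has the same zeros as the quotient.\<close>
  have tf: "tpart (f i) u = f i u" if i: "i < N" and u: "u \<in> P i" and r: "\<rho> i (f i u) \<noteq> 0" for i u
  proof -
    have "B i u * mq i u = 0"
    proof (rule nonneg_continuous_integral_zero[OF _ oP[OF i] _ _ _ u])
      have den: "1 - (norm (f i u))\<^sup>2 \<noteq> 0" if "u \<in> P i" for u
      proof -
        have "norm (f i u) < 1" using fM[OF i that] Mball by auto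
        then have "0 < 1 - (norm (f i u))\<^sup>2" by (simp add: power_less_one_iff abs_square_less_1)
        then show ?thesis by simp
      qed
      show "continuous_on (P i) (\<lambda>u. B i u * mq i u)" unfolding B_def mq_def
        by (intro continuous_on_mult continuous_on_min continuous_on_const continuous_on_divide continuous_on_diff continuous_on_power
            continuous_on_norm param_continuous[OF parP[OF i]] tpart_continuous[OF parP[OF i]] gden_continuous[OF parP[OF i]]
            continuous_on_compose2[OF C1_on_continuous[OF \<rho>(2)] param_continuous[OF parP[OF i]]])
           (use den in auto)
      show "0 \<le> B i u * mq i u" if "u \<in> P i" for u using Bnn[OF i that] mq0[OF i that] by simp
      show "(\<lambda>u. B i u * mq i u) integrable_on P i" using ai(4)[OF i] by (simp add: absolutely_integrable_on_def)
      show "integral (P i) (\<lambda>u. B i u * mq i u) = 0" using mz[OF i] by (simp add: m_def)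
    qed
    moreover have "B i u \<noteq> 0" using r param_gden_pos[OF parP[OF i] u] by (simp add: B_def)
    ultimately have "mq i u = 0" by simp
    then have "((norm (f i u))\<^sup>2 - (norm (tpart (f i) u))\<^sup>2) / (1 - (norm (f i u))\<^sup>2) = 0"
      by (simp add: mq_def min_def split: if_splits)
    moreover have "norm (f i u) < 1" using fM[OF i u] Mball by auto
    then have "1 - (norm (f i u))\<^sup>2 \<noteq> 0" using abs_square_less_1[of "norm (f i u)"] by simp
    ultimately have "(norm (f i u))\<^sup>2 = (norm (tpart (f i) u))\<^sup>2" by simp
    then have "(norm (f i u - tpart (f i) u))\<^sup>2 = 0" using tpart_pythagoras[OF parP[OF i] u] by simp
    then show ?thesis by simp
  qed
  have xM: "f0 u0 \<in> M" using pchart_image[OF ch0] u0 by blast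
  then have "(\<Sum>i<N. \<rho> i (f0 u0)) = 1" using \<rho>(7,8) by blast
  then obtain i where i: "i < N" "\<rho> i (f0 u0) \<noteq> 0"
    by (metis (no_types, lifting) lessThan_iff sum.neutral zero_neq_one)
  then have xW: "f0 u0 \<in> W i" using \<rho>0(1) by blast
  have f0M: "f0 ` U0 \<subseteq> M" using pchart_image[OF ch0] by blast
  \<comment> \<open>Chart independence of \<open>tpart\<close> carries the result from a chart of
    the partition to the given one.\<close>
  note tr = transition[OF ch[OF i(1)] pchart_param[OF ch0] f0M u0 xW]
  show ?thesis using tr(2,5) tf[OF i(1) tr(1)] i(2) by simp
qed

text \<open>With \<open>\<tau> = A \<circ> f\<close> for a left inverse \<open>A\<close> of \<open>Df(u0)\<close>, the reparametrisation \<open>h = f \<circ> \<tau>\<inverse>\<close> satisfies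
  Euler's identity \<open>h y = Dh(y) y\<close> and is therefore homogeneous of degree 1.\<close>

lemma tangent_position_local_cone:
  fixes f :: "real^'k \<Rightarrow> real^'n"
  assumes ch: "pchart M f U W \<kappa>" and t: "\<And>u. u \<in> U \<Longrightarrow> tpart f u = f u" and u0: "u0 \<in> U"
  shows "\<exists>d>0. \<forall>s. \<bar>s - 1\<bar> < d \<longrightarrow> s *\<^sub>R f u0 \<in> M"
proof -
  note p = pchart_param[OF ch]
  have lin: "linear (fd f u0)" using param_has_derivative[OF p u0] has_derivative_linear by blast
  have "inj (fd f u0)" using p u0 unfolding C1_parametrisation_def by blast
  then obtain A where A: "linear A" "A \<circ> fd f u0 = id" using linear_injective_left_inverse[OF lin] by blast
  have bA: "bounded_linear A" using A(1) linear_conv_bounded_linear by blast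
  define \<tau> where "\<tau> u = A (f u)" for u
  have C\<tau>: "C1_on \<tau> U" unfolding \<tau>_def
    by (rule C1_on_compose[OF param_C1[OF p] C1_on_bounded_linear[OF bA, of UNIV]]) simp
  have d\<tau>: "(\<tau> has_derivative (\<lambda>v. A (fd f u v))) (at u)" if "u \<in> U" for u
    unfolding \<tau>_def by (rule bounded_linear.has_derivative[OF bA param_has_derivative[OF p that]])
  obtain \<tau>' where \<tau>': "\<And>u. u \<in> U \<Longrightarrow> (\<tau> has_derivative blinfun_apply (\<tau>' u)) (at u)" "continuous_on U \<tau>'"
    using C\<tau> unfolding C1_on_def by blast
  have \<tau>'A: "blinfun_apply (\<tau>' u) = (\<lambda>v. A (fd f u v))" if "u \<in> U" for u
    using has_derivative_unique[OF \<tau>'(1)[OF that] d\<tau>[OF that]] .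
  \<comment> \<open>The left inverse \<open>A\<close> makes the derivative of \<tau> at
    \<open>u0\<close> the identity, so the identity is the left inverse that
    \<open>inverse_function_theorem\<close> asks for.\<close>
  have id0: "id_blinfun o\<^sub>L \<tau>' u0 = id_blinfun"
    by (rule blinfun_eqI) (use A(2) in \<open>simp add: \<tau>'A[OF u0] fun_eq_iff\<close>)
  obtain U' V g g' where g: "open U'" "U' \<subseteq> U" "u0 \<in> U'" "open V" "\<tau> u0 \<in> V" "homeomorphism U' V \<tau> g"
    "\<And>y. y \<in> V \<Longrightarrow> (g has_derivative (g' y)) (at y)"
    "\<And>y. y \<in> V \<Longrightarrow> g' y = inv (blinfun_apply (\<tau>' (g y)))"
    "\<And>y. y \<in> V \<Longrightarrow> bij (blinfun_apply (\<tau>' (g y)))"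
  proof (rule inverse_function_theorem[OF param_open[OF p] \<tau>'(1) \<tau>'(2) u0 id0])
    fix U' V g g'
    assume "open U'" "U' \<subseteq> U" "u0 \<in> U'" "open V" "\<tau> u0 \<in> V" "homeomorphism U' V \<tau> g"
      "\<And>y. y \<in> V \<Longrightarrow> (g has_derivative (g' y)) (at y)"
      "\<And>y. y \<in> V \<Longrightarrow> g' y = inv (blinfun_apply (\<tau>' (g y)))"
      "\<And>y. y \<in> V \<Longrightarrow> bij (blinfun_apply (\<tau>' (g y)))"
    then show thesis by (rule that)
  qed
  have gU: "g y \<in> U" "\<tau> (g y) = y" if "y \<in> V" for y
    using g(2,6) that unfolding homeomorphism_def by auto
  define h where "h y = f (g y)" for y
  have dh: "(h has_derivative (\<lambda>v. fd f (g y) (g' y v))) (at y)" if "y \<in> V" for y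
    unfolding h_def using has_derivative_compose[OF g(7)[OF that] param_has_derivative[OF p gU(1)[OF that]]] .
  have euler: "fd f (g y) (g' y y) = h y" if y: "y \<in> V" for y
  proof -
    let ?r = "rad f (g y)"
    have hr: "h y = fd f (g y) ?r" using t[OF gU(1)[OF y]] tpart_eq[OF p gU(1)[OF y]] by (simp add: h_def)
    \<comment> \<open>Applying \<open>A\<close> to the tangency relation shows that the derivative
      of \<tau> sends \<open>rad\<close> to \<open>y\<close>; inverting it yields Euler's
      identity.\<close>
    have "y = A (h y)" using gU(2)[OF y] by (simp add: \<tau>_def h_def)
    then have "y = blinfun_apply (\<tau>' (g y)) ?r" using hr \<tau>'A[OF gU(1)[OF y]] by simp
    then have "g' y y = ?r" using g(8,9)[OF y] by (metis bij_inv_eq_iff)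
    then show ?thesis using hr by simp
  qed
  define y where "y = \<tau> u0"
  have hy: "h y = f u0" using g(3,6) unfolding h_def y_def homeomorphism_def by auto
  have "continuous_on UNIV (\<lambda>s::real. s *\<^sub>R y)" by (intro continuous_intros)
  then have "open ((\<lambda>s::real. s *\<^sub>R y) -` V)" by (rule open_vimage[OF g(4)])
  moreover have "1 \<in> (\<lambda>s::real. s *\<^sub>R y) -` V" using g(5) by (simp add: y_def)
  ultimately obtain d0 where d0: "0 < d0" "ball 1 d0 \<subseteq> (\<lambda>s::real. s *\<^sub>R y) -` V"
    using open_contains_ball by blast
  \<comment> \<open>The bound 1 keeps the scaling factors positive, so that division by
    \<open>s\<close> is possible.\<close>
  define d where "d = min d0 1"
  have d: "0 < d" using d0(1) by (simp add: d_def)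
  have inV: "s *\<^sub>R y \<in> V" "0 < s" if "s \<in> ball 1 d" for s :: real
    using that d0(2) by (auto simp: d_def dist_real_def)
  \<comment> \<open>By Euler's identity the quotient has derivative 0 in \<open>s\<close>; this is
    homogeneity of degree 1 along the ray.\<close>
  have "\<exists>c. \<forall>s\<in>ball 1 d. inverse s *\<^sub>R h (s *\<^sub>R y) = c"
  proof (rule has_derivative_zero_constant)
    fix s :: real assume s: "s \<in> ball 1 d"
    note V = inV[OF s]
    have 1: "((\<lambda>s. s *\<^sub>R y) has_derivative (\<lambda>r. r *\<^sub>R y)) (at s)" by (auto intro!: derivative_eq_intros)
    have lg: "linear (\<lambda>v. fd f (g (s *\<^sub>R y)) (g' (s *\<^sub>R y) v))" using dh[OF V(1)] has_derivative_linear by blast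
    have 2: "((\<lambda>s. h (s *\<^sub>R y)) has_derivative (\<lambda>r. fd f (g (s *\<^sub>R y)) (g' (s *\<^sub>R y) (r *\<^sub>R y)))) (at s)"
      using has_derivative_compose[OF 1 dh[OF V(1)]] .
    have "fd f (g (s *\<^sub>R y)) (g' (s *\<^sub>R y) (r *\<^sub>R y)) = (r / s) *\<^sub>R h (s *\<^sub>R y)" for r
    proof -
      have e: "(r / s) *\<^sub>R (s *\<^sub>R y) = r *\<^sub>R y" using V(2) by simp
      show ?thesis using linear_scale[OF lg, of "r / s" "s *\<^sub>R y"] by (simp only: e euler[OF V(1)])
    qed
    with 2 have 3: "((\<lambda>s. h (s *\<^sub>R y)) has_derivative (\<lambda>r. (r / s) *\<^sub>R h (s *\<^sub>R y))) (at s)" by simp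
    have 4: "((\<lambda>s::real. inverse s) has_derivative (\<lambda>r. - (inverse s * r * inverse s))) (at s)"
      using V(2) by (auto intro!: derivative_eq_intros)
    have "((\<lambda>s. inverse s *\<^sub>R h (s *\<^sub>R y)) has_derivative
       (\<lambda>r. inverse s *\<^sub>R ((r / s) *\<^sub>R h (s *\<^sub>R y)) + (- (inverse s * r * inverse s)) *\<^sub>R h (s *\<^sub>R y))) (at s)"
      by (rule has_derivative_scaleR[OF 4 3])
    moreover have "(\<lambda>r. inverse s *\<^sub>R ((r / s) *\<^sub>R h (s *\<^sub>R y)) + (- (inverse s * r * inverse s)) *\<^sub>R h (s *\<^sub>R y)) = (\<lambda>_. 0)"
      by (simp add: fun_eq_iff divide_inverse mult_ac)
    ultimately show "((\<lambda>s. inverse s *\<^sub>R h (s *\<^sub>R y)) has_derivative (\<lambda>h. 0)) (at s within ball 1 d)"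
      by (metis has_derivative_at_withinI)
  qed simp
  then obtain c where c: "\<And>s. s \<in> ball 1 d \<Longrightarrow> inverse s *\<^sub>R h (s *\<^sub>R y) = c" by blast
  have "c = f u0" using c[of 1] d hy by simp
  have "s *\<^sub>R f u0 \<in> M" if "\<bar>s - 1\<bar> < d" for s
  proof -
    have s: "s \<in> ball 1 d" using that by (simp add: dist_real_def abs_minus_commute)
    have "inverse s *\<^sub>R h (s *\<^sub>R y) = f u0" using c[OF s] \<open>c = f u0\<close> by simp
    then have "s *\<^sub>R f u0 = h (s *\<^sub>R y)" using inV(2)[OF s] by (metis scaleR_scaleR right_inverse scaleR_one less_irrefl)
    moreover have "h (s *\<^sub>R y) \<in> M" unfolding h_def using gU(1)[OF inV(1)[OF s]] pchart_image[OF ch] by blast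
    ultimately show ?thesis by simp
  qed
  then show ?thesis using d by blast
qed

section \<open>From local cones to the global cone\<close>

text \<open>The positive scales at which the ray lies in \<open>M\<close> form an open set, and
  since \<open>M \<union> \<gamma>\<close> is closed the ray can leave \<open>M\<close> at a
  positive scale only on \<gamma>. All of \<gamma> lies at distance \<open>R\<close>, so there is
  one exit, beyond \<open>x\<close>, and inward the ray runs to the origin.\<close>

lemma ray_meets_boundary:
  fixes M \<gamma> :: "'a::euclidean_space set"
  assumes lc: "\<And>x. x \<in> M \<Longrightarrow> \<exists>d>0. \<forall>s. \<bar>s - 1\<bar> < d \<longrightarrow> s *\<^sub>R x \<in> M"
    and K: "compact (M \<union> \<gamma>)" and R: "\<gamma> \<subseteq> sphere 0 R" and x: "x \<in> M" "x \<noteq> 0"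
  obtains p where "p \<in> \<gamma>" "x \<in> closed_segment 0 p" "closed_segment 0 p \<subseteq> M \<union> \<gamma>"
proof -
  let ?K = "M \<union> \<gamma>"
  define J where "J = {s::real. 0 < s \<and> s *\<^sub>R x \<in> M}"
  have oJ: "open J"
    unfolding open_dist
  proof (intro ballI)
    fix s assume s: "s \<in> J"
    then obtain d where d: "0 < d" "\<And>r. \<bar>r - 1\<bar> < d \<Longrightarrow> r *\<^sub>R (s *\<^sub>R x) \<in> M" using lc[of "s *\<^sub>R x"] by (auto simp: J_def)
    have s0: "0 < s" using s by (simp add: J_def)
    show "\<exists>e>0. \<forall>t. dist t s < e \<longrightarrow> t \<in> J"
    proof (intro exI[of _ "s * min d 1"] conjI allI impI)
      fix t assume "dist t s < s * min d 1"
      then have t: "\<bar>t - s\<bar> < s * d" "\<bar>t - s\<bar> < s" using s0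
        by (auto simp: dist_real_def min_def split: if_splits intro: less_le_trans)
      have "\<bar>t / s - 1\<bar> = \<bar>t - s\<bar> / s" using s0 by (simp add: field_simps abs_if)
      then have "\<bar>t / s - 1\<bar> < d" using t(1) s0 by (simp add: divide_less_eq mult.commute)
      then have "(t / s) *\<^sub>R (s *\<^sub>R x) \<in> M" by (rule d(2))
      then show "t \<in> J" using t(2) s0 by (simp add: J_def)
    qed (use s0 d in simp)
  qed
  have one: "1 \<in> J" using x by (simp add: J_def)
  have cK: "closed ?K" using K by (rule compact_imp_closed)
  have cr: "continuous_on UNIV (\<lambda>s::real. s *\<^sub>R x)" by (intro continuous_intros)
  have clKr: "closed ((\<lambda>s::real. s *\<^sub>R x) -` ?K)" by (rule closed_vimage[OF cK cr])
  have JK: "J \<subseteq> (\<lambda>s::real. s *\<^sub>R x) -` ?K" by (auto simp: J_def)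
  have limK: "s *\<^sub>R x \<in> ?K" if "s \<in> closure J" for s
    using closure_minimal[OF JK clKr] that by blast
  have nR: "r * norm x = R" if "r *\<^sub>R x \<in> \<gamma>" "0 \<le> r" for r
    using R that by auto
  define T where "T = {1..} - J"
  have Tne: "T \<noteq> {}"
  proof -
    obtain b where b: "\<And>z. z \<in> ?K \<Longrightarrow> norm z \<le> b" using compact_imp_bounded[OF K] unfolding bounded_iff by auto
    have "norm x \<le> b" using b x(1) by blast
    then have b0: "0 \<le> b" using norm_ge_zero[of x] by linarith
    \<comment> \<open>Chosen so that the scaled point has norm \<open>2 |x| + b\<close>, beyond the
      bound \<open>b\<close> of the compact set.\<close>
    define s where "s = 1 + b / norm x + 1"
    have "norm (s *\<^sub>R x) = s * norm x" using b0 by (simp add: s_def)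
    also have "\<dots> = 2 * norm x + b" using x(2) by (simp add: s_def field_simps)
    finally have "norm (s *\<^sub>R x) > b" using x(2) by simp
    then have "s *\<^sub>R x \<notin> M" using b by force
    then have "s \<in> T" using b0 by (auto simp: T_def J_def s_def)
    then show ?thesis by blast
  qed
  have clT: "closed T" unfolding T_def using oJ by (intro closed_Diff) auto
  have bT: "bdd_below T" unfolding T_def by (intro bdd_belowI[of _ 1]) auto
  define s1 where "s1 = Inf T"
  have s1T: "s1 \<in> T" unfolding s1_def by (rule closed_contains_Inf[OF Tne bT clT])
  have s1: "1 < s1" using s1T one by (cases "s1 = 1") (auto simp: T_def)
  have below: "s \<in> J" if "1 \<le> s" "s < s1" for s
  proof (rule ccontr)
    assume "s \<notin> J"
    then have "s \<in> T" using that by (simp add: T_def)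
    then have "s1 \<le> s" unfolding s1_def by (rule cInf_lower[OF _ bT])
    then show False using that by simp
  qed
  have "s1 \<in> closure J"
  proof -
    have "{1..<s1} \<subseteq> J" using below by auto
    then have "closure {1..<s1} \<subseteq> closure J" by (rule closure_mono)
    moreover have "s1 \<in> closure {1..<s1}" using s1 by (simp add: closure_atLeastLessThan)
    ultimately show ?thesis by blast
  qed
  then have "s1 *\<^sub>R x \<in> ?K" by (rule limK)
  moreover have "s1 *\<^sub>R x \<notin> M" using s1T s1 by (auto simp: T_def J_def)
  ultimately have p: "s1 *\<^sub>R x \<in> \<gamma>" by blast
  \<comment> \<open>An exit between the origin and \<open>x\<close> would lie at distance
    \<open>R\<close> as well, and on one ray this distance determines the scale, which is
    \<open>s1\<close>.\<close>
  have down: "t \<in> J" if t: "0 < t" "t \<le> 1" for t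
  proof (rule ccontr)
    assume nt: "t \<notin> J"
    define Q where "Q = {t..1} - J"
    have Q: "Q \<noteq> {}" "closed Q" "bdd_above Q"
      using nt t oJ unfolding Q_def by (auto intro!: bdd_aboveI[of _ 1])
    define q where "q = Sup Q"
    have qQ: "q \<in> Q" unfolding q_def by (rule closed_contains_Sup[OF Q(1,3,2)])
    have q: "t \<le> q" "q < 1" "q \<notin> J" using qQ one by (auto simp: Q_def less_le)
    have "s \<in> J" if "q < s" "s \<le> 1" for s
    proof (rule ccontr)
      assume "s \<notin> J"
      then have "s \<in> Q" using that q by (simp add: Q_def)
      then have "s \<le> q" unfolding q_def by (rule cSup_upper[OF _ Q(3)])
      then show False using that by simp
    qed
    then have "closure {q<..1} \<subseteq> closure J" by (intro closure_mono) auto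
    then have "q \<in> closure J" using q(2) by (auto simp: closure_greaterThanAtMost)
    then have "q *\<^sub>R x \<in> ?K" by (rule limK)
    then have "q *\<^sub>R x \<in> \<gamma>" using q t by (auto simp: J_def)
    then have "q * norm x = R" using nR q t by simp
    moreover have "s1 * norm x = R" using nR[OF p] s1 by simp
    ultimately have "q = s1" using x(2) by (metis mult_right_cancel norm_eq_zero)
    then show False using q s1 by simp
  qed
  have all: "r *\<^sub>R x \<in> ?K" if "0 \<le> r" "r \<le> s1" for r
  proof -
    \<comment> \<open>Taking the closure adds the vertex and the end point on \<gamma>.\<close>
    have "{0<..<s1} \<subseteq> J" using below down by (metis greaterThanLessThan_iff linear subsetI)
    then have "closure {0<..<s1} \<subseteq> closure J" by (rule closure_mono)
    then have "r \<in> closure J" using that s1 by (auto simp: closure_greaterThanLessThan)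
    then show ?thesis by (rule limK)
  qed
  show thesis
  proof (rule that[OF p])
    show "x \<in> closed_segment 0 (s1 *\<^sub>R x)"
      unfolding in_segment by (intro exI[of _ "1 / s1"]) (use s1 in auto)
    show "closed_segment 0 (s1 *\<^sub>R x) \<subseteq> ?K"
    proof
      fix z assume "z \<in> closed_segment 0 (s1 *\<^sub>R x)"
      then obtain u where u: "0 \<le> u" "u \<le> 1" "z = (u * s1) *\<^sub>R x" unfolding in_segment by auto
      have "u * s1 \<le> 1 * s1" using u s1 by (intro mult_right_mono) auto
      then show "z \<in> ?K" unfolding u(3) using u(1) s1 by (intro all) auto
    qed
  qed
qed

text \<open>Tangency makes \<open>M\<close> locally a cone, and \<open>ray_meets_boundary\<close>
  puts its nonzero points on segments to \<gamma>. The converse inclusion rests on every boundary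
  point being a limit of points of \<open>M\<close>: their segments lie in the closed set
  \<open>M \<union> \<gamma>\<close> and converge to the given one.\<close>

lemma minimal_equals_cone:
  fixes M \<gamma> :: "(real^'n) set"
  assumes M: "minimal_submanifold TYPE('k::finite) M" and hb: "has_boundary CARD('k) M \<gamma>"
    and R: "0 < R" "\<gamma> \<subseteq> sphere 0 R" and em: "euclidean_minimising TYPE('k) (radial_cone \<gamma>) \<gamma>"
  shows "M \<union> \<gamma> = radial_cone \<gamma>"
proof -
  define i0 :: 'k where "i0 = undefined"
  let ?K = "M \<union> \<gamma>"
  have dj: "M \<inter> \<gamma> = {}" and cK: "compact ?K" and sub: "submanifold_with_boundary CARD('k) ?K \<gamma>"
    using hb unfolding has_boundary_def by auto
  have collar: "\<exists>W U (f :: real^'k \<Rightarrow> real^'n) \<kappa>. p \<in> W \<and> collar_chart i0 ?K \<gamma> W U f \<kappa>" if "p \<in> ?K" for p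
    by (rule collar_chart_exists[OF sub that])
  have chart: "\<exists>W U (f :: real^'k \<Rightarrow> real^'n) \<kappa> u. pchart M f U W \<kappa> \<and> u \<in> U \<and> x = f u" if x: "x \<in> M" for x
  proof -
    obtain W U and f :: "real^'k \<Rightarrow> real^'n" and \<kappa> where c: "x \<in> W" "collar_chart i0 ?K \<gamma> W U f \<kappa>"
      using collar[of x] x by blast
    have ch: "pchart M f {u \<in> U. 0 < u $ i0} W \<kappa>" by (rule collar_chart_interior[OF c(2) dj])
    then have "x \<in> f ` {u \<in> U. 0 < u $ i0}" using pchart_image[OF ch] x c(1) by blast
    then show ?thesis using ch by blast
  qed
  have lc: "\<exists>d>0. \<forall>s. \<bar>s - 1\<bar> < d \<longrightarrow> s *\<^sub>R x \<in> M" if x: "x \<in> M" for x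
  proof -
    obtain W U and f :: "real^'k \<Rightarrow> real^'n" and \<kappa> u where c: "pchart M f U W \<kappa>" "u \<in> U" "x = f u"
      using chart[OF x] by blast
    have "tpart f v = f v" if "v \<in> U" for v
      by (rule minimal_tangent_position[OF M hb R em c(1) that])
    then show ?thesis unfolding c(3) by (rule tangent_position_local_cone[OF c(1) _ c(2)])
  qed
  \<comment> \<open>This concerns the origin, which lies in the cone only if \<gamma> is nonempty; a
    second point of the chart supplies a ray and thus a point of \<gamma>.\<close>
  have nonzero: "\<exists>y\<in>M. y \<noteq> 0" if x: "x \<in> M" for x
  proof -
    obtain W U and f :: "real^'k \<Rightarrow> real^'n" and \<kappa> u where c: "pchart M f U W \<kappa>" "u \<in> U" "x = f u"
      using chart[OF x] by blast
    note p = pchart_param[OF c(1)]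
    obtain e where e: "0 < e" "ball u e \<subseteq> U" using param_open[OF p] c(2) open_contains_ball by blast
    let ?v = "u + axis i0 (e / 2)"
    have na: "norm (axis i0 (e / 2) :: real^'k) = e / 2"
    proof -
      have "axis i0 (e / 2) = (e / 2) *\<^sub>R (axis i0 1 :: real^'k)" by (auto simp: vec_eq_iff axis_def)
      then show ?thesis using e(1) by simp
    qed
    then have v: "?v \<in> U" using e by (intro subsetD[OF e(2)]) (simp add: dist_norm)
    have "?v \<noteq> u" using na e(1) by auto
    then have "f ?v \<noteq> f u" using param_inj[OF p] v c(2) by (auto dest: inj_onD)
    moreover have "f ` U \<subseteq> M" using pchart_image[OF c(1)] by blast
    then have "f ?v \<in> M" "f u \<in> M" using v c(2) by auto
    ultimately show ?thesis by (cases "f u = 0") auto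
  qed
  have ray: "\<exists>p\<in>\<gamma>. x \<in> closed_segment 0 p \<and> closed_segment 0 p \<subseteq> ?K" if "x \<in> M" "x \<noteq> 0" for x
  proof (rule ray_meets_boundary[OF _ cK R(2) that])
    show "\<exists>d>0. \<forall>s. \<bar>s - 1\<bar> < d \<longrightarrow> s *\<^sub>R x \<in> M" if "x \<in> M" for x by (rule lc[OF that])
    fix p assume "p \<in> \<gamma>" "x \<in> closed_segment 0 p" "closed_segment 0 p \<subseteq> ?K"
    then show "\<exists>p\<in>\<gamma>. x \<in> closed_segment 0 p \<and> closed_segment 0 p \<subseteq> ?K" by blast
  qed
  have limit: "\<exists>x\<in>M. dist x p < e" if p: "p \<in> \<gamma>" and e: "0 < e" for p e
  proof -
    obtain W U and f :: "real^'k \<Rightarrow> real^'n" and \<kappa> where c: "p \<in> W" "collar_chart i0 ?K \<gamma> W U f \<kappa>"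
      using collar[of p] p by blast
    have c': "C1_parametrisation f U" "\<gamma> \<inter> W = f ` {u \<in> U. u $ i0 = 0}"
      using c(2) unfolding collar_chart_def by auto
    obtain y where y: "y \<in> U" "y $ i0 = 0" "p = f y" using c'(2) c(1) p by auto
    obtain d1 where d1: "0 < d1" "ball y d1 \<subseteq> U" using param_open[OF c'(1)] y(1) open_contains_ball by blast
    obtain d2 where d2: "0 < d2" "\<And>u. u \<in> U \<Longrightarrow> dist u y < d2 \<Longrightarrow> dist (f u) (f y) < e"
      using param_continuous[OF c'(1)] y(1) e unfolding continuous_on_iff by blast
    define r where "r = min d1 d2 / 2"
    have r: "0 < r" "r < d1" "r < d2" using d1 d2 by (auto simp: r_def min_def)
    \<comment> \<open>A small step in the positive direction of coordinate \<open>i0\<close> leads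
      from \<gamma> into \<open>M\<close>.\<close>
    let ?u = "y + axis i0 r"
    have du: "dist ?u y = r" using r by (simp add: dist_norm norm_eq_sqrt_inner[of "axis i0 _"] inner_axis_axis)
    have u: "?u \<in> U" using du r by (intro subsetD[OF d1(2)]) (simp add: dist_commute)
    have "0 < ?u $ i0" using y(2) r by simp
    then have "f ?u \<in> M" using pchart_image[OF collar_chart_interior[OF c(2) dj]] u by blast
    then show ?thesis using d2(2)[OF u] du r y(3) by auto
  qed
  show ?thesis
  proof (intro equalityI subsetI)
    fix x assume x: "x \<in> ?K"
    show "x \<in> radial_cone \<gamma>"
    proof (cases "x \<in> \<gamma>")
      case True
      then show ?thesis unfolding radial_cone_def by (intro UN_I[of x]) auto
    next
      case False
      then have xM: "x \<in> M" using x by blast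
      show ?thesis
      proof (cases "x = 0")
        case True
        obtain y where "y \<in> M" "y \<noteq> 0" using nonzero[OF xM] by blast
        then obtain p where "p \<in> \<gamma>" using ray by blast
        then show ?thesis unfolding radial_cone_def True by (intro UN_I[of p]) auto
      next
        case False
        then show ?thesis using ray[OF xM] unfolding radial_cone_def by blast
      qed
    qed
  next
    fix z assume "z \<in> radial_cone \<gamma>"
    then obtain p where p: "p \<in> \<gamma>" "z \<in> closed_segment 0 p" unfolding radial_cone_def by blast
    then obtain u where u: "0 \<le> u" "u \<le> 1" "z = u *\<^sub>R p" unfolding in_segment by auto
    note z = p(1) u
    have np: "norm p = R" using z(1) R(2) by auto
    \<comment> \<open>For \<open>x\<close> in \<open>M\<close> this is the point at fraction
      \<open>u\<close> on the segment from the origin through \<open>x\<close> to \<gamma>. At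
      \<open>p\<close> it is \<open>z\<close>, and continuity carries membership over to the
      limit.\<close>
    define q where "q x = u *\<^sub>R ((R / norm x) *\<^sub>R x)" for x :: "real^'n"
    have qK: "q x \<in> ?K" if x: "x \<in> M" "x \<noteq> 0" for x
    proof -
      obtain p' where p': "p' \<in> \<gamma>" "x \<in> closed_segment 0 p'" "closed_segment 0 p' \<subseteq> ?K" using ray[OF x] by blast
      obtain t where t: "0 \<le> t" "x = t *\<^sub>R p'" using p'(2) unfolding in_segment by auto
      have "norm p' = R" using p'(1) R(2) by auto
      moreover have "t \<noteq> 0" using t x by auto
      ultimately have "(R / norm x) *\<^sub>R x = p'" using t R(1) by simp
      then have "q x = u *\<^sub>R p'" by (simp add: q_def)
      moreover have "u *\<^sub>R p' \<in> closed_segment 0 p'" unfolding in_segment using z by (intro exI[of _ u]) simp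
      ultimately show ?thesis using p'(3) by auto
    qed
    have cq: "continuous_on (- {0}) q" unfolding q_def by (intro continuous_intros) auto
    have p0: "p \<in> - {0}" using np R(1) by auto
    have qp: "q p = z" using np R(1) z(4) by (simp add: q_def)
    have "z \<in> closure ?K"
      unfolding closure_approachable
    proof (intro allI impI)
      fix e :: real assume "0 < e"
      then obtain d where d: "0 < d" "\<And>x. x \<in> - {0} \<Longrightarrow> dist x p < d \<Longrightarrow> dist (q x) (q p) < e"
        using cq p0 unfolding continuous_on_iff by blast
      obtain x where x: "x \<in> M" "dist x p < min d R" using limit[OF z(1), of "min d R"] d(1) R(1) by auto
      have "x \<noteq> 0" using x(2) np by auto
      then show "\<exists>y\<in>?K. dist y z < e" using qK[OF x(1)] d(2)[of x] x(2) qp by auto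
    qed
    then show "z \<in> ?K" using closure_closed[OF compact_imp_closed[OF cK]] by blast
  qed
qed

text \<open>The Euclidean radius is \<open>tanh (\<rho> / 2)\<close>, written with
  exponentials.\<close>

lemma geodesic_sphere_subset_sphere:
  assumes "0 < \<rho>"
  obtains R where "0 < R" "(geodesic_sphere \<rho> :: (real^'n) set) \<subseteq> sphere 0 R"
proof
  let ?R = "(exp \<rho> - 1) / (exp \<rho> + 1)"
  have e: "1 < exp \<rho>" using assms by simp
  show "0 < ?R" by (intro divide_pos_pos) (use e in linarith)+
  show "(geodesic_sphere \<rho> :: (real^'n) set) \<subseteq> sphere 0 ?R"
  proof
    fix x :: "real^'n" assume "x \<in> geodesic_sphere \<rho>"
    then have x: "norm x < 1" "2 * artanh (norm x) = \<rho>" by (auto simp: geodesic_sphere_def)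
    then have "ln ((1 + norm x) / (1 - norm x)) = \<rho>" by (simp add: artanh_def)
    moreover have "0 < (1 + norm x) / (1 - norm x)"
      using x(1) norm_ge_zero[of x] by (intro divide_pos_pos) linarith+
    ultimately have "exp \<rho> = (1 + norm x) / (1 - norm x)" by (metis exp_ln)
    then have "norm x * (exp \<rho> + 1) = exp \<rho> - 1" using x(1) by (simp add: field_simps)
    moreover have "exp \<rho> + 1 \<noteq> 0" using e by linarith
    ultimately have "norm x = ?R" by (metis nonzero_eq_divide_eq)
    then show "x \<in> sphere 0 ?R" by simp
  qed
qed

theorem proposition4p10:
  fixes \<gamma> :: "(real^'n) set"
  assumes "submanifold (CARD('k::finite) - 1) \<gamma>"
    and "euclidean_minimising TYPE('k) (radial_cone \<gamma>) \<gamma>"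
  shows "(\<gamma> \<subseteq> sphere 0 1 \<longrightarrow>
            \<not> (\<exists>M. minimal_submanifold TYPE('k) M \<and> has_ideal_boundary CARD('k) M \<gamma> \<and>
                    M \<union> \<gamma> \<noteq> radial_cone \<gamma>))
       \<and> (\<forall>\<rho>>0. \<gamma> \<subseteq> geodesic_sphere \<rho> \<longrightarrow>
            \<not> (\<exists>M. minimal_submanifold TYPE('k) M \<and> has_boundary CARD('k) M \<gamma> \<and>
                    M \<union> \<gamma> \<noteq> radial_cone \<gamma>))"
proof (intro conjI allI impI notI; elim exE conjE)
  fix M
  assume \<gamma>: "\<gamma> \<subseteq> sphere 0 1"
    and M: "minimal_submanifold TYPE('k) M" "has_ideal_boundary CARD('k) M \<gamma>" "M \<union> \<gamma> \<noteq> radial_cone \<gamma>"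
  have "has_boundary CARD('k) M \<gamma>" using M(2) unfolding has_ideal_boundary_def by blast
  \<comment> \<open>The sphere at infinity is the case \<open>R = 1\<close>.\<close>
  from minimal_equals_cone[OF M(1) this zero_less_one \<gamma> assms(2)] show False using M(3) by blast
next
  fix \<rho> :: real and M
  assume \<rho>: "0 < \<rho>" "\<gamma> \<subseteq> geodesic_sphere \<rho>"
    and M: "minimal_submanifold TYPE('k) M" "has_boundary CARD('k) M \<gamma>" "M \<union> \<gamma> \<noteq> radial_cone \<gamma>"
  obtain R where "0 < R" "geodesic_sphere \<rho> \<subseteq> sphere (0 :: real^'n) R"
    using geodesic_sphere_subset_sphere[OF \<rho>(1)] by blast
  then show False using minimal_equals_cone[OF M(1,2) _ _ assms(2)] \<rho>(2) M(3) by blast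
qed

end
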